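(* Let $A\in\mathbb{R}^{n\times n}$ be symmetric with eigenvalues $$\lambda_1<\cdots<\lambda_k<\lambda_{k+1}\le\cdots\le\lambda_n,$$ and let $q_1\in\mathbb{R}^n$ with $\|q_1\|=1$. Let $U\in\mathbb{R}^{n\times k}$ contain the (orthonormal) Ritz vectors returned by Lanczos with compression, run in exact arithmetic with initial vector $q_1$, after $N_{\mathrm{comp}}$ compressions and $\mathrm{Lan}$ matrix-vector multiplications with $A$, and let $T_{\mathrm{Lan}}\in\mathbb{R}^{\mathrm{Lan}\times\mathrm{Lan}}$ be the tridiagonal matrix from the (uncompressed) Lanczos decomposition with the same initial vector $q_1$ after $\mathrm{Lan}$ steps. Let $0<\mathrm{tol}_{\mathrm{ra}}<1/2$ be a uniform upper bound for the tolerance of the rational approximations used in all compressions. Then $$\mathrm{Tr}(U^{\mathsf T}AU)-\sum_{i=1}^k\lambda_i(T_{\mathrm{Lan}})\le 4k\,N_{\mathrm{comp}}\,(\lambda_n-\lambda_1)\,\mathrm{tol}_{\mathrm{ra}}^2,$$ where $\lambda_i(T_{\mathrm{Lan}})$ denotes the $i$th smallest eigenvalue of $T_{\mathrm{Lan}}$.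
   Context: Lanczos process. From a unit vector $q_1$, generate $q_{i+1}=\beta_i^{-1}(Aq_i-\alpha_iq_i-\beta_{i-1}q_{i-1})$ with $\alpha_i=q_i^{\mathsf T}Aq_i$, $\beta_0q_0=0$ and $\beta_i>0$ normalizing $q_{i+1}$ (breakdown is assumed not to occur). $T_{\mathrm{Lan}}$ is the symmetric tridiagonal matrix with diagonal $\alpha_1,\dots,\alpha_{\mathrm{Lan}}$ and off-diagonal $\beta_1,\dots,\beta_{\mathrm{Lan}-1}$; thus $T_{\mathrm{Lan}}=Q_{\mathrm{Lan}}^{\mathsf T}AQ_{\mathrm{Lan}}$ with $Q_{\mathrm{Lan}}=[q_1,\dots,q_{\mathrm{Lan}}]$ having orthonormal columns. Step function: $\chi_\tau(x)=1$ if $x<\tau$, and $0$ otherwise. Rational Krylov subspace. For a real rational function $r=p/q$, with extended list of poles $\Xi$ (the zeros of $q$ with multiplicities, supplemented by infinite poles, counted so that $|\Xi|=\max\{\deg p,\deg q\}+1$), and a symmetric matrix $T_m\in\mathbb{R}^{m\times m}$, $$\mathcal{Q}(T_m,e_m,\Xi)=\{\widetilde p(T_m)q(T_m)^{-1}e_m:\ \widetilde p\text{ a real polynomial},\ \deg\widetilde p\le\max\{\deg p,\deg q\}\},$$ where $e_m$ is the last unit vector of $\mathbb{R}^m$; its dimension is assumed to be the generic one, $|\Xi|\le m$. Lanczos with compression (exact arithmetic), with $k<m$. Run the Lanczos process to obtain $q_1,\dots,q_m,q_{m+1}$ and set $Q_m^{(0)}=[q_1,\dots,q_m]$. In round $c=0,1,2,\dots$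 one has an orthonormal $Q_m^{(c)}\in\mathbb{R}^{n\times m}$, the projected matrix $T_m^{(c)}=(Q_m^{(c)})^{\mathsf T}AQ_m^{(c)}$, and the next Lanczos vector $q_{i+1}$, where $i$ is the number of matrix-vector products performed so far. Either the method stops and returns $U=Q_m^{(c)}S_k$, where $S_k\in\mathbb{R}^{m\times k}$ contains orthonormal eigenvectors of $T_m^{(c)}$ for its $k$ smallest eigenvalues (then $N_{\mathrm{comp}}=c$ and $\mathrm{Lan}=i$), or it performs a compression: an orthonormal matrix $V_\ell^{(c)}\in\mathbb{R}^{m\times\ell}$ is computed ($\ell<m$ may depend on $c$), $Q_\ell^{(c+1)}=Q_m^{(c)}V_\ell^{(c)}$ is formed, and this basis is expanded by the next $m-\ell$ Lanczos vectors, $Q_m^{(c+1)}=[Q_\ell^{(c+1)},q_{i+1},\dots,q_{i+m-\ell}]$, the Lanczos process being continued by orthogonalizing $A$ times the last vector against the current basis (in exact arithmetic this reproduces the uncompressed Lanczos vectors, since $e_m\in\mathrm{range}(V_\ell^{(c)})$). Compression matrix. Let $\theta_1\le\cdots\le\theta_m$ and $s_1,\dots,s_m$ be the eigenvalues and orthonormal eigenvectors of $T_m^{(c)}$. For $\widehat k\in\{k,\dots,m-1\}$ with $\theta_k<\theta_{\widehat k+1}$ put $\tau=(\theta_k+\theta_{\widehat k+1})/2$, $\delta=(\theta_{\widehat k+1}-\theta_k)/2$, $\eta=\theta_m-\tau$, and $d_{\widehat k}=\lceil\frac{2}{\pi^2}\log(4/\mathrm{tol}_{\mathrm{ra}})\log(4\eta/\delta)\rceil$.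 Choose $\widehat k$ minimizing $\widehat k+d_{\widehat k}$, let $r_\tau$ be a best uniform approximation to $\chi_\tau$ on $[\tau-\eta,\tau+\eta]\setminus(\tau-\delta,\tau+\delta)$ among real rational functions of degree at most $d_{\widehat k}$, let $\Xi_{\widehat k}$ be its poles, and let $V_\ell^{(c)}$ be an orthonormal basis of $\mathrm{span}\{s_1,\dots,s_{\widehat k}\}+\mathcal{Q}(T_m^{(c)},e_m,\Xi_{\widehat k})$. Tolerance assumption. That $\mathrm{tol}_{\mathrm{ra}}$ is a uniform upper bound for the tolerance of rational approximation means that in every compression $$|r_\tau(x)-\chi_\tau(x)|<\mathrm{tol}_{\mathrm{ra}}\quad\text{for every }x\in[\lambda_1,\theta_m]\setminus(\theta_k,\theta_{\widehat k+1}),$$ with $\lambda_1$ the smallest eigenvalue of $A$ and $\theta_i,\tau,\widehat k$ those of that compression. It is also assumed that the zeros of the denominator of $r_\tau$ are not eigenvalues of $T_m^{(c)}$ nor of $T^{(c)}$, where $T^{(0)}=T_{\mathrm{Lan}}$ and $T^{(c+1)}=P_c^{\mathsf T}T^{(c)}P_c$ with $P_c=\mathrm{diag}(V_\ell^{(c)},I)$. *)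

theory Defs
  imports
    "Jordan_Normal_Form.Char_Poly"
    "Jordan_Normal_Form.VS_Connect"
    "Jordan_Normal_Form.Gauss_Jordan_Elimination"
begin

section \<open>Matrices\<close>

definition vnorm :: "real vec \<Rightarrow> real" where
  "vnorm v = sqrt (v \<bullet> v)"

definition mat_trace :: "real mat \<Rightarrow> real" where
  "mat_trace M = (\<Sum>i<dim_row M. M $$ (i, i))"

definition orthonormal_cols :: "real mat \<Rightarrow> bool" where
  "orthonormal_cols V \<longleftrightarrow> V\<^sup>T * V = 1\<^sub>m (dim_col V)"

text \<open>The \<open>i\<close>-th smallest real eigenvalue, counted from \<open>1\<close> and with algebraic multiplicity.
  For a symmetric \<open>M\<close> of order \<open>n\<close> all \<open>n\<close> roots of the characteristic polynomial are real,
  so this is meaningful for \<open>1 \<le> i \<le> n\<close>.\<close>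

definition eigval :: "real mat \<Rightarrow> nat \<Rightarrow> real" where
  "eigval M i = sorted_list_of_multiset (proots (char_poly M)) ! (i - 1)"

text \<open>The columns of \<open>S\<close> are orthonormal eigenvectors for the \<open>j\<close> smallest eigenvalues;
  the eigenvector \<open>s\<^sub>i\<close> is \<open>col S (i - 1)\<close>.\<close>

definition ordered_eigenvectors :: "real mat \<Rightarrow> nat \<Rightarrow> real mat \<Rightarrow> bool" where
  "ordered_eigenvectors T j S \<longleftrightarrow>
     S \<in> carrier_mat (dim_row T) j \<and> orthonormal_cols S \<and>
     (\<forall>i\<in>{1..j}. T *\<^sub>v col S (i - 1) = eigval T i \<cdot>\<^sub>v col S (i - 1))"

definition poly_mat :: "real poly \<Rightarrow> real mat \<Rightarrow> real mat" where
  "poly_mat p T =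
     mat (dim_row T) (dim_row T) (\<lambda>(i, j). \<Sum>e\<le>degree p. coeff p e * (T ^\<^sub>m e) $$ (i, j))"

definition inv_mat :: "real mat \<Rightarrow> real mat" where
  "inv_mat M = the (mat_inverse M)"

definition subspace_dim :: "nat \<Rightarrow> real vec set \<Rightarrow> nat" where
  "subspace_dim n W = vectorspace.dim class_ring ((module_vec TYPE(real) n)\<lparr>carrier := W\<rparr>)"


section \<open>The Lanczos process\<close>

text \<open>\<open>N\<close> steps of the process produce \<open>q\<^sub>1, \<dots>, q\<^sub>N\<close>, \<open>\<alpha>\<^sub>1, \<dots>, \<alpha>\<^sub>N\<close> and
  \<open>\<beta>\<^sub>1, \<dots>, \<beta>\<^sub>N\<^sub>-\<^sub>1\<close>.  Absence of breakdown is demanded only where it is needed to obtain these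
  data; \<open>\<beta>\<^sub>N = 0\<close> is permitted.\<close>

definition lanczos_process ::
    "real mat \<Rightarrow> real vec \<Rightarrow> nat \<Rightarrow> (nat \<Rightarrow> real vec) \<Rightarrow> (nat \<Rightarrow> real) \<Rightarrow> (nat \<Rightarrow> real) \<Rightarrow> bool" where
  "lanczos_process A q1 N q \<alpha> \<beta> \<longleftrightarrow>
     q 0 = 0\<^sub>v (dim_row A) \<and> \<beta> 0 = 0 \<and> q 1 = q1 \<and>
     (\<forall>i\<in>{1..N}. \<alpha> i = q i \<bullet> (A *\<^sub>v q i)) \<and>
     (\<forall>i\<in>{1..<N}. \<beta> i > 0 \<and> vnorm (q (i + 1)) = 1 \<and>
        q (i + 1) = (1 / \<beta> i) \<cdot>\<^sub>v (A *\<^sub>v q i - \<alpha> i \<cdot>\<^sub>v q i - \<beta> (i - 1) \<cdot>\<^sub>v q (i - 1)))"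

definition lanczos_tridiag :: "(nat \<Rightarrow> real) \<Rightarrow> (nat \<Rightarrow> real) \<Rightarrow> nat \<Rightarrow> real mat" where
  "lanczos_tridiag \<alpha> \<beta> N = mat N N (\<lambda>(i, j).
     if i = j then \<alpha> (i + 1) else if j = i + 1 then \<beta> j else if i = j + 1 then \<beta> i else 0)"


section \<open>Rational approximation of the step function\<close>

definition step_fun :: "real \<Rightarrow> real \<Rightarrow> real" where
  "step_fun \<tau> x = (if x < \<tau> then 1 else 0)"

text \<open>A rational function is represented by numerator and denominator.  The suprema range over
  continuous functions on \<open>E\<close>, so they are genuine maxima if \<open>E\<close> is compact and nonempty.\<close>

definition rational_on :: "nat \<Rightarrow> real set \<Rightarrow> real poly \<Rightarrow> real poly \<Rightarrow> bool" where
  "rational_on d E p q \<longleftrightarrow> degree p \<le> d \<and> degree q \<le> d \<and> q \<noteq> 0 \<and> (\<forall>x\<in>E. poly q x \<noteq> 0)"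

definition best_rational_approx ::
    "nat \<Rightarrow> real set \<Rightarrow> (real \<Rightarrow> real) \<Rightarrow> real poly \<Rightarrow> real poly \<Rightarrow> bool" where
  "best_rational_approx d E f p q \<longleftrightarrow>
     coprime p q \<and> rational_on d E p q \<and>
     (\<forall>p' q'. rational_on d E p' q' \<longrightarrow>
        (SUP x\<in>E. \<bar>poly p x / poly q x - f x\<bar>) \<le> (SUP x\<in>E. \<bar>poly p' x / poly q' x - f x\<bar>))"

text \<open>Length \<open>|\<Xi>|\<close> of the extended list of poles of \<open>p / q\<close>.\<close>

definition num_poles :: "real poly \<Rightarrow> real poly \<Rightarrow> nat" where
  "num_poles p q = max (degree p) (degree q) + 1"

definition rational_krylov ::
    "real mat \<Rightarrow> real vec \<Rightarrow> real poly \<Rightarrow> real poly \<Rightarrow> real vec set" where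
  "rational_krylov T b p q =
     {(poly_mat p' T * inv_mat (poly_mat q T)) *\<^sub>v b | p'. degree p' \<le> max (degree p) (degree q)}"


section \<open>The compression matrix\<close>

text \<open>Below, \<open>h\<close> is the number of retained eigenvectors (k-hat), \<open>k \<le> h < m\<close>.\<close>

definition split_tau :: "real mat \<Rightarrow> nat \<Rightarrow> nat \<Rightarrow> real" where
  "split_tau T k h = (eigval T k + eigval T (h + 1)) / 2"

definition split_delta :: "real mat \<Rightarrow> nat \<Rightarrow> nat \<Rightarrow> real" where
  "split_delta T k h = (eigval T (h + 1) - eigval T k) / 2"

definition split_eta :: "real mat \<Rightarrow> nat \<Rightarrow> nat \<Rightarrow> real" where
  "split_eta T k h = eigval T (dim_row T) - split_tau T k h"

definition split_degree :: "real \<Rightarrow> real mat \<Rightarrow> nat \<Rightarrow> nat \<Rightarrow> nat" where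
  "split_degree tol T k h =
     nat \<lceil>2 / pi\<^sup>2 * ln (4 / tol) * ln (4 * split_eta T k h / split_delta T k h)\<rceil>"

definition optimal_split :: "real \<Rightarrow> real mat \<Rightarrow> nat \<Rightarrow> nat \<Rightarrow> bool" where
  "optimal_split tol T k h \<longleftrightarrow>
     is_arg_min (\<lambda>h. h + split_degree tol T k h)
       (\<lambda>h. h \<in> {k..dim_row T - 1} \<and> eigval T k < eigval T (h + 1)) h"

definition approx_domain :: "real mat \<Rightarrow> nat \<Rightarrow> nat \<Rightarrow> real set" where
  "approx_domain T k h =
     (let \<tau> = split_tau T k h; \<delta> = split_delta T k h; \<eta> = split_eta T k h
      in {\<tau> - \<eta>..\<tau> + \<eta>} - {\<tau> - \<delta><..<\<tau> + \<delta>})"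

text \<open>\<open>V\<close> may be returned as \<open>V\<^sub>\<ell>\<close> when compressing \<open>T\<close>, for the choices \<open>h\<close> of
  k-hat and \<open>p / q\<close> of \<open>r\<^sub>\<tau>\<close>; here \<open>\<ell> = dim_col V\<close>.\<close>

definition compression_matrix ::
    "real \<Rightarrow> nat \<Rightarrow> real mat \<Rightarrow> nat \<Rightarrow> real poly \<Rightarrow> real poly \<Rightarrow> real mat \<Rightarrow> bool" where
  "compression_matrix tol k T h p q V \<longleftrightarrow>
     (let m = dim_row T in
      optimal_split tol T k h \<and>
      best_rational_approx (split_degree tol T k h) (approx_domain T k h)
        (step_fun (split_tau T k h)) p q \<and>
      V \<in> carrier_mat m (dim_col V) \<and> dim_col V < m \<and> orthonormal_cols V \<and>
      (\<exists>S. ordered_eigenvectors T m S \<and>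
         vec_space.col_space m V =
           {u + w | u w. u \<in> vec_space.col_space m (mat_of_cols m (take h (cols S))) \<and>
                         w \<in> rational_krylov T (unit_vec m (m - 1)) p q}))"


section \<open>Lanczos with compression\<close>

text \<open>The state \<open>(Q, x, i)\<close> consists of the current basis, the next Lanczos vector and the number
  of matrix-vector products performed so far.  A Lanczos step appends \<open>x\<close> to the basis and obtains
  the new next vector by orthogonalizing \<open>A x\<close> against the whole enlarged basis.\<close>

definition orthogonalize :: "real mat \<Rightarrow> real vec \<Rightarrow> real vec" where
  "orthogonalize Q v = (let w = v - Q *\<^sub>v (Q\<^sup>T *\<^sub>v v) in (1 / vnorm w) \<cdot>\<^sub>v w)"

definition lanczos_step ::
    "real mat \<Rightarrow> real mat \<times> real vec \<times> nat \<Rightarrow> real mat \<times> real vec \<times> nat" where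
  "lanczos_step A = (\<lambda>(Q, x, i).
     let Q' = mat_of_cols (dim_row A) (cols Q @ [x])
     in (Q', orthogonalize Q' (A *\<^sub>v x), i + 1))"

text \<open>State after \<open>c\<close> compressions, the first \<open>m\<close> vectors \<open>q\<^sub>1, \<dots>, q\<^sub>m\<close> and the next vector
  \<open>q\<^sub>m\<^sub>+\<^sub>1\<close> being taken from the Lanczos process and \<open>V c\<close> being the matrix used in compression \<open>c\<close>.\<close>

primrec lc_state ::
    "real mat \<Rightarrow> (nat \<Rightarrow> real vec) \<Rightarrow> nat \<Rightarrow> (nat \<Rightarrow> real mat) \<Rightarrow> nat \<Rightarrow> real mat \<times> real vec \<times> nat" where
  "lc_state A q m V 0 = (mat_of_cols (dim_row A) (map q [1..<m + 1]), q (m + 1), m)"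
| "lc_state A q m V (Suc c) =
     (let (Q, x, i) = lc_state A q m V c
      in (lanczos_step A ^^ (m - dim_col (V c))) (Q * V c, x, i))"

definition lc_basis ::
    "real mat \<Rightarrow> (nat \<Rightarrow> real vec) \<Rightarrow> nat \<Rightarrow> (nat \<Rightarrow> real mat) \<Rightarrow> nat \<Rightarrow> real mat" where
  "lc_basis A q m V c = fst (lc_state A q m V c)"

definition lc_matvecs ::
    "real mat \<Rightarrow> (nat \<Rightarrow> real vec) \<Rightarrow> nat \<Rightarrow> (nat \<Rightarrow> real mat) \<Rightarrow> nat \<Rightarrow> nat" where
  "lc_matvecs A q m V c = snd (snd (lc_state A q m V c))"

definition lc_projected ::
    "real mat \<Rightarrow> (nat \<Rightarrow> real vec) \<Rightarrow> nat \<Rightarrow> (nat \<Rightarrow> real mat) \<Rightarrow> nat \<Rightarrow> real mat" where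
  "lc_projected A q m V c = (lc_basis A q m V c)\<^sup>T * A * lc_basis A q m V c"

text \<open>The matrices \<open>T\<^sup>(\<^sup>c\<^sup>)\<close>: the compressions applied to the whole of \<open>T\<^sub>L\<^sub>a\<^sub>n\<close>.\<close>

primrec compressed_tridiag :: "real mat \<Rightarrow> nat \<Rightarrow> (nat \<Rightarrow> real mat) \<Rightarrow> nat \<Rightarrow> real mat" where
  "compressed_tridiag T m V 0 = T"
| "compressed_tridiag T m V (Suc c) =
     (let T' = compressed_tridiag T m V c; P = diag_block_mat [V c, 1\<^sub>m (dim_row T' - m)]
      in P\<^sup>T * T' * P)"

end

theory Submission
  imports Defs "HOL-Computational_Algebra.Fundamental_Theorem_Algebra"
begin

text \<open>Complete the basis of each round by the Lanczos vectors still to come.  The projection of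
  \<open>A\<close> to the resulting basis is \<open>T\<^sup>(\<^sup>c\<^sup>)\<close>, and a compression replaces it by
  \<open>P\<^sup>T T\<^sup>(\<^sup>c\<^sup>) P\<close> with \<open>P = diag(V, I)\<close>; so it suffices to bound the increase of the sum
  of the \<open>k\<close> smallest eigenvalues in one such step.

  Let \<open>u\<close> be the leading part of an eigenvector of \<open>T\<^sup>(\<^sup>c\<^sup>)\<close> for one of the \<open>k\<close> smallest
  eigenvalues \<open>\<mu>\<close>.  As \<open>(T\<^sub>m - \<mu>) u\<close> is a multiple of \<open>e\<^sub>m\<close>, the vector \<open>r(T\<^sub>m) u - r(\<mu>) u\<close> lies
  in the rational Krylov space, and \<open>r(T\<^sub>m)\<close> is smaller than \<open>tol\<close> on the complement of the
  retained eigenvectors, while \<open>r(\<mu>)\<close> is within \<open>tol\<close> of \<open>1\<close>.  Hence every unit vector \<open>y\<close> in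
  the span of these \<open>k\<close> eigenvectors has distance at most \<open>tol / (1 - tol) \<le> 2 tol\<close> from the range
  of \<open>P\<close>.  Projecting the eigenvectors to that range and orthonormalizing gives trial vectors
  whose trace exceeds the minimum by at most the sum of the squared distances times the spread of
  the spectrum.\<close>

section \<open>Orthonormal columns\<close>

text \<open>That \<open>(T_m - \<mu>) u\<close> is a multiple of \<open>e_m\<close> requires that
  the leading block of order \<open>m\<close> be coupled to the other coordinates through its last
  row alone. Compression destroys tridiagonality but not this pattern: the last basis vector of
  every round is again a Lanczos vector, all later ones obey a three-term recurrence, and the
  recurrence ends in a residual orthogonal to the whole completed basis. That basis changes only by
  compression, never by expansion. After the last round nothing remains to be completed, so its
  projection is the final projected matrix.

  The distance must be bounded for the span of the \<open>k\<close> eigenvectors and not for each of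
  them, although the factors \<open>r(\<mu>)\<close> differ. They are divided into the coefficients
  of a combination, which costs \<open>1 / (1 - tol)\<close> once and no factor depending on
  \<open>k\<close>.

  The step function is \<open>1\<close> at each \<open>\<mu>\<close> because Poincare separation
  keeps \<open>\<mu>\<close> at or below the \<open>k\<close>-th eigenvalue of the block. Every
  matrix involved is a projection of \<open>A\<close> to orthonormal columns, so a single spread
  serves all rounds.\<close>

lemma orthonormal_cols_iff:
  "orthonormal_cols X \<longleftrightarrow>
     (\<forall>i<dim_col X. \<forall>j<dim_col X. col X i \<bullet> col X j = (if i = j then 1 else 0))"
  (is "_ \<longleftrightarrow> ?R")
proof
  assume "orthonormal_cols X"
  then have *: "X\<^sup>T * X = 1\<^sub>m (dim_col X)" by (simp add: orthonormal_cols_def)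
  show ?R
  proof (intro allI impI)
    fix i j assume ij: "i < dim_col X" "j < dim_col X"
    have "(X\<^sup>T * X) $$ (i, j) = col X i \<bullet> col X j" using ij by simp
    then show "col X i \<bullet> col X j = (if i = j then 1 else 0)" unfolding * using ij by simp
  qed
next
  assume ?R
  then show "orthonormal_cols X"
    unfolding orthonormal_cols_def by (intro eq_matI) auto
qed

lemma orthonormal_cols_mat_of_cols:
  assumes "\<And>i. i < k \<Longrightarrow> x i \<in> carrier_vec n"
    and "\<And>i j. i < k \<Longrightarrow> j < k \<Longrightarrow> x i \<bullet> x j = (if i = j then 1 else 0)"
  shows "orthonormal_cols (mat_of_cols n (map x [0..<k]))"
  unfolding orthonormal_cols_iff using assms by simp

lemma scalar_prod_mult_mat_vec:
  fixes A :: "real mat"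
  assumes "A \<in> carrier_mat n k" "v \<in> carrier_vec n" "a \<in> carrier_vec k"
  shows "v \<bullet> (A *\<^sub>v a) = (A\<^sup>T *\<^sub>v v) \<bullet> a" "(A *\<^sub>v a) \<bullet> v = a \<bullet> (A\<^sup>T *\<^sub>v v)"
proof -
  show 1: "v \<bullet> (A *\<^sub>v a) = (A\<^sup>T *\<^sub>v v) \<bullet> a"
    using transpose_vec_mult_scalar[OF assms(1,3,2)] by simp
  have "(A *\<^sub>v a) \<bullet> v = v \<bullet> (A *\<^sub>v a)" using assms by (intro comm_scalar_prod) auto
  also have "\<dots> = a \<bullet> (A\<^sup>T *\<^sub>v v)"
    unfolding 1 using assms by (intro comm_scalar_prod) auto
  finally show "(A *\<^sub>v a) \<bullet> v = a \<bullet> (A\<^sup>T *\<^sub>v v)" .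
qed

lemma orthonormal_cols_cancel:
  assumes "X \<in> carrier_mat n k" "orthonormal_cols X" "a \<in> carrier_vec k"
  shows "X\<^sup>T *\<^sub>v (X *\<^sub>v a) = a"
proof -
  have "X\<^sup>T *\<^sub>v (X *\<^sub>v a) = (X\<^sup>T * X) *\<^sub>v a"
    using assms by (intro assoc_mult_mat_vec[symmetric]) auto
  also have "\<dots> = a" using assms unfolding orthonormal_cols_def by simp
  finally show ?thesis .
qed

lemma orthonormal_cols_isometry:
  assumes "X \<in> carrier_mat n k" "orthonormal_cols X" "a \<in> carrier_vec k" "b \<in> carrier_vec k"
  shows "(X *\<^sub>v a) \<bullet> (X *\<^sub>v b) = a \<bullet> b"
  using assms scalar_prod_mult_mat_vec(1)[of X n k "X *\<^sub>v a" b]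
  by (simp add: orthonormal_cols_cancel)

lemma orthogonal_mat_transpose:
  assumes "X \<in> carrier_mat n n" "orthonormal_cols X"
  shows "X * X\<^sup>T = 1\<^sub>m n" "orthonormal_cols (X\<^sup>T)"
proof -
  show *: "X * X\<^sup>T = 1\<^sub>m n"
    by (rule mat_mult_left_right_inverse) (use assms in \<open>auto simp: orthonormal_cols_def\<close>)
  then show "orthonormal_cols (X\<^sup>T)" using assms by (simp add: orthonormal_cols_def)
qed

lemma scalar_prod_self_nonneg: "(v :: real vec) \<bullet> v \<ge> 0"
  unfolding scalar_prod_def by (intro sum_nonneg) auto

lemma scalar_prod_self_eq_0:
  assumes "(v :: real vec) \<in> carrier_vec n" "v \<bullet> v = 0"
  shows "v = 0\<^sub>v n"
  using assms by (intro eq_vecI) (auto simp: scalar_prod_def sum_nonneg_eq_0_iff)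

lemma scalar_prod_self_pos:
  assumes "(v :: real vec) \<in> carrier_vec n" "v \<noteq> 0\<^sub>v n"
  shows "v \<bullet> v > 0"
  using assms scalar_prod_self_eq_0[OF assms(1)] scalar_prod_self_nonneg[of v] by fastforce

lemma col_eq_mult_unit_vec:
  assumes "(X :: real mat) \<in> carrier_mat n k" "i < k"
  shows "col X i = X *\<^sub>v unit_vec k i"
  using assms by (intro eq_vecI) auto

lemma mult_mat_zero_vec:
  "(M :: real mat) \<in> carrier_mat n k \<Longrightarrow> M *\<^sub>v 0\<^sub>v k = 0\<^sub>v n"
  by (intro eq_vecI) (auto simp: scalar_prod_right_zero)

section \<open>The spectral theorem for real symmetric matrices\<close>

lemma real_symmetric_eigenvector:
  fixes A :: "real mat"
  assumes A: "A \<in> carrier_mat n n" "A\<^sup>T = A" and n: "n > 0"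
  shows "\<exists>e v. v \<in> carrier_vec n \<and> v \<bullet> v = 1 \<and> A *\<^sub>v v = e \<cdot>\<^sub>v v"
proof -
  let ?A = "map_mat complex_of_real A"
  have A': "?A \<in> carrier_mat n n" using A by simp
  have "degree (char_poly ?A) = n" using degree_monic_char_poly[OF A'] by simp
  then have "\<not> constant (poly (char_poly ?A))" using n by (simp add: constant_degree)
  then obtain z where "poly (char_poly ?A) z = 0" using fundamental_theorem_of_algebra by blast
  then have "eigenvalue ?A z" using eigenvalue_root_char_poly[OF A'] by simp
  then obtain w where w: "w \<in> carrier_vec n" "w \<noteq> 0\<^sub>v n" "?A *\<^sub>v w = z \<cdot>\<^sub>v w"
    using A' unfolding eigenvalue_def eigenvector_def by auto
  \<comment> \<open>the complex eigenvalue \<open>z\<close> is real: \<open>z * |w|\<^sup>2\<close> is the Hermitian form of \<open>A\<close> at \<open>w\<close>\<close>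
  let ?s = "\<Sum>i<n. \<Sum>j<n. complex_of_real (A $$ (i, j)) * (cnj (w $ i) * w $ j)"
  have row: "(\<Sum>j<n. complex_of_real (A $$ (i, j)) * w $ j) = z * w $ i" if "i < n" for i
  proof -
    have "(?A *\<^sub>v w) $ i = (\<Sum>j<n. complex_of_real (A $$ (i, j)) * w $ j)"
      using that A' w(1) A(1) by (auto simp: scalar_prod_def atLeast0LessThan intro!: sum.cong)
    then show ?thesis using w that by simp
  qed
  have s1: "?s = z * (\<Sum>i<n. cnj (w $ i) * w $ i)"
  proof -
    have "?s = (\<Sum>i<n. cnj (w $ i) * (\<Sum>j<n. complex_of_real (A $$ (i, j)) * w $ j))"
      by (simp add: sum_distrib_left mult_ac)
    also have "\<dots> = (\<Sum>i<n. cnj (w $ i) * (z * w $ i))" by (intro sum.cong) (auto simp: row)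
    also have "\<dots> = z * (\<Sum>i<n. cnj (w $ i) * w $ i)" by (simp add: sum_distrib_left mult_ac)
    finally show ?thesis .
  qed
  have sym: "A $$ (i, j) = A $$ (j, i)" if "i < n" "j < n" for i j
    using arg_cong[OF A(2), of "\<lambda>M. M $$ (j, i)"] that A(1) by simp
  have "cnj ?s = (\<Sum>i<n. \<Sum>j<n. complex_of_real (A $$ (i, j)) * (w $ i * cnj (w $ j)))" by simp
  also have "\<dots> = (\<Sum>j<n. \<Sum>i<n. complex_of_real (A $$ (i, j)) * (w $ i * cnj (w $ j)))"
    by (rule sum.swap)
  also have "\<dots> = ?s" by (intro sum.cong refl) (simp add: sym mult_ac)
  finally have s2: "cnj ?s = ?s" .
  define S where "S = (\<Sum>i<n. (cmod (w $ i))\<^sup>2)"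
  have S: "(\<Sum>i<n. cnj (w $ i) * w $ i) = of_real S"
    unfolding S_def of_real_sum by (intro sum.cong) (auto simp: complex_norm_square mult.commute simp del: of_real_power)
  have "S \<noteq> 0"
  proof
    assume "S = 0"
    then have "\<forall>i<n. w $ i = 0" unfolding S_def by (simp add: sum_nonneg_eq_0_iff)
    then have "w = 0\<^sub>v n" using w(1) by (intro eq_vecI) auto
    with w(2) show False by simp
  qed
  have "cnj z * of_real S = z * of_real S" using s2 unfolding s1 S by simp
  with \<open>S \<noteq> 0\<close> have "cnj z = z" by simp
  then obtain e where z: "z = of_real e" by (metis Reals_cnj_iff Reals_cases)
  \<comment> \<open>The complex eigenvector is dropped here. Only the root is carried back to the
    real characteristic polynomial, which then supplies a real eigenvector.\<close>
  have "of_real (poly (char_poly A) e) = poly (char_poly ?A) z"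
    unfolding z of_real_hom.char_poly_hom[OF A(1)] by simp
  then have "poly (char_poly A) e = 0" using \<open>poly (char_poly ?A) z = 0\<close> by simp
  then have "eigenvalue A e" using eigenvalue_root_char_poly[OF A(1)] by simp
  then obtain v where v: "v \<in> carrier_vec n" "v \<noteq> 0\<^sub>v n" "A *\<^sub>v v = e \<cdot>\<^sub>v v"
    using A unfolding eigenvalue_def eigenvector_def by auto
  define c where "c = 1 / sqrt (v \<bullet> v)"
  have pos: "v \<bullet> v > 0" using v scalar_prod_self_pos by blast
  have "(c \<cdot>\<^sub>v v) \<bullet> (c \<cdot>\<^sub>v v) = c * c * (v \<bullet> v)" using v by simp
  also have "\<dots> = 1" using pos by (simp add: c_def)
  finally have "(c \<cdot>\<^sub>v v) \<bullet> (c \<cdot>\<^sub>v v) = 1" .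
  moreover have "A *\<^sub>v (c \<cdot>\<^sub>v v) = e \<cdot>\<^sub>v (c \<cdot>\<^sub>v v)"
    using A v by (simp add: mult_mat_vec smult_smult_assoc mult.commute)
  ultimately show ?thesis using v by (intro exI[of _ e] exI[of _ "c \<cdot>\<^sub>v v"]) auto
qed

text \<open>The matrix is the Householder reflection exchanging \<open>v\<close> and the first unit vector.\<close>

lemma orthogonal_mat_first_col:
  fixes v :: "real vec"
  assumes v: "v \<in> carrier_vec n" "v \<bullet> v = 1" and n: "n > 0"
  shows "\<exists>H. H \<in> carrier_mat n n \<and> orthonormal_cols H \<and> col H 0 = v"
proof (cases "v = unit_vec n 0")
  case True
  then show ?thesis using n by (intro exI[of _ "1\<^sub>m n"]) (auto simp: orthonormal_cols_def)
next
  case False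
  define u where "u = v - unit_vec n 0"
  have u: "u \<in> carrier_vec n" using v by (simp add: u_def)
  have "u \<noteq> 0\<^sub>v n"
  proof
    assume *: "u = 0\<^sub>v n"
    have "v $ i = unit_vec n 0 $ i" if "i < n" for i
      using arg_cong[OF *, of "\<lambda>u. u $ i"] v that by (simp add: u_def)
    then have "v = unit_vec n 0" using v by (intro eq_vecI) auto
    with False show False by simp
  qed
  define c where "c = 2 / (u \<bullet> u)"
  have uu: "u \<bullet> u > 0" using u \<open>u \<noteq> 0\<^sub>v n\<close> scalar_prod_self_pos by blast
  have "u \<bullet> u = v \<bullet> v - v $ 0 - (v $ 0 - 1)"
    unfolding u_def using v n
    by (simp add: minus_scalar_prod_distrib[of _ n] scalar_prod_minus_distrib[of _ n])
  \<comment> \<open>This is where \<open>v\<close> being a unit vector enters: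
    \<open>u \<bullet> u = 2 - 2 * v $ 0\<close>. It makes \<open>c * u $ 0 = -1\<close>, so that
    column \<open>0\<close> of \<open>H\<close> is the first unit vector plus \<open>u\<close>,
    which is \<open>v\<close>.\<close>
  then have u0: "u \<bullet> u = - 2 * u $ 0" using v n by (simp add: u_def)
  define H where "H = mat n n (\<lambda>(i, j). (if i = j then 1 else 0) - c * u $ i * u $ j)"
  have H: "H \<in> carrier_mat n n" by (simp add: H_def)
  have colH: "col H j = unit_vec n j - (c * u $ j) \<cdot>\<^sub>v u" if "j < n" for j
    using that u by (intro eq_vecI) (auto simp: H_def)
  have "col H i \<bullet> col H j = (if i = j then 1 else 0)" if "i < n" "j < n" for i j
  proof -
    have "col H i \<bullet> col H j = unit_vec n i \<bullet> unit_vec n j - 2 * c * u $ i * u $ j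
        + c * u $ i * u $ j * (c * (u \<bullet> u))"
      unfolding colH[OF that(1)] colH[OF that(2)] using u that
      by (simp add: minus_scalar_prod_distrib[of _ n] scalar_prod_minus_distrib[of _ n] algebra_simps)
    also have "c * (u \<bullet> u) = 2" using uu by (simp add: c_def)
    finally show ?thesis using that by simp
  qed
  then have "orthonormal_cols H" unfolding orthonormal_cols_iff using H by auto
  moreover have "col H 0 = v"
  proof -
    have "c * u $ 0 = -1" using u0 uu by (simp add: c_def field_simps)
    then show ?thesis unfolding colH[OF n] using v n by (intro eq_vecI) (auto simp: u_def)
  qed
  ultimately show ?thesis using H by blast
qed

text \<open>Deflation: an orthogonal \<open>H\<close> whose first column is a unit eigenvector makes
  \<open>H\<^sup>T * A * H\<close> block diagonal with a corner of order one. The induction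
  hypothesis diagonalizes the other block; its eigenvectors are padded by a leading zero and rotated
  back by \<open>H\<close>.\<close>

lemma real_symmetric_eigenbasis:
  fixes A :: "real mat"
  assumes "A \<in> carrier_mat n n" "A\<^sup>T = A"
  shows "\<exists>X d. X \<in> carrier_mat n n \<and> orthonormal_cols X \<and>
           (\<forall>i<n. A *\<^sub>v col X i = d i \<cdot>\<^sub>v col X i)"
  using assms
proof (induction n arbitrary: A)
  case 0
  then show ?case by (intro exI[of _ "1\<^sub>m 0"]) (auto simp: orthonormal_cols_def)
next
  case (Suc m)
  let ?n = "Suc m"
  obtain e v where v: "v \<in> carrier_vec ?n" "v \<bullet> v = 1" "A *\<^sub>v v = e \<cdot>\<^sub>v v"
    using real_symmetric_eigenvector[OF Suc.prems] by auto
  obtain H where H: "H \<in> carrier_mat ?n ?n" "orthonormal_cols H" "col H 0 = v"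
    using orthogonal_mat_first_col[OF v(1,2)] by auto
  note A = Suc.prems
  define B where "B = H\<^sup>T * A * H"
  have B: "B \<in> carrier_mat ?n ?n" using A H by (simp add: B_def)
  have Bij: "B $$ (i, j) = col H i \<bullet> (A *\<^sub>v col H j)" if "i < ?n" "j < ?n" for i j
  proof -
    have "B = H\<^sup>T * (A * H)" unfolding B_def using A H by (intro assoc_mult_mat) auto
    moreover have "col (A * H) j = A *\<^sub>v col H j" using A H that by (intro eq_vecI) auto
    ultimately show ?thesis using that A H by simp
  qed
  have Bsym: "B $$ (i, j) = B $$ (j, i)" if "i < ?n" "j < ?n" for i j
    unfolding Bij[OF that] Bij[OF that(2,1)]
    using scalar_prod_mult_mat_vec[OF A(1), of "col H i" "col H j"] A H that
    by (simp add: comm_scalar_prod[of _ ?n])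
  have B0: "B $$ (i, 0) = (if i = 0 then e else 0)" if "i < ?n" for i
    unfolding Bij[OF that zero_less_Suc] H(3) v(3)
    using H(2) H(1) that v H(3) unfolding orthonormal_cols_iff by auto
  define D where "D = mat m m (\<lambda>(i, j). B $$ (Suc i, Suc j))"
  have D: "D \<in> carrier_mat m m" "D\<^sup>T = D"
    unfolding D_def using Bsym by (auto intro!: eq_matI)
  obtain Y d where Y: "Y \<in> carrier_mat m m" "orthonormal_cols Y"
      "\<And>i. i < m \<Longrightarrow> D *\<^sub>v col Y i = d i \<cdot>\<^sub>v col Y i"
    using Suc.IH[OF D] by blast
  define y where "y = case_nat (vCons 1 (0\<^sub>v m)) (\<lambda>i. vCons 0 (col Y i))"
  define f where "f = case_nat e d"
  have y: "y i \<in> carrier_vec ?n" if "i < ?n" for i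
    using that Y by (auto simp: y_def split: nat.splits)
  have yy: "y i \<bullet> y j = (if i = j then 1 else 0)" if "i < ?n" "j < ?n" for i j
    using that Y unfolding orthonormal_cols_iff y_def by (auto split: nat.splits)
  have row: "row B i \<bullet> vCons a w = B $$ (i, 0) * a + vec m (\<lambda>j. B $$ (i, Suc j)) \<bullet> w"
    if "i < ?n" "w \<in> carrier_vec m" for i a w
  proof -
    have "row B i = vCons (B $$ (i, 0)) (vec m (\<lambda>j. B $$ (i, Suc j)))"
      using that B by (intro eq_vecI) (auto simp: vec_index_vCons)
    then show ?thesis by simp
  qed
  have By: "B *\<^sub>v y i = f i \<cdot>\<^sub>v y i" if "i < ?n" for i
  proof (cases i)
    case 0
    show ?thesis
    proof (rule eq_vecI)
      fix l assume "l < dim_vec (f i \<cdot>\<^sub>v y i)"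
      then have l: "l < ?n" using y[OF that] by simp
      show "(B *\<^sub>v y i) $ l = (f i \<cdot>\<^sub>v y i) $ l"
        using l B B0[OF l] row[OF l zero_carrier_vec, of 1]
        by (simp add: 0 y_def f_def vec_index_vCons scalar_prod_right_zero[of _ m])
    qed (use y[OF that] B in auto)
  next
    case (Suc i')
    then have i': "i' < m" using that by simp
    show ?thesis
    proof (rule eq_vecI)
      fix l assume "l < dim_vec (f i \<cdot>\<^sub>v y i)"
      then have l: "l < ?n" using y[OF that] by simp
      have cY: "col Y i' \<in> carrier_vec m" using Y(1) by (intro carrier_vecI) simp
      have eq: "(B *\<^sub>v y i) $ l = vec m (\<lambda>j. B $$ (l, Suc j)) \<bullet> col Y i'"
        using l B row[OF l cY, of 0] by (simp add: Suc y_def)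
      show "(B *\<^sub>v y i) $ l = (f i \<cdot>\<^sub>v y i) $ l"
      proof (cases l)
        case 0
        have "vec m (\<lambda>j. B $$ (l, Suc j)) = 0\<^sub>v m"
          by (intro eq_vecI) (simp_all add: Bsym[of 0] B0 0)
        then show ?thesis unfolding eq using 0 cY by (simp add: Suc y_def f_def)
      next
        case l': (Suc l')
        then have "l' < m" using l by simp
        have "vec m (\<lambda>j. B $$ (l, Suc j)) = row D l'"
          using \<open>l' < m\<close> l' by (intro eq_vecI) (auto simp: D_def)
        then have "(B *\<^sub>v y i) $ l = (D *\<^sub>v col Y i') $ l'" unfolding eq using \<open>l' < m\<close> D by simp
        then show ?thesis unfolding Y(3)[OF i'] using \<open>l' < m\<close> l' i' Y by (simp add: Suc y_def f_def)
      qed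
    qed (use y[OF that] B in auto)
  qed
  let ?X = "mat_of_cols ?n (map (\<lambda>i. H *\<^sub>v y i) [0..<?n])"
  have Xcol: "col ?X i = H *\<^sub>v y i" if "i < ?n" for i
    by (subst col_mat_of_cols) (use that H y in \<open>auto simp del: upt_Suc\<close>)
  have AX: "A *\<^sub>v (H *\<^sub>v y i) = f i \<cdot>\<^sub>v (H *\<^sub>v y i)" if "i < ?n" for i
  proof -
    have yi: "y i \<in> carrier_vec ?n" using y that by simp
    have HH: "H * H\<^sup>T = 1\<^sub>m ?n" using orthogonal_mat_transpose H by blast
    have "H *\<^sub>v (B *\<^sub>v y i) = H *\<^sub>v (H\<^sup>T *\<^sub>v (A *\<^sub>v (H *\<^sub>v y i)))"
      unfolding B_def using A H yi by (simp add: assoc_mult_mat_vec[of _ ?n ?n _ ?n])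
    also have "\<dots> = (H * H\<^sup>T) *\<^sub>v (A *\<^sub>v (H *\<^sub>v y i))"
      using A H yi by (subst assoc_mult_mat_vec[of _ ?n ?n _ ?n]) auto
    also have "\<dots> = A *\<^sub>v (H *\<^sub>v y i)" unfolding HH using A H yi by simp
    finally show ?thesis unfolding By[OF that] using H yi by (simp add: mult_mat_vec)
  qed
  have "orthonormal_cols ?X"
    by (rule orthonormal_cols_mat_of_cols)
      (use H y yy in \<open>auto simp: orthonormal_cols_isometry[OF H(1,2)]\<close>)
  moreover have "?X \<in> carrier_mat ?n ?n" by (rule carrier_matI) (simp_all del: upt_Suc)
  ultimately show ?case using AX Xcol by (intro exI[of _ ?X] exI[of _ f]) (auto simp del: upt_Suc)
qed

text \<open>\<open>A * X = X * D\<close> with \<open>D\<close> diagonal makes \<open>A\<close>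
  similar to \<open>D\<close>. This is the bridge from \<open>eigval\<close>, defined by roots of
  the characteristic polynomial, to eigenvectors; the values \<open>d\<close> come in arbitrary
  order.\<close>

lemma char_poly_eigenbasis:
  fixes A :: "real mat"
  assumes A: "A \<in> carrier_mat n n" and X: "X \<in> carrier_mat n n" "orthonormal_cols X"
    and ev: "\<forall>i<n. A *\<^sub>v col X i = d i \<cdot>\<^sub>v col X i"
  shows "char_poly A = (\<Prod>a\<leftarrow>map d [0..<n]. [:- a, 1:])"
proof -
  define D where "D = mat n n (\<lambda>(i, j). if i = j then d i else 0)"
  have D: "D \<in> carrier_mat n n" by (simp add: D_def)
  have XX: "X\<^sup>T * X = 1\<^sub>m n" "X * X\<^sup>T = 1\<^sub>m n"
    using X orthogonal_mat_transpose[OF X] by (auto simp: orthonormal_cols_def)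
  have AX: "A * X = X * D"
  proof (rule eq_matI)
    fix i j assume ij: "i < dim_row (X * D)" "j < dim_col (X * D)"
    then have i: "i < n" and j: "j < n" using X D by auto
    have "col D j = d j \<cdot>\<^sub>v unit_vec n j"
      using j by (intro eq_vecI) (auto simp: D_def)
    then have "(X * D) $$ (i, j) = d j * X $$ (i, j)" using i j X D by simp
    moreover have "(A * X) $$ (i, j) = (A *\<^sub>v col X j) $ i" using i j A X by simp
    ultimately show "(A * X) $$ (i, j) = (X * D) $$ (i, j)"
      unfolding ev[rule_format, OF j] using i j X by simp
  qed (use A X D in auto)
  have "A = A * (X * X\<^sup>T)" unfolding XX using A by simp
  also have "\<dots> = A * X * X\<^sup>T" using A X by (intro assoc_mult_mat[symmetric]) auto
  finally have "A = X * D * X\<^sup>T" unfolding AX .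
  then have "similar_mat_wit A D X (X\<^sup>T)"
    using A X D XX by (intro similar_mat_witI[of _ _ n]) auto
  then have "char_poly A = char_poly D" by (intro char_poly_similar) (auto simp: similar_mat_def)
  also have "\<dots> = (\<Prod>a\<leftarrow>diag_mat D. [:- a, 1:])"
    using D by (intro char_poly_upper_triangular[of _ n]) (auto simp: upper_triangular_def D_def)
  also have "diag_mat D = map d [0..<n]" by (auto simp: diag_mat_def D_def)
  finally show ?thesis .
qed

lemma proots_linear_factors: "proots (\<Prod>a\<leftarrow>as. [:- a, 1 :: real:]) = mset as"
proof (induction as)
  case (Cons a as)
  have "(\<Prod>a\<leftarrow>as. [:- a, 1 :: real:]) \<noteq> 0" by (simp add: prod_list_zero_iff image_iff)
  then show ?case using Cons by (simp add: proots_mult del: mult_pCons_left)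
qed auto

lemma eigval_eigenbasis:
  assumes "A \<in> carrier_mat n n" "X \<in> carrier_mat n n" "orthonormal_cols X"
    and "\<forall>i<n. A *\<^sub>v col X i = d i \<cdot>\<^sub>v col X i"
  shows "eigval A i = sort (map d [0..<n]) ! (i - 1)"
  unfolding eigval_def char_poly_eigenbasis[OF assms] proots_linear_factors
  by (simp only: sorted_list_of_multiset_mset)

lemma eigval_mono:
  assumes "A \<in> carrier_mat n n" "A\<^sup>T = A" "1 \<le> i" "i \<le> j" "j \<le> n"
  shows "eigval A i \<le> eigval A j"
proof -
  obtain X d where "X \<in> carrier_mat n n" "orthonormal_cols X"
      "\<forall>i<n. A *\<^sub>v col X i = d i \<cdot>\<^sub>v col X i"
    using real_symmetric_eigenbasis[OF assms(1,2)] by blast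
  note * = eigval_eigenbasis[OF assms(1) this]
  show ?thesis unfolding * using assms by (intro sorted_nth_mono) auto
qed

text \<open>The indices of an arbitrary eigenbasis are sorted by their eigenvalues. Sorting indices
  rather than values keeps each eigenvalue paired with its eigenvector.\<close>

lemma ordered_eigenvectors_exist:
  assumes A: "A \<in> carrier_mat n n" "A\<^sup>T = A"
  shows "\<exists>X. ordered_eigenvectors A n X"
proof -
  obtain X d where X: "X \<in> carrier_mat n n" "orthonormal_cols X"
      "\<forall>i<n. A *\<^sub>v col X i = d i \<cdot>\<^sub>v col X i"
    using real_symmetric_eigenbasis[OF assms(1,2)] by blast
  define p where "p = sort_key d [0..<n]"
  have p: "length p = n" "set p = {0..<n}" "distinct p" by (auto simp: p_def)
  have pl: "p ! i < n" if "i < n" for i using p that nth_mem[of i p] by auto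
  have "sort (map d [0..<n]) = map d p"
    by (rule properties_for_sort) (simp_all add: p_def mset_map)
  then have ev: "eigval A i = d (p ! (i - 1))" if "i \<in> {1..n}" for i
    unfolding eigval_eigenbasis[OF A(1) X] using that p by auto
  let ?Y = "mat_of_cols n (map (\<lambda>i. col X (p ! i)) [0..<n])"
  have cX: "col X i \<in> carrier_vec n" for i using X(1) by (intro carrier_vecI) simp
  have "orthonormal_cols ?Y"
    by (rule orthonormal_cols_mat_of_cols)
      (use p pl X cX in \<open>auto simp: orthonormal_cols_iff nth_eq_iff_index_eq\<close>)
  moreover have "A *\<^sub>v col ?Y (i - 1) = eigval A i \<cdot>\<^sub>v col ?Y (i - 1)" if "i \<in> {1..n}" for i
  proof -
    have "i - 1 < n" using that by auto
    then have "col ?Y (i - 1) = col X (p ! (i - 1))"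
      using cX by simp
    then show ?thesis using X(3)[rule_format, OF pl[OF \<open>i - 1 < n\<close>]] ev[OF that] by simp
  qed
  ultimately show ?thesis unfolding ordered_eigenvectors_def using A by (intro exI[of _ ?Y]) auto
qed

section \<open>Variational bounds for sums of eigenvalues\<close>

lemma scalar_prod_transpose_mult:
  assumes "X \<in> carrier_mat n k" "v \<in> carrier_vec n" "w \<in> carrier_vec n"
  shows "(X\<^sup>T *\<^sub>v v) \<bullet> (X\<^sup>T *\<^sub>v w) = (\<Sum>i<k. (col X i \<bullet> v) * (col X i \<bullet> (w :: real vec)))"
  using assms by (auto simp: scalar_prod_def[of "X\<^sup>T *\<^sub>v v"] atLeast0LessThan intro!: sum.cong)

lemma parseval:
  fixes v w :: "real vec"
  assumes "X \<in> carrier_mat n n" "orthonormal_cols X" "v \<in> carrier_vec n" "w \<in> carrier_vec n"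
  shows "v \<bullet> w = (\<Sum>i<n. (col X i \<bullet> v) * (col X i \<bullet> w))"
proof -
  have "(X\<^sup>T *\<^sub>v v) \<bullet> (X\<^sup>T *\<^sub>v w) = v \<bullet> w"
    using assms orthogonal_mat_transpose by (intro orthonormal_cols_isometry) auto
  then show ?thesis using scalar_prod_transpose_mult[OF assms(1,3,4)] by simp
qed

lemma bessel:
  fixes v :: "real vec"
  assumes "X \<in> carrier_mat n k" "orthonormal_cols X" "v \<in> carrier_vec n"
  shows "(X\<^sup>T *\<^sub>v v) \<bullet> (X\<^sup>T *\<^sub>v v) \<le> v \<bullet> v"
proof -
  define w where "w = X\<^sup>T *\<^sub>v v"
  have w: "w \<in> carrier_vec k" using assms by (auto simp: w_def)
  have Xw: "X *\<^sub>v w \<in> carrier_vec n" using assms(1) w by (rule mult_mat_vec_carrier)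
  have 1: "v \<bullet> (X *\<^sub>v w) = w \<bullet> w" "(X *\<^sub>v w) \<bullet> v = w \<bullet> w"
    using scalar_prod_mult_mat_vec[OF assms(1,3) w] by (auto simp: w_def)
  have 2: "(X *\<^sub>v w) \<bullet> (X *\<^sub>v w) = w \<bullet> w" using orthonormal_cols_isometry assms w by blast
  have "0 \<le> (v - X *\<^sub>v w) \<bullet> (v - X *\<^sub>v w)" by (rule scalar_prod_self_nonneg)
  also have "\<dots> = v \<bullet> v - w \<bullet> w"
    using assms(3) Xw 1 2
    by (simp add: minus_scalar_prod_distrib[of _ n] scalar_prod_minus_distrib[of _ n])
  finally show ?thesis by (simp add: w_def)
qed

section \<open>Spectral expansions and Rayleigh bounds\<close>

lemma ordered_eigenvectorsD:
  assumes "ordered_eigenvectors T k X" "T \<in> carrier_mat n n"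
  shows "X \<in> carrier_mat n k" "orthonormal_cols X" "\<And>i. i < k \<Longrightarrow> col X i \<in> carrier_vec n"
    "\<And>i. i < k \<Longrightarrow> T *\<^sub>v col X i = eigval T (Suc i) \<cdot>\<^sub>v col X i"
proof -
  show X: "X \<in> carrier_mat n k" "orthonormal_cols X"
    using assms by (auto simp: ordered_eigenvectors_def)
  show "\<And>i. i < k \<Longrightarrow> col X i \<in> carrier_vec n" using X(1) by (intro carrier_vecI) simp
  show "T *\<^sub>v col X i = eigval T (Suc i) \<cdot>\<^sub>v col X i" if "i < k" for i
    using assms(1) that unfolding ordered_eigenvectors_def by (auto dest!: bspec[of _ _ "Suc i"])
qed

lemma eigenvector_scalar_prod:
  fixes T :: "real mat"
  assumes "T \<in> carrier_mat n n" "T\<^sup>T = T" "x \<in> carrier_vec n" "v \<in> carrier_vec n"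
    and "T *\<^sub>v x = d \<cdot>\<^sub>v x"
  shows "x \<bullet> (T *\<^sub>v v) = d * (x \<bullet> v)"
  using scalar_prod_mult_mat_vec(1)[OF assms(1,3,4)] assms by simp

lemma quad_form_spectral:
  fixes T :: "real mat"
  assumes T: "T \<in> carrier_mat n n" "T\<^sup>T = T" and X: "ordered_eigenvectors T n X"
    and v: "v \<in> carrier_vec n"
  shows "v \<bullet> (T *\<^sub>v v) = (\<Sum>i<n. eigval T (Suc i) * (col X i \<bullet> v)\<^sup>2)"
proof -
  note D = ordered_eigenvectorsD[OF X T(1)]
  have "v \<bullet> (T *\<^sub>v v) = (\<Sum>i<n. (col X i \<bullet> v) * (col X i \<bullet> (T *\<^sub>v v)))"
    using D T v by (intro parseval) auto
  also have "\<dots> = (\<Sum>i<n. eigval T (Suc i) * (col X i \<bullet> v)\<^sup>2)"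
    using D T v
    by (intro sum.cong refl) (simp add: eigenvector_scalar_prod[OF T] power2_eq_square)
  finally show ?thesis .
qed

lemma norm_spectral:
  fixes T :: "real mat"
  assumes "T \<in> carrier_mat n n" "ordered_eigenvectors T n X" "v \<in> carrier_vec n"
  shows "v \<bullet> v = (\<Sum>i<n. (col X i \<bullet> v)\<^sup>2)"
  using parseval[OF ordered_eigenvectorsD(1,2)[OF assms(2,1)] assms(3,3)]
  by (simp add: power2_eq_square)

lemma rayleigh_bounds:
  fixes T :: "real mat"
  assumes T: "T \<in> carrier_mat n n" "T\<^sup>T = T" and v: "v \<in> carrier_vec n"
  shows "eigval T 1 * (v \<bullet> v) \<le> v \<bullet> (T *\<^sub>v v)" "v \<bullet> (T *\<^sub>v v) \<le> eigval T n * (v \<bullet> v)"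
proof -
  obtain X where X: "ordered_eigenvectors T n X" using ordered_eigenvectors_exist[OF T] by blast
  have "eigval T 1 \<le> eigval T (Suc i)" "eigval T (Suc i) \<le> eigval T n" if "i < n" for i
    using that by (auto intro!: eigval_mono[OF T])
  then show "eigval T 1 * (v \<bullet> v) \<le> v \<bullet> (T *\<^sub>v v)" "v \<bullet> (T *\<^sub>v v) \<le> eigval T n * (v \<bullet> v)"
    unfolding quad_form_spectral[OF T X v] norm_spectral[OF T(1) X v] sum_distrib_left
    by (intro sum_mono mult_right_mono; simp)+
qed

section \<open>Projections to orthonormal columns and separation of eigenvalues\<close>

lemma transpose_congruence:
  fixes T :: "real mat"
  assumes "T \<in> carrier_mat n n" "T\<^sup>T = T" "P \<in> carrier_mat n k"
  shows "P\<^sup>T * T * P \<in> carrier_mat k k" "(P\<^sup>T * T * P)\<^sup>T = P\<^sup>T * T * P"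
proof -
  show "P\<^sup>T * T * P \<in> carrier_mat k k" using assms by simp
  have "(P\<^sup>T * T * P)\<^sup>T = P\<^sup>T * (P\<^sup>T * T)\<^sup>T"
    using assms by (intro transpose_mult) auto
  also have "(P\<^sup>T * T)\<^sup>T = T\<^sup>T * (P\<^sup>T)\<^sup>T"
    using assms by (intro transpose_mult) auto
  also have "P\<^sup>T * (T\<^sup>T * (P\<^sup>T)\<^sup>T) = P\<^sup>T * T * P"
    using assms by (simp add: assoc_mult_mat[of _ k n _ n])
  finally show "(P\<^sup>T * T * P)\<^sup>T = P\<^sup>T * T * P" .
qed

lemma scalar_prod_congruence:
  fixes T :: "real mat"
  assumes "T \<in> carrier_mat n n" "P \<in> carrier_mat n k" "v \<in> carrier_vec k" "w \<in> carrier_vec k"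
  shows "v \<bullet> ((P\<^sup>T * T * P) *\<^sub>v w) = (P *\<^sub>v v) \<bullet> (T *\<^sub>v (P *\<^sub>v w))"
proof -
  have "(P\<^sup>T * T * P) *\<^sub>v w = P\<^sup>T *\<^sub>v (T *\<^sub>v (P *\<^sub>v w))"
    using assms by (simp add: assoc_mult_mat_vec[of _ k n _ k] assoc_mult_mat_vec[of _ k n _ n])
  then show ?thesis using scalar_prod_mult_mat_vec(2)[of P n k "T *\<^sub>v (P *\<^sub>v w)" v] assms by simp
qed

text \<open>An eigenvalue of the projection is the Rayleigh quotient of \<open>A\<close> at the unit
  vector \<open>Z *\<^sub>v x\<close>. Hence the spectra of all rounds lie in one interval, fixed by
  \<open>A\<close>.\<close>

lemma eigval_congruence_bounds:
  fixes A :: "real mat"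
  assumes A: "A \<in> carrier_mat n n" "A\<^sup>T = A" and Z: "Z \<in> carrier_mat n k" "orthonormal_cols Z"
    and i: "1 \<le> i" "i \<le> k"
  shows "eigval A 1 \<le> eigval (Z\<^sup>T * A * Z) i" "eigval (Z\<^sup>T * A * Z) i \<le> eigval A n"
proof -
  let ?T = "Z\<^sup>T * A * Z"
  note T = transpose_congruence[OF A Z(1)]
  obtain X where X: "ordered_eigenvectors ?T k X" using ordered_eigenvectors_exist[OF T] by blast
  note D = ordered_eigenvectorsD[OF X T(1)]
  define x where "x = col X (i - 1)"
  have x: "x \<in> carrier_vec k" "x \<bullet> x = 1" "?T *\<^sub>v x = eigval ?T i \<cdot>\<^sub>v x"
    using D(1-3) D(4)[of "i - 1"] i unfolding orthonormal_cols_iff x_def by auto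
  have "eigval ?T i = x \<bullet> (?T *\<^sub>v x)" using x by simp
  also have "\<dots> = (Z *\<^sub>v x) \<bullet> (A *\<^sub>v (Z *\<^sub>v x))" by (rule scalar_prod_congruence[OF A(1) Z(1) x(1,1)])
  finally have e: "eigval ?T i = (Z *\<^sub>v x) \<bullet> (A *\<^sub>v (Z *\<^sub>v x))" .
  have Zx: "Z *\<^sub>v x \<in> carrier_vec n" "(Z *\<^sub>v x) \<bullet> (Z *\<^sub>v x) = 1"
    using Z x orthonormal_cols_isometry[OF Z x(1,1)] by auto
  show "eigval A 1 \<le> eigval ?T i" "eigval ?T i \<le> eigval A n"
    using rayleigh_bounds[OF A Zx(1)] unfolding e Zx(2) by auto
qed

text \<open>Padding with zero rows to a square matrix makes the determinant vanish, since every
  permutation term meets the zero row \<open>r\<close>.\<close>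

lemma exists_kernel_vec:
  fixes K :: "real mat"
  assumes "K \<in> carrier_mat r n" "r < n"
  shows "\<exists>a. a \<in> carrier_vec n \<and> a \<noteq> 0\<^sub>v n \<and> K *\<^sub>v a = 0\<^sub>v r"
proof -
  define L where "L = mat n n (\<lambda>(i, j). if i < r then K $$ (i, j) else 0)"
  have L: "L \<in> carrier_mat n n" by (simp add: L_def)
  have "det L = 0"
  proof -
    have "(\<Prod>i = 0..<n. L $$ (i, p i)) = 0" if "p permutes {0..<n}" for p
    proof (rule prod_zero)
      have "p r < n" using that assms permutes_in_image[of p "{0..<n}" r] by auto
      then show "\<exists>i\<in>{0..<n}. L $$ (i, p i) = 0" using assms by (auto simp: L_def intro!: bexI[of _ r])
    qed simp
    then show ?thesis unfolding det_def'[OF L] by (intro sum.neutral) auto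
  qed
  then obtain a where a: "a \<in> carrier_vec n" "a \<noteq> 0\<^sub>v n" "L *\<^sub>v a = 0\<^sub>v n"
    using det_0_iff_vec_prod_zero[OF L] by blast
  have "K *\<^sub>v a = 0\<^sub>v r"
  proof (rule eq_vecI)
    fix i assume "i < dim_vec (0\<^sub>v r)"
    then have i: "i < r" by simp
    have "row K i = row L i" using i assms by (intro eq_vecI) (auto simp: L_def)
    then have "(K *\<^sub>v a) $ i = (L *\<^sub>v a) $ i" using i assms L by simp
    then show "(K *\<^sub>v a) $ i = 0\<^sub>v r $ i" unfolding a(3) using i assms by simp
  qed (use assms in simp)
  with a show ?thesis by blast
qed

text \<open>A Courant-Fischer dimension count. On a vector orthogonal to the first
  \<open>i - 1\<close> eigenvectors of \<open>T\<close> the Rayleigh quotient is at least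
  \<open>eigval T i\<close>; on a combination of the first \<open>i\<close> eigenvectors of the
  projection it is at most the right-hand side. The two requirements are compatible for some nonzero
  vector.\<close>

lemma poincare_separation:
  fixes T :: "real mat"
  assumes T: "T \<in> carrier_mat n n" "T\<^sup>T = T" and P: "P \<in> carrier_mat n k" "orthonormal_cols P"
    and i: "1 \<le> i" "i \<le> k" "k \<le> n"
  shows "eigval T i \<le> eigval (P\<^sup>T * T * P) i"
proof -
  let ?B = "P\<^sup>T * T * P"
  note B = transpose_congruence[OF T P(1)]
  obtain Y where Y: "ordered_eigenvectors ?B k Y" using ordered_eigenvectors_exist[OF B] by blast
  obtain X where X: "ordered_eigenvectors T n X" using ordered_eigenvectors_exist[OF T] by blast
  note DY = ordered_eigenvectorsD[OF Y B(1)] and DX = ordered_eigenvectorsD[OF X T(1)]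
  \<comment> \<open>a vector in the span of the first \<open>i\<close> columns of \<open>P Y\<close> orthogonal to the first \<open>i - 1\<close>
    columns of \<open>X\<close>\<close>
  define M where "M = X\<^sup>T * (P * Y)"
  have M: "M \<in> carrier_mat n k" using DX DY P by (auto simp: M_def)
  \<comment> \<open>The first \<open>i - 1\<close> rows impose the orthogonality. Row
    \<open>j\<close> of the other \<open>k - i\<close> rows reads off entry \<open>j + 1\<close>, so
    these rows force the entries \<open>i\<close>, ..., \<open>k - 1\<close> of \<open>b\<close> to
    vanish. That makes \<open>k - 1\<close> equations for \<open>k\<close> unknowns.\<close>
  define K where "K = mat (i - 1 + (k - i)) k (\<lambda>(j, l).
    if j < i - 1 then M $$ (j, l) else if l = Suc j then 1 else 0)"
  have K: "K \<in> carrier_mat (i - 1 + (k - i)) k" by (simp add: K_def)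
  then obtain b where b: "b \<in> carrier_vec k" "b \<noteq> 0\<^sub>v k" "K *\<^sub>v b = 0\<^sub>v (i - 1 + (k - i))"
    using exists_kernel_vec[of K "i - 1 + (k - i)" k] i by auto
  have bz: "b $ l = 0" if "i \<le> l" "l < k" for l
  proof -
    have l: "l - 1 < i - 1 + (k - i)" "Suc (l - 1) = l" using that i by auto
    have "row K (l - 1) = unit_vec k l"
      using l that i by (intro eq_vecI) (auto simp: K_def)
    then have "(K *\<^sub>v b) $ (l - 1) = unit_vec k l \<bullet> b"
      using l K by (subst index_mult_mat_vec) auto
    then have "b $ l = (K *\<^sub>v b) $ (l - 1)" using b that by simp
    then show ?thesis unfolding b(3) using l by simp
  qed
  define v where "v = P *\<^sub>v (Y *\<^sub>v b)"
  have Yb: "Y *\<^sub>v b \<in> carrier_vec k" and v: "v \<in> carrier_vec n" using DY P b by (auto simp: v_def)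
  have vv: "v \<bullet> v = b \<bullet> b"
    unfolding v_def orthonormal_cols_isometry[OF P Yb Yb]
    by (rule orthonormal_cols_isometry[OF DY(1,2) b(1,1)])
  have orth: "col X j \<bullet> v = 0" if "j < i - 1" for j
  proof -
    have j: "j < i - 1 + (k - i)" "j < n" using that i by auto
    have "row K j = row M j"
      using that j M by (intro eq_vecI) (auto simp: K_def)
    then have "(K *\<^sub>v b) $ j = (M *\<^sub>v b) $ j" using j M K by simp
    also have "M *\<^sub>v b = X\<^sup>T *\<^sub>v ((P * Y) *\<^sub>v b)"
      unfolding M_def using DX DY P b by (intro assoc_mult_mat_vec) auto
    also have "(P * Y) *\<^sub>v b = v" unfolding v_def using DY P b by (intro assoc_mult_mat_vec) auto
    also have "(X\<^sup>T *\<^sub>v v) $ j = col X j \<bullet> v" using DX j by simp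
    finally show ?thesis unfolding b(3) using j by simp
  qed
  have "eigval T i * (v \<bullet> v) = (\<Sum>j<n. eigval T i * (col X j \<bullet> v)\<^sup>2)"
    unfolding norm_spectral[OF T(1) X v] sum_distrib_left ..
  also have "\<dots> \<le> (\<Sum>j<n. eigval T (Suc j) * (col X j \<bullet> v)\<^sup>2)"
  proof (rule sum_mono)
    fix j assume "j \<in> {..<n}"
    then show "eigval T i * (col X j \<bullet> v)\<^sup>2 \<le> eigval T (Suc j) * (col X j \<bullet> v)\<^sup>2"
      using orth[of j] i by (cases "j < i - 1") (auto intro!: mult_right_mono eigval_mono[OF T])
  qed
  also have "\<dots> = v \<bullet> (T *\<^sub>v v)" using quad_form_spectral[OF T X v] by simp
  also have "\<dots> = (Y *\<^sub>v b) \<bullet> (?B *\<^sub>v (Y *\<^sub>v b))"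
    unfolding v_def using scalar_prod_congruence[OF T(1) P(1) Yb Yb] by simp
  also have "\<dots> = (\<Sum>l<k. eigval ?B (Suc l) * (col Y l \<bullet> (Y *\<^sub>v b))\<^sup>2)"
    by (rule quad_form_spectral[OF B Y Yb])
  also have "\<dots> = (\<Sum>l<k. eigval ?B (Suc l) * (b $ l)\<^sup>2)"
  proof (rule sum.cong[OF refl])
    fix l assume "l \<in> {..<k}"
    then have "col Y l \<bullet> (Y *\<^sub>v b) = (Y\<^sup>T *\<^sub>v (Y *\<^sub>v b)) $ l" using DY by simp
    then show "eigval ?B (Suc l) * (col Y l \<bullet> (Y *\<^sub>v b))\<^sup>2 = eigval ?B (Suc l) * (b $ l)\<^sup>2"
      unfolding orthonormal_cols_cancel[OF DY(1,2) b(1)] by simp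
  qed
  also have "\<dots> \<le> (\<Sum>l<k. eigval ?B i * (b $ l)\<^sup>2)"
  proof (rule sum_mono)
    fix l assume "l \<in> {..<k}"
    then show "eigval ?B (Suc l) * (b $ l)\<^sup>2 \<le> eigval ?B i * (b $ l)\<^sup>2"
      using bz[of l] i by (cases "i \<le> l") (auto intro!: mult_right_mono eigval_mono[OF B])
  qed
  also have "\<dots> = eigval ?B i * (v \<bullet> v)"
    unfolding vv using b by (simp add: scalar_prod_def atLeast0LessThan sum_distrib_left power2_eq_square)
  finally show ?thesis using vv scalar_prod_self_pos[OF b(1,2)] by simp
qed

text \<open>Weights of total \<open>k\<close> with values in \<open>[0, 1]\<close> are compared with
  the indicator of the first \<open>k\<close> indices. Subtracting a threshold \<open>s\<close> from
  \<open>f\<close> changes nothing, both totals being \<open>k\<close>, and makes every term of the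
  difference nonnegative.\<close>

lemma sum_weights_lower:
  fixes f \<omega> :: "nat \<Rightarrow> real"
  assumes mono: "\<And>i j. i \<le> j \<Longrightarrow> j < n \<Longrightarrow> f i \<le> f j"
    and \<omega>: "\<And>j. j < n \<Longrightarrow> 0 \<le> \<omega> j" "\<And>j. j < n \<Longrightarrow> \<omega> j \<le> 1"
    and sum: "(\<Sum>j<n. \<omega> j) = real k" and k: "k \<le> n"
  shows "(\<Sum>j<k. f j) \<le> (\<Sum>j<n. f j * \<omega> j)"
proof -
  \<comment> \<open>For \<open>k = 0\<close> truncated subtraction gives \<open>f 0\<close>, still a
    lower bound for every value that occurs.\<close>
  define s where "s = f (k - 1)"
  define \<chi> where "\<chi> j = (if j < k then 1 else 0 :: real)" for j
  have \<chi>: "(\<Sum>j<n. g j * \<chi> j) = (\<Sum>j<k. g j)" for g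
  proof -
    have "(\<Sum>j<n. g j * \<chi> j) = (\<Sum>j\<in>{..<n} \<inter> {..<k}. g j)"
      unfolding sum.inter_restrict[OF finite_lessThan] by (intro sum.cong) (auto simp: \<chi>_def)
    also have "{..<n} \<inter> {..<k} = {..<k}" using k by auto
    finally show ?thesis .
  qed
  have "0 \<le> (\<Sum>j<n. (f j - s) * (\<omega> j - \<chi> j))"
  proof (rule sum_nonneg)
    fix j assume j: "j \<in> {..<n}"
    show "0 \<le> (f j - s) * (\<omega> j - \<chi> j)"
    proof (cases "j < k")
      case True
      then have "f j \<le> s" unfolding s_def using k by (intro mono) auto
      then show ?thesis using True \<omega>(2) j by (auto simp: \<chi>_def intro: mult_nonpos_nonpos)
    next
      case False
      then have "s \<le> f j" unfolding s_def using j by (intro mono) auto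
      then show ?thesis using False \<omega>(1) j by (auto simp: \<chi>_def)
    qed
  qed
  also have "\<dots> = (\<Sum>j<n. f j * \<omega> j) - (\<Sum>j<n. f j * \<chi> j) - s * ((\<Sum>j<n. \<omega> j) - (\<Sum>j<n. 1 * \<chi> j))"
    by (simp add: algebra_simps sum.distrib sum_subtractf sum_distrib_left)
  also have "\<dots> = (\<Sum>j<n. f j * \<omega> j) - (\<Sum>j<k. f j)" unfolding \<chi> sum by simp
  finally show ?thesis by simp
qed

text \<open>The weight missing from the first \<open>k\<close> indices sits on the remaining ones,
  and moving one unit of weight raises the sum by at most \<open>hi - lo\<close>.\<close>

lemma sum_weights_upper:
  fixes f \<omega> :: "nat \<Rightarrow> real"
  assumes f: "\<And>j. j < n \<Longrightarrow> lo \<le> f j" "\<And>j. j < n \<Longrightarrow> f j \<le> hi"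
    and \<omega>: "\<And>j. j < n \<Longrightarrow> 0 \<le> \<omega> j" "\<And>j. j < n \<Longrightarrow> \<omega> j \<le> 1"
    and sum: "(\<Sum>j<n. \<omega> j) = real k" and k: "k \<le> n"
  shows "(\<Sum>j<n. f j * \<omega> j) - (\<Sum>j<k. f j) \<le> (hi - lo) * (real k - (\<Sum>j<k. \<omega> j))"
proof -
  have split: "(\<Sum>j<n. g j) = (\<Sum>j<k. g j) + (\<Sum>j\<in>{k..<n}. g j)" for g :: "nat \<Rightarrow> real"
    using k sum.atLeastLessThan_concat[of 0 k n g] by (simp add: atLeast0LessThan)
  have "(\<Sum>j\<in>{k..<n}. f j * \<omega> j) \<le> (\<Sum>j\<in>{k..<n}. hi * \<omega> j)"
    using f \<omega> by (intro sum_mono mult_right_mono) auto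
  moreover have "(\<Sum>j<k. lo * (1 - \<omega> j)) \<le> (\<Sum>j<k. f j * (1 - \<omega> j))"
    using f \<omega> k by (intro sum_mono mult_right_mono) auto
  moreover have "(\<Sum>j\<in>{k..<n}. \<omega> j) = real k - (\<Sum>j<k. \<omega> j)" using sum split[of \<omega>] by simp
  ultimately show ?thesis
    unfolding split[of "\<lambda>j. f j * \<omega> j"]
    by (simp add: algebra_simps sum_subtractf flip: sum_distrib_left)
qed

text \<open>\<open>\<omega> j\<close> is the squared length of the projection of the
  \<open>j\<close>-th eigenvector to the range of \<open>W\<close>, at most one by Bessel; the total
  is \<open>k\<close> because the columns of \<open>W\<close> are unit vectors. A trace thus becomes
  a weighted sum of eigenvalues, which serves both the minimum principle and the estimate of the
  excess over the minimum.\<close>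

lemma ky_fan_weights:
  fixes T :: "real mat"
  assumes T: "T \<in> carrier_mat n n" "T\<^sup>T = T" and X: "ordered_eigenvectors T n X"
    and W: "W \<in> carrier_mat n k" "orthonormal_cols W"
  defines "\<omega> \<equiv> \<lambda>j. \<Sum>i<k. (col X j \<bullet> col W i)\<^sup>2"
  shows "(\<Sum>i<k. col W i \<bullet> (T *\<^sub>v col W i)) = (\<Sum>j<n. eigval T (Suc j) * \<omega> j)"
    and "\<And>j. j < n \<Longrightarrow> 0 \<le> \<omega> j" and "\<And>j. j < n \<Longrightarrow> \<omega> j \<le> 1"
    and "(\<Sum>j<n. \<omega> j) = real k"
proof -
  note D = ordered_eigenvectorsD[OF X T(1)]
  have cW: "col W i \<in> carrier_vec n" for i using W(1) by (intro carrier_vecI) simp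
  show "(\<Sum>i<k. col W i \<bullet> (T *\<^sub>v col W i)) = (\<Sum>j<n. eigval T (Suc j) * \<omega> j)"
    unfolding \<omega>_def sum_distrib_left quad_form_spectral[OF T X cW] by (rule sum.swap)
  show "0 \<le> \<omega> j" for j unfolding \<omega>_def by (intro sum_nonneg) auto
  show "\<omega> j \<le> 1" if "j < n" for j
  proof -
    have x: "col X j \<in> carrier_vec n" "col X j \<bullet> col X j = 1"
      using D(1-3) that unfolding orthonormal_cols_iff by auto
    have "\<omega> j = (\<Sum>i<k. (col W i \<bullet> col X j) * (col W i \<bullet> col X j))"
      unfolding \<omega>_def using x cW by (simp add: power2_eq_square comm_scalar_prod[OF x(1) cW])
    also have "\<dots> = (W\<^sup>T *\<^sub>v col X j) \<bullet> (W\<^sup>T *\<^sub>v col X j)"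
      using scalar_prod_transpose_mult[OF W(1) x(1,1)] by simp
    also have "\<dots> \<le> 1" using bessel[OF W x(1)] x(2) by simp
    finally show ?thesis .
  qed
  have "(\<Sum>j<n. \<omega> j) = (\<Sum>i<k. col W i \<bullet> col W i)"
    unfolding \<omega>_def norm_spectral[OF T(1) X cW] by (rule sum.swap)
  also have "\<dots> = (\<Sum>i<k. 1)" using W unfolding orthonormal_cols_iff by (intro sum.cong) auto
  finally show "(\<Sum>j<n. \<omega> j) = real k" by simp
qed

lemma ky_fan:
  fixes T :: "real mat"
  assumes T: "T \<in> carrier_mat n n" "T\<^sup>T = T"
    and W: "W \<in> carrier_mat n k" "orthonormal_cols W" and k: "k \<le> n"
  shows "(\<Sum>i<k. eigval T (Suc i)) \<le> (\<Sum>i<k. col W i \<bullet> (T *\<^sub>v col W i))"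
proof -
  obtain X where X: "ordered_eigenvectors T n X" using ordered_eigenvectors_exist[OF T] by blast
  note w = ky_fan_weights[OF T X W]
  show ?thesis unfolding w(1)
    by (rule sum_weights_lower) (use w k in \<open>auto intro!: eigval_mono[OF T]\<close>)
qed

section \<open>Eigenvalue sums after projection to a range close to the eigenspace\<close>

lemma norm_projection_residual:
  fixes y :: "real vec"
  assumes P: "P \<in> carrier_mat n p" "orthonormal_cols P" and y: "y \<in> carrier_vec n"
  defines "e \<equiv> y - P *\<^sub>v (P\<^sup>T *\<^sub>v y)"
  shows "e \<bullet> e = y \<bullet> y - (P\<^sup>T *\<^sub>v y) \<bullet> (P\<^sup>T *\<^sub>v y)"
proof -
  let ?c = "P\<^sup>T *\<^sub>v y"
  have c: "?c \<in> carrier_vec p" and Pc: "P *\<^sub>v ?c \<in> carrier_vec n" using P y by auto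
  have "y \<bullet> (P *\<^sub>v ?c) = ?c \<bullet> ?c" "(P *\<^sub>v ?c) \<bullet> y = ?c \<bullet> ?c"
    "(P *\<^sub>v ?c) \<bullet> (P *\<^sub>v ?c) = ?c \<bullet> ?c"
    using scalar_prod_mult_mat_vec[OF P(1) y c] orthonormal_cols_isometry[OF P c c] by auto
  then show ?thesis unfolding e_def using y Pc
    by (simp add: minus_scalar_prod_distrib[of _ n] scalar_prod_minus_distrib[of _ n])
qed

text \<open>With \<open>C = P\<^sup>T X\<^sub>k\<close> and an eigendecomposition \<open>C\<^sup>T C = R \<Lambda> R\<^sup>T\<close>, the columns of
  \<open>P C R \<Lambda>\<^sup>-\<^sup>1\<^sup>/\<^sup>2\<close> are an orthonormal basis of the projection of the range of \<open>X\<^sub>k\<close> to the range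
  of \<open>P\<close>; they are the trial vectors.\<close>

lemma eigval_sum_congruence:
  fixes T :: "real mat"
  assumes T: "T \<in> carrier_mat n n" "T\<^sup>T = T" and X: "ordered_eigenvectors T n X"
    and P: "P \<in> carrier_mat n p" "orthonormal_cols P" and k: "k \<le> p" "k \<le> n"
    and \<kappa>: "\<kappa> < 1"
    and Xk: "Xk = mat_of_cols n (map (col X) [0..<k])"
    and dist: "\<And>a y. a \<in> carrier_vec k \<Longrightarrow> y = Xk *\<^sub>v a \<Longrightarrow>
      (y - P *\<^sub>v (P\<^sup>T *\<^sub>v y)) \<bullet> (y - P *\<^sub>v (P\<^sup>T *\<^sub>v y)) \<le> \<kappa> * (a \<bullet> a)"
    and bounds: "lo \<le> hi" "\<And>j. j < n \<Longrightarrow> lo \<le> eigval T (Suc j)" "\<And>j. j < n \<Longrightarrow> eigval T (Suc j) \<le> hi"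
  shows "(\<Sum>i<k. eigval (P\<^sup>T * T * P) (Suc i))
           \<le> (\<Sum>i<k. eigval T (Suc i)) + (hi - lo) * (real k * \<kappa>)"
proof -
  note D = ordered_eigenvectorsD[OF X T(1)]
  have Xk1: "Xk \<in> carrier_mat n k" "orthonormal_cols Xk"
    unfolding Xk using D k by (auto intro!: orthonormal_cols_mat_of_cols simp: orthonormal_cols_iff)
  have colXk: "col Xk j = col X j" if "j < k" for j
    unfolding Xk by (subst col_mat_of_cols) (use that D(3) k in auto)
  define C where "C = P\<^sup>T * Xk"
  have C: "C \<in> carrier_mat p k" using P Xk1 by (auto simp: C_def)
  define G where "G = C\<^sup>T * C"
  have G: "G \<in> carrier_mat k k" "G\<^sup>T = G"
    unfolding G_def using C transpose_mult[of "C\<^sup>T" k p C k] by auto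
  obtain R where R: "ordered_eigenvectors G k R" using ordered_eigenvectors_exist[OF G] by blast
  note DR = ordered_eigenvectorsD[OF R G(1)]
  define r where "r = col R"
  define l where "l i = eigval G (Suc i)" for i
  have r: "r i \<in> carrier_vec k" "G *\<^sub>v r i = l i \<cdot>\<^sub>v r i" if "i < k" for i
    using DR(3,4) that unfolding r_def l_def by auto
  have rr: "r i \<bullet> r j = (if i = j then 1 else 0)" if "i < k" "j < k" for i j
    using DR(1,2) that unfolding r_def orthonormal_cols_iff by auto
  have CtC: "C\<^sup>T *\<^sub>v (C *\<^sub>v r i) = l i \<cdot>\<^sub>v r i" if "i < k" for i
  proof -
    have "C\<^sup>T *\<^sub>v (C *\<^sub>v r i) = G *\<^sub>v r i"
      unfolding G_def using C r(1)[OF that] by (intro assoc_mult_mat_vec[symmetric]) auto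
    then show ?thesis using r(2)[OF that] by simp
  qed
  have CC: "(C *\<^sub>v r i) \<bullet> (C *\<^sub>v r j) = (if i = j then l i else 0)" if "i < k" "j < k" for i j
  proof -
    have "(C *\<^sub>v r i) \<bullet> (C *\<^sub>v r j) = (C\<^sup>T *\<^sub>v (C *\<^sub>v r i)) \<bullet> r j"
      using C r that by (intro scalar_prod_mult_mat_vec) auto
    then show ?thesis unfolding CtC[OF that(1)] using r(1)[OF that(1)] r(1)[OF that(2)] rr[OF that] by simp
  qed
  \<comment> \<open>\<open>l i\<close> is the squared length of the projection of the unit vector
    \<open>Xk *\<^sub>v r i\<close> to the range of \<open>P\<close>; the distance hypothesis bounds
    the complementary part by \<open>\<kappa>\<close>. With \<open>\<kappa> < 1\<close> this keeps
    the projections independent, so dividing by \<open>sqrt (l i)\<close> is possible.\<close>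
  have l: "1 - \<kappa> \<le> l i" if "i < k" for i
  proof -
    define y where "y = Xk *\<^sub>v r i"
    have y: "y \<in> carrier_vec n" using Xk1 r that by (auto simp: y_def)
    have yy: "y \<bullet> y = 1" unfolding y_def
      using orthonormal_cols_isometry[OF Xk1 r(1)[OF that] r(1)[OF that]] rr[OF that that] by simp
    have "P\<^sup>T *\<^sub>v y = C *\<^sub>v r i" unfolding y_def C_def
      using P Xk1 r that by (intro assoc_mult_mat_vec[symmetric]) auto
    then have "(P\<^sup>T *\<^sub>v y) \<bullet> (P\<^sup>T *\<^sub>v y) = l i" using CC that by simp
    then show ?thesis
      using dist[OF r(1)[OF that] y_def] rr[OF that that] norm_projection_residual[OF P y] yy by simp
  qed
  have lpos: "0 < l i" if "i < k" for i using l[OF that] \<kappa> by simp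
  define w where "w i = (1 / sqrt (l i)) \<cdot>\<^sub>v (C *\<^sub>v r i)" for i
  have w: "w i \<in> carrier_vec p" if "i < k" for i using C r that by (auto simp: w_def)
  have ww: "w i \<bullet> w j = (if i = j then 1 else 0)" if "i < k" "j < k" for i j
    unfolding w_def using C r that CC[OF that] lpos[OF that(1)] by auto
  define W where "W = mat_of_cols p (map w [0..<k])"
  have W: "W \<in> carrier_mat p k" "orthonormal_cols W" "\<And>i. i < k \<Longrightarrow> col W i = w i"
    unfolding W_def using w ww by (auto intro: orthonormal_cols_mat_of_cols)
  define Z where "Z = mat_of_cols n (map (\<lambda>i. P *\<^sub>v w i) [0..<k])"
  have Pw: "P *\<^sub>v w i \<in> carrier_vec n" if "i < k" for i using P w that by auto
  have Z: "Z \<in> carrier_mat n k" "orthonormal_cols Z" "\<And>i. i < k \<Longrightarrow> col Z i = P *\<^sub>v w i"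
    unfolding Z_def using Pw w ww
    by (auto intro!: orthonormal_cols_mat_of_cols simp: orthonormal_cols_isometry[OF P])
  note B = transpose_congruence[OF T P(1)]
  note kf = ky_fan_weights[OF T X Z(1,2)]
  have "(\<Sum>i<k. eigval (P\<^sup>T * T * P) (Suc i)) \<le> (\<Sum>i<k. col W i \<bullet> ((P\<^sup>T * T * P) *\<^sub>v col W i))"
    by (rule ky_fan[OF B W(1,2) k(1)])
  also have "\<dots> = (\<Sum>i<k. col Z i \<bullet> (T *\<^sub>v col Z i))"
    using W Z w by (intro sum.cong refl) (simp add: scalar_prod_congruence[OF T(1) P(1)])
  finally have 1: "(\<Sum>i<k. eigval (P\<^sup>T * T * P) (Suc i)) \<le> (\<Sum>i<k. col Z i \<bullet> (T *\<^sub>v col Z i))" .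
  \<comment> \<open>The weight that the trial vectors keep on the first \<open>k\<close>
    eigenvectors is the trace of \<open>G\<close>, because \<open>Xk\<^sup>T\<close> maps
    \<open>P *\<^sub>v w i\<close> to \<open>sqrt (l i)\<close> times \<open>r i\<close>.\<close>
  have "(\<Sum>j<k. \<Sum>i<k. (col X j \<bullet> col Z i)\<^sup>2) = (\<Sum>i<k. \<Sum>j<k. (col X j \<bullet> col Z i)\<^sup>2)"
    by (rule sum.swap)
  also have "\<dots> = (\<Sum>i<k. l i)"
  proof (rule sum.cong[OF refl])
    fix i assume "i \<in> {..<k}"
    then have i: "i < k" by simp
    have "(\<Sum>j<k. (col X j \<bullet> col Z i)\<^sup>2) = (Xk\<^sup>T *\<^sub>v (P *\<^sub>v w i)) \<bullet> (Xk\<^sup>T *\<^sub>v (P *\<^sub>v w i))"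
      unfolding scalar_prod_transpose_mult[OF Xk1(1) Pw[OF i] Pw[OF i]]
      using i by (intro sum.cong) (auto simp: power2_eq_square colXk Z(3))
    also have "Xk\<^sup>T *\<^sub>v (P *\<^sub>v w i) = (Xk\<^sup>T * P) *\<^sub>v w i"
      using Xk1 P w[OF i] by (intro assoc_mult_mat_vec[symmetric]) auto
    also have "Xk\<^sup>T * P = C\<^sup>T"
      unfolding C_def using transpose_mult[of "P\<^sup>T" p n Xk k] P Xk1 by simp
    also have "C\<^sup>T *\<^sub>v w i = (1 / sqrt (l i) * l i) \<cdot>\<^sub>v r i"
      unfolding w_def using C r(1)[OF i] CtC[OF i] by (simp add: mult_mat_vec smult_smult_assoc)
    also have "1 / sqrt (l i) * l i = sqrt (l i)" using lpos[OF i] by (simp add: real_div_sqrt)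
    also have "(sqrt (l i) \<cdot>\<^sub>v r i) \<bullet> (sqrt (l i) \<cdot>\<^sub>v r i) = l i"
      using r(1)[OF i] rr[OF i i] lpos[OF i] by simp
    finally show "(\<Sum>j<k. (col X j \<bullet> col Z i)\<^sup>2) = l i" .
  qed
  also have "\<dots> \<ge> (\<Sum>i<k. 1 - \<kappa>)" using l by (intro sum_mono) auto
  finally have 2: "real k - (\<Sum>j<k. \<Sum>i<k. (col X j \<bullet> col Z i)\<^sup>2) \<le> real k * \<kappa>"
    by (simp add: algebra_simps)
  have "(\<Sum>i<k. col Z i \<bullet> (T *\<^sub>v col Z i)) - (\<Sum>i<k. eigval T (Suc i))
      \<le> (hi - lo) * (real k - (\<Sum>j<k. \<Sum>i<k. (col X j \<bullet> col Z i)\<^sup>2))"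
    unfolding kf(1) by (rule sum_weights_upper) (use kf bounds k in auto)
  also have "\<dots> \<le> (hi - lo) * (real k * \<kappa>)" using 2 bounds(1) by (intro mult_left_mono) auto
  finally show ?thesis using 1 by linarith
qed

section \<open>Matrix polynomials on eigenvectors\<close>

lemma poly_mat_carrier [simp]: "T \<in> carrier_mat n n \<Longrightarrow> poly_mat p T \<in> carrier_mat n n"
  by (simp add: poly_mat_def)

lemma eigenvector_pow_scalar_prod:
  fixes T :: "real mat"
  assumes T: "T \<in> carrier_mat n n" "T\<^sup>T = T" and x: "x \<in> carrier_vec n" "T *\<^sub>v x = d \<cdot>\<^sub>v x"
    and v: "v \<in> carrier_vec n"
  shows "x \<bullet> ((T ^\<^sub>m e) *\<^sub>v v) = d ^ e * (x \<bullet> v)"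
  using v
proof (induction e arbitrary: v)
  case 0
  then show ?case using T by simp
next
  case (Suc e)
  have "(T ^\<^sub>m Suc e) *\<^sub>v v = (T ^\<^sub>m e) *\<^sub>v (T *\<^sub>v v)"
    using T Suc.prems by (simp add: assoc_mult_mat_vec[of _ n n _ n])
  then have "x \<bullet> ((T ^\<^sub>m Suc e) *\<^sub>v v) = d ^ e * (x \<bullet> (T *\<^sub>v v))"
    using Suc.IH[of "T *\<^sub>v v"] T Suc.prems by simp
  also have "x \<bullet> (T *\<^sub>v v) = d * (x \<bullet> v)" by (rule eigenvector_scalar_prod) (use T x Suc.prems in auto)
  finally show ?case by simp
qed

text \<open>Functions of a matrix are handled only through eigenvector coordinates, where
  \<open>poly_mat p T\<close> acts as a scalar. The entrywise definition of \<open>poly_mat\<close>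
  is unfolded nowhere but here and for its dimension.\<close>

lemma eigenvector_poly_mat_scalar_prod:
  fixes T :: "real mat"
  assumes T: "T \<in> carrier_mat n n" "T\<^sup>T = T" and x: "x \<in> carrier_vec n" "T *\<^sub>v x = d \<cdot>\<^sub>v x"
    and v: "v \<in> carrier_vec n"
  shows "x \<bullet> (poly_mat p T *\<^sub>v v) = poly p d * (x \<bullet> v)"
proof -
  have Te: "T ^\<^sub>m e \<in> carrier_mat n n" for e using T by simp
  have mv: "(M *\<^sub>v v) $ i = (\<Sum>j<n. M $$ (i, j) * v $ j)" if "i < n" "M \<in> carrier_mat n n" for M i
    using that v by (auto simp: scalar_prod_def atLeast0LessThan intro!: sum.cong)
  have pow: "((T ^\<^sub>m e) *\<^sub>v v) $ i = (\<Sum>j<n. (T ^\<^sub>m e) $$ (i, j) * v $ j)" if "i < n" for i e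
    using mv[OF that Te] .
  have pm: "(poly_mat p T *\<^sub>v v) $ i = (\<Sum>e\<le>degree p. coeff p e * ((T ^\<^sub>m e) *\<^sub>v v) $ i)"
    if "i < n" for i
  proof -
    have "(poly_mat p T *\<^sub>v v) $ i
        = (\<Sum>j<n. (\<Sum>e\<le>degree p. coeff p e * (T ^\<^sub>m e) $$ (i, j)) * v $ j)"
      using that v T by (auto simp: poly_mat_def scalar_prod_def atLeast0LessThan intro!: sum.cong)
    also have "\<dots> = (\<Sum>j<n. \<Sum>e\<le>degree p. coeff p e * ((T ^\<^sub>m e) $$ (i, j) * v $ j))"
      by (simp add: sum_distrib_left mult_ac)
    also have "\<dots> = (\<Sum>e\<le>degree p. \<Sum>j<n. coeff p e * ((T ^\<^sub>m e) $$ (i, j) * v $ j))"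
      by (rule sum.swap)
    also have "\<dots> = (\<Sum>e\<le>degree p. coeff p e * ((T ^\<^sub>m e) *\<^sub>v v) $ i)"
      unfolding pow[OF that] by (simp add: sum_distrib_left)
    finally show ?thesis .
  qed
  have "x \<bullet> (poly_mat p T *\<^sub>v v) = (\<Sum>i<n. x $ i * (poly_mat p T *\<^sub>v v) $ i)"
    using T by (auto simp: scalar_prod_def poly_mat_def atLeast0LessThan)
  also have "\<dots> = (\<Sum>i<n. \<Sum>e\<le>degree p. coeff p e * (x $ i * ((T ^\<^sub>m e) *\<^sub>v v) $ i))"
    by (intro sum.cong refl) (simp only: lessThan_iff pm sum_distrib_left mult.left_commute)
  also have "\<dots> = (\<Sum>e\<le>degree p. \<Sum>i<n. coeff p e * (x $ i * ((T ^\<^sub>m e) *\<^sub>v v) $ i))"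
    by (rule sum.swap)
  also have "\<dots> = (\<Sum>e\<le>degree p. coeff p e * (x \<bullet> ((T ^\<^sub>m e) *\<^sub>v v)))"
  proof (rule sum.cong[OF refl])
    fix e
    have "x \<bullet> ((T ^\<^sub>m e) *\<^sub>v v) = (\<Sum>i<n. x $ i * ((T ^\<^sub>m e) *\<^sub>v v) $ i)"
      using carrier_matD(1)[OF Te[of e]] by (simp only: scalar_prod_def[of x] atLeast0LessThan dim_mult_mat_vec)
    then show "(\<Sum>i<n. coeff p e * (x $ i * ((T ^\<^sub>m e) *\<^sub>v v) $ i)) = coeff p e * (x \<bullet> ((T ^\<^sub>m e) *\<^sub>v v))"
      by (simp add: sum_distrib_left)
  qed
  also have "\<dots> = poly p d * (x \<bullet> v)"
    unfolding eigenvector_pow_scalar_prod[OF T x v] by (simp add: poly_altdef sum_distrib_left mult_ac)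
  finally show ?thesis .
qed

lemma inv_mat_inverse:
  assumes M: "M \<in> carrier_mat n n" and ker: "\<And>v. v \<in> carrier_vec n \<Longrightarrow> M *\<^sub>v v = 0\<^sub>v n \<Longrightarrow> v = 0\<^sub>v n"
  shows "inv_mat M \<in> carrier_mat n n" "M * inv_mat M = 1\<^sub>m n"
proof -
  have "det M \<noteq> 0" using ker det_0_iff_vec_prod_zero[OF M] by blast
  then have "mat_inverse M \<noteq> None"
    using det_non_zero_imp_unit[OF M, where b = "()"] mat_inverse(1)[OF M, where b = "()"] by blast
  then obtain B where "mat_inverse M = Some B" by blast
  then show "inv_mat M \<in> carrier_mat n n" "M * inv_mat M = 1\<^sub>m n"
    using mat_inverse(2)[OF M] by (auto simp: inv_mat_def)
qed

text \<open>On eigenvectors \<open>poly_mat q T\<close> multiplies by nonzero scalars, so its kernel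
  is trivial and \<open>inv_mat\<close> is a genuine inverse. Each numerator of admissible degree
  then yields an element of the Krylov space with known coordinates.\<close>

lemma rational_krylov_spectral:
  fixes T :: "real mat"
  assumes T: "T \<in> carrier_mat n n" "T\<^sup>T = T" and S: "ordered_eigenvectors T n S"
    and q: "\<And>j. j < n \<Longrightarrow> poly q (eigval T (Suc j)) \<noteq> 0" and b: "b \<in> carrier_vec n"
    and deg: "degree g \<le> max (degree p) (degree q)"
  shows "\<exists>w. w \<in> rational_krylov T b p q \<and> w \<in> carrier_vec n \<and>
           (\<forall>j<n. col S j \<bullet> w = poly g (eigval T (Suc j)) / poly q (eigval T (Suc j)) * (col S j \<bullet> b))"
proof -
  note D = ordered_eigenvectorsD[OF S T(1)]
  let ?M = "poly_mat q T"
  have M: "?M \<in> carrier_mat n n" using T by simp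
  have ker: "v = 0\<^sub>v n" if v: "v \<in> carrier_vec n" "?M *\<^sub>v v = 0\<^sub>v n" for v
  proof -
    have "col S j \<bullet> v = 0" if "j < n" for j
      using eigenvector_poly_mat_scalar_prod[OF T D(3)[OF that] D(4)[OF that] v(1), of q]
        q[OF that] D(3)[OF that] v(2) by simp
    then have "v \<bullet> v = 0" unfolding norm_spectral[OF T(1) S v(1)] by simp
    then show ?thesis using scalar_prod_self_eq_0 v by blast
  qed
  have I: "inv_mat ?M \<in> carrier_mat n n" "?M * inv_mat ?M = 1\<^sub>m n"
    using inv_mat_inverse[OF M] ker by blast+
  define z where "z = inv_mat ?M *\<^sub>v b"
  have z: "z \<in> carrier_vec n" using I b by (auto simp: z_def)
  have "?M *\<^sub>v z = (?M * inv_mat ?M) *\<^sub>v b"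
    unfolding z_def using M I b by (intro assoc_mult_mat_vec[symmetric]) auto
  then have Mz: "?M *\<^sub>v z = b" unfolding I(2) using b by simp
  define w where "w = (poly_mat g T * inv_mat ?M) *\<^sub>v b"
  have "w = poly_mat g T *\<^sub>v z"
    unfolding w_def z_def using T I b by (intro assoc_mult_mat_vec[of _ n n _ n]) auto
  moreover have "col S j \<bullet> w = poly g (eigval T (Suc j)) / poly q (eigval T (Suc j)) * (col S j \<bullet> b)"
    if "j < n" for j
  proof -
    note e = eigenvector_poly_mat_scalar_prod[OF T D(3)[OF that] D(4)[OF that] z]
    show ?thesis using e[of q] e[of g] q[OF that] \<open>w = poly_mat g T *\<^sub>v z\<close>
      by (simp add: Mz)
  qed
  moreover have "w \<in> rational_krylov T b p q"
    unfolding rational_krylov_def w_def using deg by blast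
  moreover have "w \<in> carrier_vec n" using \<open>w = poly_mat g T *\<^sub>v z\<close> z T
    by (metis mult_mat_vec_carrier poly_mat_carrier)
  ultimately show ?thesis by blast
qed

section \<open>One compression\<close>

lemma scalar_prod_mult_mat_vec_cols:
  fixes X :: "real mat"
  assumes "X \<in> carrier_mat n k" "v \<in> carrier_vec n" "a \<in> carrier_vec k"
  shows "v \<bullet> (X *\<^sub>v a) = (\<Sum>i<k. a $ i * (v \<bullet> col X i))"
proof -
  have "v \<bullet> (X *\<^sub>v a) = (\<Sum>i<k. (col X i \<bullet> v) * a $ i)"
    unfolding scalar_prod_mult_mat_vec(1)[OF assms]
    using assms by (auto simp: scalar_prod_def[of _ a] atLeast0LessThan intro!: sum.cong)
  also have "\<dots> = (\<Sum>i<k. a $ i * (v \<bullet> col X i))"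
    using assms by (intro sum.cong refl) (simp add: comm_scalar_prod[of v n] mult.commute)
  finally show ?thesis .
qed

lemma scalar_prod_vec_first:
  fixes y z :: "real vec"
  assumes "y \<in> carrier_vec n" "z \<in> carrier_vec m" "m \<le> n"
  shows "z \<bullet> vec_first y m = (z @\<^sub>v 0\<^sub>v (n - m)) \<bullet> y"
proof -
  have "vec_first y m @\<^sub>v vec_last y (n - m) = y" using assms by (intro vec_first_last_append) auto
  then have "(z @\<^sub>v 0\<^sub>v (n - m)) \<bullet> y
      = (z @\<^sub>v 0\<^sub>v (n - m)) \<bullet> (vec_first y m @\<^sub>v vec_last y (n - m))" by simp
  also have "\<dots> = z \<bullet> vec_first y m + 0\<^sub>v (n - m) \<bullet> vec_last y (n - m)"
    using assms by (intro scalar_prod_append[of _ m _ "n - m"]) auto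
  finally show ?thesis by simp
qed

lemma norm_vec_first_le:
  fixes y :: "real vec"
  assumes "y \<in> carrier_vec n" "m \<le> n"
  shows "vec_first y m \<bullet> vec_first y m \<le> y \<bullet> y"
proof -
  have "vec_first y m @\<^sub>v vec_last y (n - m) = y" using assms by (intro vec_first_last_append) auto
  then have "y \<bullet> y = (vec_first y m @\<^sub>v vec_last y (n - m)) \<bullet> (vec_first y m @\<^sub>v vec_last y (n - m))"
    by simp
  also have "\<dots> = vec_first y m \<bullet> vec_first y m + vec_last y (n - m) \<bullet> vec_last y (n - m)"
    using assms by (intro scalar_prod_append[of _ m _ "n - m"]) auto
  finally show ?thesis using scalar_prod_self_nonneg[of "vec_last y (n - m)"] by simp
qed

text \<open>Taken from the projection of \<open>A\<close> to the completed basis of a round, this is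
  the matrix from which the compression is computed.\<close>

definition leading_block :: "nat \<Rightarrow> real mat \<Rightarrow> real mat" where
  "leading_block m T = mat m m (\<lambda>(i, j). T $$ (i, j))"

text \<open>The block is a projection to the first \<open>m\<close> unit vectors, so Poincare
  separation applies. The eigenvalue inequality later places the small eigenvalues of
  \<open>T\<close> on the side where the step function is \<open>1\<close>.\<close>

lemma leading_block_congruence:
  fixes T :: "real mat"
  assumes "T \<in> carrier_mat n n" "T\<^sup>T = T" "m \<le> n"
  shows "leading_block m T \<in> carrier_mat m m" "(leading_block m T)\<^sup>T = leading_block m T"
    "\<And>i. 1 \<le> i \<Longrightarrow> i \<le> m \<Longrightarrow> eigval T i \<le> eigval (leading_block m T) i"
proof -
  define P where "P = mat n m (\<lambda>(i, j). if i = j then 1 else 0 :: real)"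
  have P: "P \<in> carrier_mat n m" by (simp add: P_def)
  have cP: "col P j = unit_vec n j" if "j < m" for j
    using that assms by (intro eq_vecI) (auto simp: P_def)
  have oP: "orthonormal_cols P" unfolding orthonormal_cols_iff using P cP assms by auto
  have B: "P\<^sup>T * T * P = leading_block m T"
  proof (rule eq_matI)
    fix i j assume "i < dim_row (leading_block m T)" "j < dim_col (leading_block m T)"
    then have ij: "i < m" "j < m" by (auto simp: leading_block_def)
    have "P\<^sup>T * T * P = P\<^sup>T * (T * P)" using P assms by (intro assoc_mult_mat) auto
    moreover have "col (T * P) j = T *\<^sub>v unit_vec n j"
      using cP[OF ij(2)] P assms ij by (intro eq_vecI) auto
    moreover have "T *\<^sub>v unit_vec n j = col T j"
      using ij assms by (intro col_eq_mult_unit_vec[symmetric]) auto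
    ultimately show "(P\<^sup>T * T * P) $$ (i, j) = leading_block m T $$ (i, j)"
      using ij P assms cP[OF ij(1)] carrier_vecI[of "col T j" n] by (simp add: leading_block_def)
  qed (use P assms in \<open>auto simp: leading_block_def\<close>)
  show "leading_block m T \<in> carrier_mat m m" "(leading_block m T)\<^sup>T = leading_block m T"
    using transpose_congruence[OF assms(1,2) P] unfolding B by auto
  show "eigval T i \<le> eigval (leading_block m T) i" if "1 \<le> i" "i \<le> m" for i
    using poincare_separation[OF assms(1,2) P oP that assms(3)] unfolding B .
qed

abbreviation extend_id :: "nat \<Rightarrow> real mat \<Rightarrow> real mat" where
  "extend_id r V \<equiv> four_block_mat V (0\<^sub>m (dim_row V) r) (0\<^sub>m r (dim_col V)) (1\<^sub>m r)"

lemma extend_id: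
  assumes V: "V \<in> carrier_mat m l" "orthonormal_cols V"
  shows "extend_id r V \<in> carrier_mat (m + r) (l + r)" "orthonormal_cols (extend_id r V)"
    "(extend_id r V)\<^sup>T = four_block_mat (V\<^sup>T) (0\<^sub>m l r) (0\<^sub>m r m) (1\<^sub>m r)"
proof -
  show "extend_id r V \<in> carrier_mat (m + r) (l + r)" using V by auto
  show t: "(extend_id r V)\<^sup>T = four_block_mat (V\<^sup>T) (0\<^sub>m l r) (0\<^sub>m r m) (1\<^sub>m r)"
    using V by (subst transpose_four_block_mat[of _ m l _ r _ r]) auto
  have "(extend_id r V)\<^sup>T * extend_id r V = 1\<^sub>m (l + r)"
    unfolding t using V
    by (subst mult_four_block_mat[of _ l m _ r _ r _ _ l _ r]) (auto simp: orthonormal_cols_def)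
  then show "orthonormal_cols (extend_id r V)" using V by (simp add: orthonormal_cols_def)
qed

text \<open>The identity block reproduces the trailing coordinates exactly, so only the leading part
  of \<open>y\<close> contributes to its distance from the range.\<close>

lemma extend_id_residual:
  fixes y :: "real vec"
  assumes V: "V \<in> carrier_mat m l" "orthonormal_cols V" and y: "y \<in> carrier_vec n" and m: "m \<le> n"
  defines "P \<equiv> extend_id (n - m) V" and "u \<equiv> vec_first y m"
  shows "y - P *\<^sub>v (P\<^sup>T *\<^sub>v y) = (u - V *\<^sub>v (V\<^sup>T *\<^sub>v u)) @\<^sub>v 0\<^sub>v (n - m)"
proof -
  define d where "d = vec_last y (n - m)"
  have ud: "u \<in> carrier_vec m" "d \<in> carrier_vec (n - m)" by (auto simp: u_def d_def)
  have y': "y = u @\<^sub>v d" unfolding u_def d_def using y m by (intro vec_first_last_append[symmetric]) auto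
  have Vu: "V\<^sup>T *\<^sub>v u \<in> carrier_vec l" using V ud by auto
  have "P\<^sup>T *\<^sub>v y = (V\<^sup>T *\<^sub>v u) @\<^sub>v d"
    unfolding P_def extend_id(3)[OF V] y'
    using V ud Vu by (subst four_block_mat_mult_vec[of _ l m _ "n - m" _ "n - m"]) auto
  moreover have "P *\<^sub>v ((V\<^sup>T *\<^sub>v u) @\<^sub>v d) = (V *\<^sub>v (V\<^sup>T *\<^sub>v u)) @\<^sub>v d"
    unfolding P_def
    using V ud Vu by (subst four_block_mat_mult_vec[of _ m l _ "n - m" _ "n - m"]) auto
  ultimately show ?thesis
    unfolding y' using ud V Vu by (intro eq_vecI) auto
qed

text \<open>The arithmetic-geometric mean inequality in each term gives
  \<open>E \<le> (E + t\<^sup>2 * B) / 2\<close>, and half of \<open>E\<close> is absorbed on the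
  left. In the application \<open>E\<close> is the squared residual norm; unlike Cauchy-Schwarz,
  this needs no division by a norm that may be zero.\<close>

lemma weighted_amgm:
  fixes c a b :: "nat \<Rightarrow> real"
  assumes "E = (\<Sum>j\<in>J. c j * a j * b j)" "(\<Sum>j\<in>J. (a j)\<^sup>2) \<le> E" "(\<Sum>j\<in>J. (b j)\<^sup>2) \<le> B"
    "\<And>j. j \<in> J \<Longrightarrow> \<bar>c j\<bar> \<le> t" "0 \<le> t"
  shows "E \<le> t\<^sup>2 * B"
proof -
  have "E \<le> (\<Sum>j\<in>J. ((a j)\<^sup>2 + t\<^sup>2 * (b j)\<^sup>2) / 2)"
    unfolding assms(1)
  proof (rule sum_mono)
    fix j assume j: "j \<in> J"
    have "2 * (a j * (c j * b j)) \<le> (a j)\<^sup>2 + (c j * b j)\<^sup>2"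
      using sum_squares_bound[of "a j" "c j * b j"] by (simp add: mult_ac)
    also have "(c j * b j)\<^sup>2 \<le> t\<^sup>2 * (b j)\<^sup>2"
      unfolding power_mult_distrib using assms(4)[OF j] assms(5)
      by (intro mult_right_mono) (auto simp: abs_le_square_iff[symmetric])
    finally show "c j * a j * b j \<le> ((a j)\<^sup>2 + t\<^sup>2 * (b j)\<^sup>2) / 2" by (simp add: mult_ac)
  qed
  also have "\<dots> = ((\<Sum>j\<in>J. (a j)\<^sup>2) + t\<^sup>2 * (\<Sum>j\<in>J. (b j)\<^sup>2)) / 2"
    by (simp add: sum.distrib sum_distrib_left flip: sum_divide_distrib)
  also have "\<dots> \<le> (E + t\<^sup>2 * B) / 2"
    using assms by (intro divide_right_mono add_mono mult_left_mono) auto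
  finally show ?thesis by simp
qed

text \<open>The leading part \<open>u\<close> of an eigenvector \<open>x\<close> of \<open>T\<close> satisfies
  \<open>(T\<^sub>m - \<mu>) u = -\<gamma> e\<^sub>m\<close>.  Dividing the polynomial \<open>p - r(\<mu>) q\<close>, which vanishes at \<open>\<mu>\<close>,
  by \<open>X - \<mu>\<close> therefore gives \<open>r(T\<^sub>m) u - r(\<mu>) u\<close> in the rational Krylov space.\<close>

lemma leading_eigenvector_krylov:
  fixes T :: "real mat"
  assumes T: "T \<in> carrier_mat n n" "T\<^sup>T = T" and m: "1 \<le> m" "m \<le> n"
    and zero: "\<And>i j. i < m - 1 \<Longrightarrow> m \<le> j \<Longrightarrow> j < n \<Longrightarrow> T $$ (i, j) = 0"
    and S: "ordered_eigenvectors (leading_block m T) m S"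
    and x: "x \<in> carrier_vec n" "T *\<^sub>v x = \<mu> \<cdot>\<^sub>v x"
    and q: "poly q \<mu> \<noteq> 0" "\<And>j. j < m \<Longrightarrow> poly q (eigval (leading_block m T) (Suc j)) \<noteq> 0"
    and e: "e \<in> carrier_vec m"
      "\<And>w. w \<in> rational_krylov (leading_block m T) (unit_vec m (m - 1)) p q \<Longrightarrow>
         w \<in> carrier_vec m \<Longrightarrow> w \<bullet> e = 0"
  defines "\<theta> \<equiv> \<lambda>j. eigval (leading_block m T) (Suc j)" and "u \<equiv> vec_first x m"
  shows "poly p \<mu> / poly q \<mu> * (e \<bullet> u)
    = (\<Sum>j<m. poly p (\<theta> j) / poly q (\<theta> j) * (col S j \<bullet> e) * (col S j \<bullet> u))"
proof -
  let ?Tm = "leading_block m T"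
  note Tm = leading_block_congruence(1,2)[OF T m(2)]
  note D = ordered_eigenvectorsD[OF S Tm(1)]
  let ?b = "unit_vec m (m - 1) :: real vec"
  have u: "u \<in> carrier_vec m" by (simp add: u_def)
  \<comment> \<open>By \<open>zero\<close>, the trailing coordinates of \<open>x\<close> enter only
    row \<open>m - 1\<close> of the leading equations, and \<open>\<gamma>\<close> is their whole
    contribution.\<close>
  define \<gamma> where "\<gamma> = (\<Sum>j\<in>{m..<n}. T $$ (m - 1, j) * x $ j)"
  have Tu: "?Tm *\<^sub>v u = \<mu> \<cdot>\<^sub>v u - \<gamma> \<cdot>\<^sub>v ?b"
  proof (rule eq_vecI)
    fix i assume "i < dim_vec (\<mu> \<cdot>\<^sub>v u - \<gamma> \<cdot>\<^sub>v ?b)"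
    then have i: "i < m" by simp
    have "(T *\<^sub>v x) $ i = (\<Sum>j<n. T $$ (i, j) * x $ j)"
      using i m T x(1) by (auto simp: scalar_prod_def atLeast0LessThan intro!: sum.cong)
    also have "\<dots> = (\<Sum>j<m. T $$ (i, j) * x $ j) + (\<Sum>j\<in>{m..<n}. T $$ (i, j) * x $ j)"
      using sum.atLeastLessThan_concat[of 0 m n "\<lambda>j. T $$ (i, j) * x $ j"] m by (simp add: atLeast0LessThan)
    also have "(\<Sum>j<m. T $$ (i, j) * x $ j) = (?Tm *\<^sub>v u) $ i"
      using i x(1) m by (auto simp: leading_block_def u_def vec_first_def scalar_prod_def
          atLeast0LessThan intro!: sum.cong)
    also have "(\<Sum>j\<in>{m..<n}. T $$ (i, j) * x $ j) = \<gamma> * ?b $ i"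
    proof (cases "i = m - 1")
      case False
      then have "(\<Sum>j\<in>{m..<n}. T $$ (i, j) * x $ j) = 0"
        using i zero[of i] by (intro sum.neutral) auto
      then show ?thesis using False i by simp
    qed (use i m in \<open>simp add: \<gamma>_def\<close>)
    finally have "(?Tm *\<^sub>v u) $ i = (T *\<^sub>v x) $ i - \<gamma> * ?b $ i" by simp
    then show "(?Tm *\<^sub>v u) $ i = (\<mu> \<cdot>\<^sub>v u - \<gamma> \<cdot>\<^sub>v ?b) $ i"
      unfolding x(2) using i m x(1) by (simp add: u_def vec_first_def)
  qed (use Tm in auto)
  \<comment> \<open>The eigenvector equation in coordinates, kept in product form:
    \<open>\<mu>\<close> may coincide with an eigenvalue of the block, so there is no division by
    \<open>\<theta> j - \<mu>\<close>.\<close>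
  have sj: "(\<theta> j - \<mu>) * (col S j \<bullet> u) = - \<gamma> * (col S j \<bullet> ?b)" if "j < m" for j
  proof -
    have "\<theta> j * (col S j \<bullet> u) = col S j \<bullet> (\<mu> \<cdot>\<^sub>v u - \<gamma> \<cdot>\<^sub>v ?b)"
      using eigenvector_scalar_prod[OF Tm D(3)[OF that] u D(4)[OF that]] by (simp add: Tu \<theta>_def)
    also have "\<dots> = \<mu> * (col S j \<bullet> u) - \<gamma> * (col S j \<bullet> ?b)"
      using D(3)[OF that] u m by (simp add: scalar_prod_minus_distrib[of _ m] del: scalar_prod_right_unit)
    finally show ?thesis by (simp add: algebra_simps)
  qed
  define r where "r = poly p \<mu> / poly q \<mu>"
  define f where "f = p - Polynomial.smult r q"
  have "poly f \<mu> = 0" using q(1) by (simp add: f_def r_def)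
  then obtain g where g: "f = [:- \<mu>, 1:] * g" using poly_eq_0_iff_dvd by (metis dvdE)
  have "degree g \<le> degree f"
    by (cases "g = 0") (simp_all add: g degree_mult_eq del: mult_pCons_left)
  also have "\<dots> \<le> max (degree p) (degree q)"
    unfolding f_def by (intro degree_diff_le order.trans[OF degree_smult_le]) auto
  finally obtain w where w: "w \<in> rational_krylov ?Tm ?b p q" "w \<in> carrier_vec m"
      "\<forall>j<m. col S j \<bullet> w = poly g (\<theta> j) / poly q (\<theta> j) * (col S j \<bullet> ?b)"
    using rational_krylov_spectral[OF Tm S, of q ?b g p] q(2) unfolding \<theta>_def by auto
  \<comment> \<open>Termwise, \<open>- \<gamma>\<close> times the coordinate of \<open>e_m\<close>
    is exchanged for \<open>\<theta> j - \<mu>\<close> times that of \<open>u\<close>. The factor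
    \<open>\<theta> j - \<mu>\<close> then joins \<open>g\<close> to restore \<open>f\<close>, that
    is \<open>p - r * q\<close>. The case \<open>\<gamma> = 0\<close> is included.\<close>
  have "0 = - \<gamma> * (w \<bullet> e)" using e(2)[OF w(1,2)] by simp
  also have "\<dots> = (\<Sum>j<m. - \<gamma> * ((col S j \<bullet> w) * (col S j \<bullet> e)))"
    unfolding parseval[OF D(1,2) w(2) e(1)] by (rule sum_distrib_left)
  also have "\<dots> = (\<Sum>j<m. (poly p (\<theta> j) / poly q (\<theta> j) - r) * ((col S j \<bullet> e) * (col S j \<bullet> u)))"
  proof (rule sum.cong[OF refl])
    fix j assume "j \<in> {..<m}"
    then have j: "j < m" by simp
    have qj: "poly q (\<theta> j) \<noteq> 0" using q(2)[OF j] by (simp add: \<theta>_def)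
    have "(\<theta> j - \<mu>) * poly g (\<theta> j) = poly f (\<theta> j)" unfolding g by (simp add: algebra_simps)
    also have "\<dots> = poly p (\<theta> j) - r * poly q (\<theta> j)" by (simp add: f_def)
    finally have fg: "poly p (\<theta> j) / poly q (\<theta> j) - r = (\<theta> j - \<mu>) * poly g (\<theta> j) / poly q (\<theta> j)"
      using qj by (simp add: field_simps)
    have "- \<gamma> * ((col S j \<bullet> w) * (col S j \<bullet> e))
        = poly g (\<theta> j) / poly q (\<theta> j) * (- \<gamma> * (col S j \<bullet> ?b)) * (col S j \<bullet> e)"
      using w(3)[rule_format, OF j] by simp
    also have "\<dots> = poly g (\<theta> j) / poly q (\<theta> j) * ((\<theta> j - \<mu>) * (col S j \<bullet> u)) * (col S j \<bullet> e)"
      unfolding sj[OF j] ..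
    also have "\<dots> = (poly p (\<theta> j) / poly q (\<theta> j) - r) * ((col S j \<bullet> e) * (col S j \<bullet> u))"
      unfolding fg by simp
    finally show "- \<gamma> * ((col S j \<bullet> w) * (col S j \<bullet> e))
        = (poly p (\<theta> j) / poly q (\<theta> j) - r) * ((col S j \<bullet> e) * (col S j \<bullet> u))" .
  qed
  also have "\<dots> = (\<Sum>j<m. poly p (\<theta> j) / poly q (\<theta> j) * (col S j \<bullet> e) * (col S j \<bullet> u))
      - r * (\<Sum>j<m. (col S j \<bullet> e) * (col S j \<bullet> u))"
    by (simp add: left_diff_distrib sum_subtractf sum_distrib_left mult.assoc)
  also have "(\<Sum>j<m. (col S j \<bullet> e) * (col S j \<bullet> u)) = e \<bullet> u"
    using parseval[OF D(1,2) e(1) u] by simp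
  finally show ?thesis by (simp add: r_def)
qed

text \<open>The residual \<open>e\<close> of the leading part of \<open>y\<close> is orthogonal to
  the first \<open>h\<close> eigenvectors of the block and to the Krylov space. The identity for
  leading parts of eigenvectors therefore writes each \<open>r i * (e \<bullet> x i)\<close> as a
  sum over \<open>j \<ge> h\<close> only, where the rational function is below \<open>t\<close>.
  Since \<open>e \<bullet> e = e \<bullet> y1\<close>, these sums combine to a bound for
  \<open>e\<close> in terms of itself.\<close>

lemma compression_residual:
  fixes T :: "real mat"
  assumes T: "T \<in> carrier_mat n n" "T\<^sup>T = T" and m: "1 \<le> m" "m \<le> n" and k: "k \<le> m"
    and zero: "\<And>i j. i < m - 1 \<Longrightarrow> m \<le> j \<Longrightarrow> j < n \<Longrightarrow> T $$ (i, j) = 0"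
    and S: "ordered_eigenvectors (leading_block m T) m S" and X: "ordered_eigenvectors T n X"
    and V: "V \<in> carrier_mat m l" "orthonormal_cols V"
    and Ve: "\<And>e j. e \<in> carrier_vec m \<Longrightarrow> V\<^sup>T *\<^sub>v e = 0\<^sub>v l \<Longrightarrow> j < h \<Longrightarrow> col S j \<bullet> e = 0"
      "\<And>e w. e \<in> carrier_vec m \<Longrightarrow> V\<^sup>T *\<^sub>v e = 0\<^sub>v l \<Longrightarrow>
         w \<in> rational_krylov (leading_block m T) (unit_vec m (m - 1)) p q \<Longrightarrow>
         w \<in> carrier_vec m \<Longrightarrow> w \<bullet> e = 0"
    and q: "\<And>i. i < k \<Longrightarrow> poly q (eigval T (Suc i)) \<noteq> 0"
      "\<And>j. j < m \<Longrightarrow> poly q (eigval (leading_block m T) (Suc j)) \<noteq> 0"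
    and tol: "0 < t" "t < 1"
    and near1: "\<And>i. i < k \<Longrightarrow>
      \<bar>poly p (eigval T (Suc i)) / poly q (eigval T (Suc i)) - 1\<bar> < t"
    and near0: "\<And>j. h \<le> j \<Longrightarrow> j < m \<Longrightarrow>
      \<bar>poly p (eigval (leading_block m T) (Suc j)) / poly q (eigval (leading_block m T) (Suc j))\<bar> < t"
    and Xk: "Xk = mat_of_cols n (map (col X) [0..<k])"
    and a: "a \<in> carrier_vec k" and y: "y = Xk *\<^sub>v a" and P: "P = extend_id (n - m) V"
  shows "(y - P *\<^sub>v (P\<^sup>T *\<^sub>v y)) \<bullet> (y - P *\<^sub>v (P\<^sup>T *\<^sub>v y)) \<le> (t / (1 - t))\<^sup>2 * (a \<bullet> a)"
proof -
  note Tm = leading_block_congruence(1,2)[OF T m(2)]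
  note DX = ordered_eigenvectorsD[OF X T(1)] and DS = ordered_eigenvectorsD[OF S Tm(1)]
  define \<theta> where "\<theta> j = eigval (leading_block m T) (Suc j)" for j
  define R where "R z = poly p z / poly q z" for z
  define r where "r i = R (eigval T (Suc i))" for i
  define x where "x i = vec_first (col X i) m" for i
  have Xk1: "Xk \<in> carrier_mat n k" "orthonormal_cols Xk"
    unfolding Xk using DX k m by (auto intro!: orthonormal_cols_mat_of_cols simp: orthonormal_cols_iff)
  have colXk: "col Xk i = col X i" if "i < k" for i
    unfolding Xk by (subst col_mat_of_cols) (use that DX(3) k m in auto)
  have yc: "y \<in> carrier_vec n" unfolding y using Xk1 a by auto
  define y1 where "y1 = vec_first y m"
  have y1: "y1 \<in> carrier_vec m" by (simp add: y1_def)
  define e where "e = y1 - V *\<^sub>v (V\<^sup>T *\<^sub>v y1)"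
  have Vy: "V\<^sup>T *\<^sub>v y1 \<in> carrier_vec l" and VVy: "V *\<^sub>v (V\<^sup>T *\<^sub>v y1) \<in> carrier_vec m"
    using V y1 by auto
  have e: "e \<in> carrier_vec m" using y1 VVy by (auto simp: e_def)
  have Vte: "V\<^sup>T *\<^sub>v e = 0\<^sub>v l"
    unfolding e_def using V y1 VVy Vy orthonormal_cols_cancel[OF V Vy]
    by (subst mult_minus_distrib_mat_vec[of _ l m]) auto
  have res: "(y - P *\<^sub>v (P\<^sup>T *\<^sub>v y)) \<bullet> (y - P *\<^sub>v (P\<^sup>T *\<^sub>v y)) = e \<bullet> e"
    unfolding P extend_id_residual[OF V yc m(2)] y1_def[symmetric] e_def[symmetric]
    using e by (subst scalar_prod_append[of _ m _ "n - m"]) auto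
  have "e \<bullet> (V *\<^sub>v (V\<^sup>T *\<^sub>v y1)) = 0"
    unfolding scalar_prod_mult_mat_vec(1)[OF V(1) e Vy] Vte using Vy by simp
  then have ee: "e \<bullet> e = e \<bullet> y1"
    using scalar_prod_minus_distrib[OF e y1 VVy] by (simp add: e_def[symmetric])
  have first: "z \<bullet> vec_first (Xk *\<^sub>v b) m = (\<Sum>i<k. b $ i * (z \<bullet> x i))"
    if "z \<in> carrier_vec m" "b \<in> carrier_vec k" for z b
  proof -
    have z0: "z @\<^sub>v 0\<^sub>v (n - m) \<in> carrier_vec n"
      using that m carrier_vecI[of "z @\<^sub>v 0\<^sub>v (n - m)" n] by simp
    have Xb: "Xk *\<^sub>v b \<in> carrier_vec n" using that Xk1 by auto
    show ?thesis
      unfolding scalar_prod_vec_first[OF Xb that(1) m(2)] scalar_prod_mult_mat_vec_cols[OF Xk1(1) z0 that(2)]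
      using colXk DX(3) k m that
      by (intro sum.cong refl) (simp add: x_def scalar_prod_vec_first[of _ n])
  qed
  have rpos: "1 - t \<le> r i" if "i < k" for i
    using near1[OF that] unfolding r_def R_def by linarith
  have key: "r i * (e \<bullet> x i) = (\<Sum>j\<in>{h..<m}. R (\<theta> j) * (col S j \<bullet> e) * (col S j \<bullet> x i))"
    if "i < k" for i
  proof -
    have i: "i < n" using that k m by simp
    have "r i * (e \<bullet> x i) = (\<Sum>j<m. R (\<theta> j) * (col S j \<bullet> e) * (col S j \<bullet> x i))"
      unfolding r_def R_def x_def \<theta>_def
      by (rule leading_eigenvector_krylov[OF T m _ S DX(3)[OF i] DX(4)[OF i]])
        (use zero q that e Vte Ve(2)[OF e Vte] in auto)
    also have "\<dots> = (\<Sum>j\<in>{h..<m}. R (\<theta> j) * (col S j \<bullet> e) * (col S j \<bullet> x i))"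
      using Ve(1)[OF e Vte] by (intro sum.mono_neutral_right) auto
    finally show ?thesis .
  qed
  \<comment> \<open>Putting the factors \<open>1 / r i\<close> into the coefficients lets one vector
    \<open>v\<close> represent all \<open>k\<close> eigenvectors at once. Its length grows by at
    most \<open>1 / (1 - t)\<close>, because each \<open>r i\<close> is at least
    \<open>1 - t\<close>.\<close>
  define b where "b = vec k (\<lambda>i. a $ i / r i)"
  have b: "b \<in> carrier_vec k" by (simp add: b_def)
  define v where "v = vec_first (Xk *\<^sub>v b) m"
  have v: "v \<in> carrier_vec m" by (simp add: v_def)
  have "e \<bullet> e = (\<Sum>i<k. a $ i * (e \<bullet> x i))"
    unfolding ee y1_def y using first[OF e a] .
  also have "\<dots> = (\<Sum>i<k. b $ i * (\<Sum>j\<in>{h..<m}. R (\<theta> j) * (col S j \<bullet> e) * (col S j \<bullet> x i)))"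
  proof (rule sum.cong[OF refl])
    fix i assume "i \<in> {..<k}"
    then have i: "i < k" by simp
    have "r i \<noteq> 0" using rpos[OF i] tol by simp
    then show "a $ i * (e \<bullet> x i) = b $ i * (\<Sum>j\<in>{h..<m}. R (\<theta> j) * (col S j \<bullet> e) * (col S j \<bullet> x i))"
      unfolding key[OF i, symmetric] using i by (simp add: b_def)
  qed
  also have "\<dots> = (\<Sum>j\<in>{h..<m}. \<Sum>i<k. b $ i * (R (\<theta> j) * (col S j \<bullet> e) * (col S j \<bullet> x i)))"
    unfolding sum_distrib_left by (rule sum.swap)
  also have "\<dots> = (\<Sum>j\<in>{h..<m}. R (\<theta> j) * (col S j \<bullet> e) * (col S j \<bullet> v))"
  proof (rule sum.cong[OF refl])
    fix j assume "j \<in> {h..<m}"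
    then show "(\<Sum>i<k. b $ i * (R (\<theta> j) * (col S j \<bullet> e) * (col S j \<bullet> x i)))
        = R (\<theta> j) * (col S j \<bullet> e) * (col S j \<bullet> v)"
      unfolding v_def using first[OF DS(3) b, of j] by (simp add: sum_distrib_left mult_ac)
  qed
  finally have E: "e \<bullet> e = (\<Sum>j\<in>{h..<m}. R (\<theta> j) * (col S j \<bullet> e) * (col S j \<bullet> v))" .
  have tail: "(\<Sum>j\<in>{h..<m}. (col S j \<bullet> z)\<^sup>2) \<le> z \<bullet> z" if "z \<in> carrier_vec m" for z
    unfolding norm_spectral[OF Tm(1) S that] by (intro sum_mono2) auto
  have "v \<bullet> v \<le> (Xk *\<^sub>v b) \<bullet> (Xk *\<^sub>v b)"
    unfolding v_def using Xk1 b m by (intro norm_vec_first_le[of _ n]) auto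
  also have "\<dots> = b \<bullet> b" by (rule orthonormal_cols_isometry[OF Xk1 b b])
  also have "\<dots> = (\<Sum>i<k. (a $ i)\<^sup>2 / (r i)\<^sup>2)"
    by (simp add: b_def scalar_prod_def atLeast0LessThan power2_eq_square)
  also have "\<dots> \<le> (\<Sum>i<k. (a $ i)\<^sup>2 / (1 - t)\<^sup>2)"
  proof (rule sum_mono)
    fix i assume "i \<in> {..<k}"
    then have "(1 - t)\<^sup>2 \<le> (r i)\<^sup>2" "0 < r i" using rpos[of i] tol by (auto intro!: power_mono)
    then show "(a $ i)\<^sup>2 / (r i)\<^sup>2 \<le> (a $ i)\<^sup>2 / (1 - t)\<^sup>2"
      using tol by (intro divide_left_mono mult_pos_pos zero_less_power) auto
  qed
  also have "\<dots> = (a \<bullet> a) / (1 - t)\<^sup>2"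
    using a by (simp add: scalar_prod_def atLeast0LessThan power2_eq_square sum_divide_distrib)
  finally have vv: "v \<bullet> v \<le> (a \<bullet> a) / (1 - t)\<^sup>2" .
  have "e \<bullet> e \<le> t\<^sup>2 * ((a \<bullet> a) / (1 - t)\<^sup>2)"
    by (rule weighted_amgm[OF E tail[OF e]])
      (use tail[OF v] vv near0 tol in \<open>auto simp: R_def \<theta>_def intro: less_imp_le order.trans\<close>)
  then show ?thesis unfolding res by (simp add: power_divide)
qed

text \<open>\<open>V\<^sup>T *\<^sub>v e = 0\<^sub>v l\<close> says that \<open>e\<close> is
  orthogonal to the range of \<open>V\<close>. As that range is given as a set of sums, testing one
  summand needs a member of the other set: the zero vector for the Krylov part, and some Krylov
  vector for the eigenvectors.\<close>

lemma compression_range_orthogonal: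
  fixes T :: "real mat"
  assumes T: "T \<in> carrier_mat m m" "T\<^sup>T = T" and S: "ordered_eigenvectors T m S" and h: "h \<le> m"
    and V: "V \<in> carrier_mat m l"
    and range: "vec_space.col_space m V =
      {u + w | u w. u \<in> vec_space.col_space m (mat_of_cols m (take h (cols S))) \<and>
                    w \<in> rational_krylov T b p q}"
    and q: "\<And>j. j < m \<Longrightarrow> poly q (eigval T (Suc j)) \<noteq> 0" and b: "b \<in> carrier_vec m"
    and e: "e \<in> carrier_vec m" "V\<^sup>T *\<^sub>v e = 0\<^sub>v l"
  shows "\<And>w. w \<in> rational_krylov T b p q \<Longrightarrow> w \<in> carrier_vec m \<Longrightarrow> w \<bullet> e = 0"
    and "\<And>j. j < h \<Longrightarrow> col S j \<bullet> e = 0"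
proof -
  interpret vec_space "TYPE(real)" m .
  note D = ordered_eigenvectorsD[OF S T(1)]
  let ?M = "mat_of_cols m (take h (cols S))"
  have M: "?M \<in> carrier_mat m h" using D(1) h by auto
  have orth: "z \<bullet> e = 0" if z: "z \<in> col_space V" for z
  proof -
    obtain c where c: "c \<in> carrier_vec l" "V *\<^sub>v c = z"
      using z V unfolding col_space_eq[OF V] by auto
    have "z \<bullet> e = c \<bullet> (V\<^sup>T *\<^sub>v e)"
      unfolding c(2)[symmetric] by (rule scalar_prod_mult_mat_vec(2)[OF V e(1) c(1)])
    then show ?thesis unfolding e(2) using c by simp
  qed
  show w: "w \<bullet> e = 0" if "w \<in> rational_krylov T b p q" "w \<in> carrier_vec m" for w
  proof -
    have "?M *\<^sub>v 0\<^sub>v h = 0\<^sub>v m" using M by (rule mult_mat_zero_vec)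
    then have "0\<^sub>v m \<in> col_space ?M"
      unfolding col_space_eq[OF M] using M by (auto intro!: bexI[of _ "0\<^sub>v h"])
    then have "0\<^sub>v m + w \<in> col_space V" unfolding range using that by blast
    then show ?thesis using orth that(2) by simp
  qed
  show "col S j \<bullet> e = 0" if "j < h" for j
  proof -
    have j: "j < m" using that h by simp
    \<comment> \<open>Any Krylov vector will do as second summand, its product with \<open>e\<close>
      being already known to vanish.\<close>
    obtain w where w0: "w \<in> rational_krylov T b p q" "w \<in> carrier_vec m"
      using rational_krylov_spectral[OF T S q b, of 0 p] by auto
    have "col ?M j = col S j"
      by (subst col_mat_of_cols) (use D that h in \<open>auto simp: cols_def\<close>)
    then have "?M *\<^sub>v unit_vec h j = col S j"
      using col_eq_mult_unit_vec[OF M that] by simp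
    then have "col S j \<in> col_space ?M"
      unfolding col_space_eq[OF M] using M D(3)[OF j] by (auto intro!: bexI[of _ "unit_vec h j"])
    then have "col S j + w \<in> col_space V" unfolding range using w0 by blast
    then have "(col S j + w) \<bullet> e = 0" by (rule orth)
    then show ?thesis
      using w[OF w0] D(3)[OF j] w0(2) e(1) by (simp add: add_scalar_prod_distrib[of _ m])
  qed
qed

section \<open>The increase of the eigenvalue sum in one compression\<close>

lemma eigenvalue_eigval:
  fixes T :: "real mat"
  assumes T: "T \<in> carrier_mat m m" "T\<^sup>T = T" and j: "j < m"
  shows "eigenvalue T (eigval T (Suc j))"
proof -
  obtain S where S: "ordered_eigenvectors T m S" using ordered_eigenvectors_exist[OF T] by blast
  note D = ordered_eigenvectorsD[OF S T(1)]
  have "col S j \<bullet> col S j = 1" using D(1,2) j unfolding orthonormal_cols_iff by auto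
  then have "col S j \<noteq> 0\<^sub>v m" by auto
  then show ?thesis using D(3,4)[OF j] T unfolding eigenvalue_def eigenvector_def by auto
qed

lemma compression_matrixD:
  assumes "compression_matrix tol k T h p q V" and T: "T \<in> carrier_mat m m" and k: "1 \<le> k" "k < m"
  shows "V \<in> carrier_mat m (dim_col V)" "dim_col V < m" "orthonormal_cols V"
    "k \<le> h" "h < m" "eigval T k < eigval T (h + 1)"
    "\<exists>S. ordered_eigenvectors T m S \<and> vec_space.col_space m V =
         {u + w | u w. u \<in> vec_space.col_space m (mat_of_cols m (take h (cols S))) \<and>
                       w \<in> rational_krylov T (unit_vec m (m - 1)) p q}"
proof -
  have dim: "dim_row T = m" using T by simp
  note C = assms(1)[unfolded compression_matrix_def Let_def dim]
  have "optimal_split tol T k h" using C by (elim conjE)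
  then show "k \<le> h" "h < m" "eigval T k < eigval T (h + 1)"
    using k by (auto simp: optimal_split_def is_arg_min_def dim)
  show "V \<in> carrier_mat m (dim_col V)" using C by (elim conjE)
  show "dim_col V < m" using C by (elim conjE)
  show "orthonormal_cols V" using C by (elim conjE)
  show "\<exists>S. ordered_eigenvectors T m S \<and> vec_space.col_space m V =
         {u + w | u w. u \<in> vec_space.col_space m (mat_of_cols m (take h (cols S))) \<and>
                       w \<in> rational_krylov T (unit_vec m (m - 1)) p q}"
    using C by (elim conjE)
qed

lemma compression_step:
  fixes T :: "real mat"
  assumes T: "T \<in> carrier_mat n n" "T\<^sup>T = T" and k: "1 \<le> k" "k < m" and m: "m \<le> n"
    and zero: "\<And>i j. i < m - 1 \<Longrightarrow> m \<le> j \<Longrightarrow> j < n \<Longrightarrow> T $$ (i, j) = 0"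
    and compr: "compression_matrix tol k (leading_block m T) h p q V"
    and tol: "0 < tol" "tol < 1 / 2"
    and bounds: "lo \<le> hi" "\<And>j. 1 \<le> j \<Longrightarrow> j \<le> n \<Longrightarrow> lo \<le> eigval T j"
      "\<And>j. 1 \<le> j \<Longrightarrow> j \<le> n \<Longrightarrow> eigval T j \<le> hi"
    and lV: "k \<le> dim_col V + (n - m)"
    and tolerance: "\<And>x. x \<in> {lo..eigval (leading_block m T) m}
        - {eigval (leading_block m T) k<..<eigval (leading_block m T) (h + 1)} \<Longrightarrow>
      \<bar>poly p x / poly q x - step_fun (split_tau (leading_block m T) k h) x\<bar> < tol"
    and poles: "\<And>x. poly q x = 0 \<Longrightarrow> \<not> eigenvalue (leading_block m T) x"
  defines "P \<equiv> extend_id (n - m) V"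
  shows "(\<Sum>i<k. eigval (P\<^sup>T * T * P) (Suc i))
    \<le> (\<Sum>i<k. eigval T (Suc i)) + 4 * real k * (hi - lo) * tol\<^sup>2"
proof -
  define Tm where "Tm = leading_block m T"
  note Tm = leading_block_congruence[OF T m, folded Tm_def]
  note C = compression_matrixD[OF compr[folded Tm_def] Tm(1) k]
  note split = C(4-6)
  define l where "l = dim_col V"
  have V: "V \<in> carrier_mat m l" "orthonormal_cols V" using C(1,3) unfolding l_def .
  obtain S where S: "ordered_eigenvectors Tm m S"
      "vec_space.col_space m V =
         {u + w | u w. u \<in> vec_space.col_space m (mat_of_cols m (take h (cols S))) \<and>
                       w \<in> rational_krylov Tm (unit_vec m (m - 1)) p q}"
    using C(7) by blast
  note DS = ordered_eigenvectorsD[OF S(1) Tm(1)]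
  obtain X where X: "ordered_eigenvectors T n X" using ordered_eigenvectors_exist[OF T] by blast
  note mono = eigval_mono[OF Tm(1,2)]
  \<comment> \<open>\<open>split_tau\<close> is the midpoint of a gap of positive length, so outside
    the open gap the strict comparison with it amounts to a weak comparison with the left
    end.\<close>
  have step: "step_fun (split_tau Tm k h) x = (if x \<le> eigval Tm k then 1 else 0)"
    if "x \<le> eigval Tm k \<or> eigval Tm (h + 1) \<le> x" for x
    using that split(3) by (auto simp: step_fun_def split_tau_def field_simps)
  \<comment> \<open>Eigenvalues of \<open>T\<close> may lie below all those of its leading block,
    which is why the approximation must be accurate from \<open>lo\<close> on.\<close>
  have near1: "\<bar>poly p (eigval T (Suc i)) / poly q (eigval T (Suc i)) - 1\<bar> < tol" if "i < k" for i
  proof -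
    have le: "eigval T (Suc i) \<le> eigval Tm k"
      using Tm(3)[of "Suc i"] mono[of "Suc i" k] that k by simp
    then have "eigval T (Suc i) \<in> {lo..eigval Tm m} - {eigval Tm k<..<eigval Tm (h + 1)}"
      using bounds(2)[of "Suc i"] mono[of k m] that k m by auto
    from tolerance[folded Tm_def, OF this] show ?thesis using step le by simp
  qed
  have near0: "\<bar>poly p (eigval Tm (Suc j)) / poly q (eigval Tm (Suc j))\<bar> < tol"
    if "h \<le> j" "j < m" for j
  proof -
    have ge: "eigval Tm (h + 1) \<le> eigval Tm (Suc j)" using mono[of "h + 1" "Suc j"] that by simp
    have "lo \<le> eigval Tm (Suc j)"
      using bounds(2)[of "Suc j"] Tm(3)[of "Suc j"] that m by simp
    then have "eigval Tm (Suc j) \<in> {lo..eigval Tm m} - {eigval Tm k<..<eigval Tm (h + 1)}"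
      using mono[of "Suc j" m] that ge by auto
    from tolerance[folded Tm_def, OF this] show ?thesis using step[of "eigval Tm (Suc j)"] ge split(3) by simp
  qed
  \<comment> \<open>at a zero of \<open>q\<close> the quotient is \<open>0\<close>, hence not within \<open>tol\<close> of \<open>1\<close>\<close>
  have qT: "poly q (eigval T (Suc i)) \<noteq> 0" if "i < k" for i
    using near1[OF that] tol by auto
  have qTm: "poly q (eigval Tm (Suc j)) \<noteq> 0" if "j < m" for j
    using poles[folded Tm_def] eigenvalue_eigval[OF Tm(1,2) that] by blast
  define Xk where "Xk = mat_of_cols n (map (col X) [0..<k])"
  have P: "P \<in> carrier_mat n (l + (n - m))" "orthonormal_cols P"
    using extend_id(1,2)[OF V, of "n - m"] m by (auto simp: P_def)
  define \<kappa> where "\<kappa> = (tol / (1 - tol))\<^sup>2"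
  \<comment> \<open>Here \<open>tol < 1 / 2\<close> enters twice: the first bound keeps the
    projected eigenvectors independent, and the second, squared, is the origin of the constant
    \<open>4\<close>.\<close>
  have t1: "tol / (1 - tol) < 1" "tol / (1 - tol) \<le> 2 * tol" "0 \<le> tol / (1 - tol)"
    using tol by (auto simp: field_simps)
  have "\<kappa> < 1" unfolding \<kappa>_def using power_strict_mono[OF t1(1,3), of 2] by simp
  have \<kappa>: "\<kappa> \<le> 4 * tol\<^sup>2"
    using power_mono[OF t1(2,3), of 2] by (simp add: \<kappa>_def power_mult_distrib)
  have Ve1: "col S j \<bullet> e = 0" if "e \<in> carrier_vec m" "V\<^sup>T *\<^sub>v e = 0\<^sub>v l" "j < h" for e j
    by (rule compression_range_orthogonal(2)[OF Tm(1,2) S(1) _ V(1) S(2) _ _ that(1,2,3)])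
      (use qTm split in auto)
  have Ve2: "w \<bullet> e = 0" if "e \<in> carrier_vec m" "V\<^sup>T *\<^sub>v e = 0\<^sub>v l"
    "w \<in> rational_krylov Tm (unit_vec m (m - 1)) p q" "w \<in> carrier_vec m" for e w
    by (rule compression_range_orthogonal(1)[OF Tm(1,2) S(1) _ V(1) S(2) _ _ that(1,2,3,4)])
      (use qTm split in auto)
  have "1 \<le> m" "k \<le> m" "tol < 1" "P = extend_id (n - m) V" using k tol by (auto simp: P_def)
  have "(\<Sum>i<k. eigval (P\<^sup>T * T * P) (Suc i)) \<le> (\<Sum>i<k. eigval T (Suc i)) + (hi - lo) * (real k * \<kappa>)"
  proof (rule eigval_sum_congruence[OF T X P _ _ \<open>\<kappa> < 1\<close> Xk_def])
    fix a y :: "real vec" assume "a \<in> carrier_vec k" "y = Xk *\<^sub>v a"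
    show "(y - P *\<^sub>v (P\<^sup>T *\<^sub>v y)) \<bullet> (y - P *\<^sub>v (P\<^sup>T *\<^sub>v y)) \<le> \<kappa> * (a \<bullet> a)"
      unfolding \<kappa>_def
      by (rule compression_residual[where n = n and m = m and T = T and k = k and S = S and X = X
            and V = V and l = l and h = h and p = p and q = q and Xk = Xk, folded Tm_def]; fact)
  qed (use k m lV bounds in \<open>auto simp: l_def\<close>)
  also have "(hi - lo) * (real k * \<kappa>) \<le> (hi - lo) * (real k * (4 * tol\<^sup>2))"
    using \<kappa> bounds(1) by (intro mult_left_mono) auto
  finally show ?thesis by (simp add: algebra_simps)
qed

section \<open>The Lanczos vectors\<close>

lemma congruence_index:
  fixes A :: "real mat"
  assumes "A \<in> carrier_mat n n" "Z \<in> carrier_mat n k" "i < k" "j < k"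
  shows "(Z\<^sup>T * A * Z) $$ (i, j) = col Z i \<bullet> (A *\<^sub>v col Z j)"
proof -
  have "Z\<^sup>T * A * Z = Z\<^sup>T * (A * Z)" using assms by (intro assoc_mult_mat) auto
  moreover have "col (A * Z) j = A *\<^sub>v col Z j" using assms by (intro eq_vecI) auto
  ultimately show ?thesis using assms by simp
qed

lemma orthonormal_cols_mult:
  assumes "Z \<in> carrier_mat n k" "orthonormal_cols Z" "P \<in> carrier_mat k l" "orthonormal_cols P"
  shows "orthonormal_cols (Z * P)"
proof -
  have c: "col P i \<in> carrier_vec k" for i using assms(3) by (intro carrier_vecI) simp
  have "col (Z * P) i = Z *\<^sub>v col P i" if "i < l" for i
    using assms that by (intro eq_vecI) auto
  then show ?thesis
    using assms unfolding orthonormal_cols_iff[of "Z * P"] orthonormal_cols_iff[of P]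
    by (auto simp: orthonormal_cols_isometry[OF assms(1,2) c c])
qed

text \<open>\<open>N\<close> will be the final number of matrix-vector products, so the vectors of
  all later rounds are at hand for completing an earlier basis.\<close>

locale lanczos =
  fixes A :: "real mat" and n N :: nat and q1 :: "real vec" and q :: "nat \<Rightarrow> real vec"
    and \<alpha> \<beta> :: "nat \<Rightarrow> real"
  assumes A: "A \<in> carrier_mat n n" "A\<^sup>T = A"
    and q1: "q1 \<in> carrier_vec n" "vnorm q1 = 1"
    and process: "lanczos_process A q1 N q \<alpha> \<beta>"
    and N: "1 \<le> N"
begin

lemma q_0: "q 0 = 0\<^sub>v n" and q_1: "q 1 = q1" and beta_0: "\<beta> 0 = 0"
  and alpha: "1 \<le> i \<Longrightarrow> i \<le> N \<Longrightarrow> \<alpha> i = q i \<bullet> (A *\<^sub>v q i)"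
  and beta_pos: "1 \<le> i \<Longrightarrow> i < N \<Longrightarrow> \<beta> i > 0"
  and norm_q: "1 \<le> i \<Longrightarrow> i < N \<Longrightarrow> vnorm (q (i + 1)) = 1"
  and q_Suc: "1 \<le> i \<Longrightarrow> i < N \<Longrightarrow>
    q (i + 1) = (1 / \<beta> i) \<cdot>\<^sub>v (A *\<^sub>v q i - \<alpha> i \<cdot>\<^sub>v q i - \<beta> (i - 1) \<cdot>\<^sub>v q (i - 1))"
proof -
  note P = process[unfolded lanczos_process_def carrier_matD(1)[OF A(1)]]
  show "q 0 = 0\<^sub>v n" "q 1 = q1" "\<beta> 0 = 0" using P by auto
  show "1 \<le> i \<Longrightarrow> i \<le> N \<Longrightarrow> \<alpha> i = q i \<bullet> (A *\<^sub>v q i)" using P by simp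
  show "1 \<le> i \<Longrightarrow> i < N \<Longrightarrow> \<beta> i > 0" using P by simp
  show "1 \<le> i \<Longrightarrow> i < N \<Longrightarrow> vnorm (q (i + 1)) = 1" using P atLeastLessThan_iff by blast
  show "1 \<le> i \<Longrightarrow> i < N \<Longrightarrow>
    q (i + 1) = (1 / \<beta> i) \<cdot>\<^sub>v (A *\<^sub>v q i - \<alpha> i \<cdot>\<^sub>v q i - \<beta> (i - 1) \<cdot>\<^sub>v q (i - 1))"
    using P atLeastLessThan_iff by blast
qed

lemma q_carrier: "i \<le> N \<Longrightarrow> q i \<in> carrier_vec n"
proof (induction i rule: less_induct)
  case (less i)
  consider "i = 0" | "i = 1" | j where "i = j + 1" "1 \<le> j"
    by (metis Suc_eq_plus1 le_eq_less_or_eq less_Suc_eq_0_disj not_less_eq_eq One_nat_def not0_implies_Suc)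
  then show ?case
  proof cases
    case 3
    then have "q j \<in> carrier_vec n" "q (j - 1) \<in> carrier_vec n" using less by auto
    then show ?thesis using 3 less.prems A q_Suc[of j] by simp
  qed (use q_0 q_1 q1 in auto)
qed

lemma norm_q_1: "1 \<le> i \<Longrightarrow> i \<le> N \<Longrightarrow> q i \<bullet> q i = 1"
  using norm_q[of "i - 1"] q_1 q1 by (cases "i = 1") (auto simp: vnorm_def)

text \<open>The next Lanczos direction after \<open>N\<close> steps, left unnormalized because it
  may be zero.\<close>

definition residual :: "real vec" where
  "residual = A *\<^sub>v q N - \<alpha> N \<cdot>\<^sub>v q N - \<beta> (N - 1) \<cdot>\<^sub>v q (N - 1)"

lemma residual_carrier: "residual \<in> carrier_vec n"
  unfolding residual_def using A q_carrier[of N] q_carrier[of "N - 1"] by auto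

lemma three_term:
  assumes "1 \<le> i" "i \<le> N"
  shows "A *\<^sub>v q i = (if i < N then \<beta> i \<cdot>\<^sub>v q (i + 1) else residual)
    + \<alpha> i \<cdot>\<^sub>v q i + \<beta> (i - 1) \<cdot>\<^sub>v q (i - 1)"
proof -
  have c: "q i \<in> carrier_vec n" "q (i - 1) \<in> carrier_vec n" using assms q_carrier by auto
  have "(if i < N then \<beta> i \<cdot>\<^sub>v q (i + 1) else residual)
      = A *\<^sub>v q i - \<alpha> i \<cdot>\<^sub>v q i - \<beta> (i - 1) \<cdot>\<^sub>v q (i - 1)"
    using assms q_Suc[of i] beta_pos[of i] A c by (auto simp: smult_smult_assoc residual_def)
  then show ?thesis using A c by (intro eq_vecI) auto
qed

lemma scalar_prod_A_q:
  assumes "1 \<le> i" "i \<le> N" "v \<in> carrier_vec n"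
  shows "v \<bullet> (A *\<^sub>v q i) = (if i < N then \<beta> i * (v \<bullet> q (i + 1)) else v \<bullet> residual)
    + \<alpha> i * (v \<bullet> q i) + \<beta> (i - 1) * (v \<bullet> q (i - 1))"
proof -
  have c: "q i \<in> carrier_vec n" "q (i - 1) \<in> carrier_vec n" "i < N \<Longrightarrow> q (i + 1) \<in> carrier_vec n"
    using assms q_carrier by auto
  show ?thesis unfolding three_term[OF assms(1,2)]
    using assms(3) c residual_carrier by (auto simp: scalar_prod_add_distrib[of _ n])
qed

lemma A_q_sym:
  assumes "i \<le> N" "j \<le> N"
  shows "q i \<bullet> (A *\<^sub>v q j) = q j \<bullet> (A *\<^sub>v q i)"
proof -
  have c: "q i \<in> carrier_vec n" "q j \<in> carrier_vec n" using assms q_carrier by auto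
  have "q i \<bullet> (A *\<^sub>v q j) = (A *\<^sub>v q i) \<bullet> q j" using scalar_prod_mult_mat_vec(1)[OF A(1) c] A(2) by simp
  also have "\<dots> = q j \<bullet> (A *\<^sub>v q i)" using A c by (intro comm_scalar_prod[of _ n]) auto
  finally show ?thesis .
qed

text \<open>By symmetry \<open>A\<close> is moved from \<open>q j\<close> to \<open>q i\<close>,
  whose three-term expansion reaches no further than \<open>q (i + 1)\<close>. For
  \<open>i + 1 < j\<close> everything vanishes by induction; for \<open>i + 1 = j\<close> the two
  \<open>\<beta>\<close> terms cancel, and for \<open>i = j\<close> the choice of
  \<open>\<alpha>\<close> does it.\<close>

lemma q_orthogonal: "1 \<le> i \<Longrightarrow> i < j \<Longrightarrow> j \<le> N \<Longrightarrow> q i \<bullet> q j = 0"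
proof (induction j arbitrary: i rule: less_induct)
  case (less j')
  define j where "j = j' - 1"
  have j: "j' = j + 1" "1 \<le> j" "j < N" "1 \<le> i" "i \<le> j" using less.prems by (auto simp: j_def)
  have qi: "q i \<in> carrier_vec n" using j q_carrier by auto
  have lower: "q l \<bullet> q a = 0" "q a \<bullet> q l = 0" if "a < l" "l \<le> j" for a l
  proof -
    have c: "q a \<in> carrier_vec n" "q l \<in> carrier_vec n" using that j q_carrier by auto
    show "q a \<bullet> q l = 0"
      using less.IH[of l a] that j q_0 c by (cases "a = 0") auto
    then show "q l \<bullet> q a = 0" using comm_scalar_prod[OF c] by simp
  qed
  have eq: "\<beta> j * (q i \<bullet> q (j + 1)) = q i \<bullet> (A *\<^sub>v q j) - \<alpha> j * (q i \<bullet> q j) - \<beta> (j - 1) * (q i \<bullet> q (j - 1))"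
    using scalar_prod_A_q[of j, OF _ _ qi] j by simp
  have "\<beta> j * (q i \<bullet> q (j + 1)) = 0"
  proof (cases "i = j")
    case True
    then show ?thesis unfolding eq using j alpha[of j] norm_q_1[of j] lower[of "j - 1" j] by simp
  next
    case False
    then have ij: "i < j" using j by simp
    have qj: "q j \<in> carrier_vec n" using j q_carrier by auto
    have "q i \<bullet> (A *\<^sub>v q j) = q j \<bullet> (A *\<^sub>v q i)" using A_q_sym j by simp
    also have "\<dots> = \<beta> i * (q j \<bullet> q (i + 1))"
      using scalar_prod_A_q[of i, OF _ _ qj] j ij lower[of i j] lower[of "i - 1" j] by simp
    finally have 1: "q i \<bullet> (A *\<^sub>v q j) = \<beta> i * (q j \<bullet> q (i + 1))" .
    show ?thesis
    proof (cases "i + 1 = j")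
      case True
      then have "j - 1 = i" by simp
      then show ?thesis unfolding eq 1 using True j lower[of i j] norm_q_1[of j] norm_q_1[of i] by simp
    next
      case False
      then show ?thesis unfolding eq 1 using ij j lower[of i j] lower[of "i + 1" j] lower[of i "j - 1"] by simp
    qed
  qed
  then show ?case using beta_pos[of j] j by simp
qed

lemma q_orthonormal:
  assumes "1 \<le> i" "i \<le> N" "1 \<le> j" "j \<le> N"
  shows "q i \<bullet> q j = (if i = j then 1 else 0)"
  using q_orthogonal[of i j] q_orthogonal[of j i] norm_q_1[of i] assms
    comm_scalar_prod[OF q_carrier[of i] q_carrier[of j]]
  by (cases i j rule: linorder_cases) auto

lemma q_A_q:
  assumes "1 \<le> i" "i < j" "j \<le> N"
  shows "q i \<bullet> (A *\<^sub>v q j) = (if j = i + 1 then \<beta> i else 0)"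
proof -
  have qj: "q j \<in> carrier_vec n" using assms q_carrier by auto
  have "q j \<bullet> q (i - 1) = 0 \<or> i = 1" using q_orthonormal[of j "i - 1"] assms by auto
  then have "q j \<bullet> q (i - 1) = 0" using q_0 qj by auto
  then have "q j \<bullet> (A *\<^sub>v q i) = \<beta> i * (q j \<bullet> q (i + 1))"
    using scalar_prod_A_q[of i, OF _ _ qj] q_orthonormal[of j i] assms by simp
  then show ?thesis using A_q_sym[of i j] q_orthonormal[of j "i + 1"] assms by auto
qed

text \<open>The computation for a next Lanczos vector, without division by \<open>\<beta>\<close>.
  It closes the recurrence at \<open>N\<close>: the part of \<open>A *\<^sub>v q N\<close> outside
  the Lanczos basis is invisible in every projection.\<close>

lemma residual_orthogonal:
  assumes "1 \<le> i" "i \<le> N"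
  shows "q i \<bullet> residual = 0"
proof -
  have qi: "q i \<in> carrier_vec n" using assms q_carrier by auto
  have 0: "q i \<bullet> q 0 = 0" using q_0 qi by simp
  have eq: "q i \<bullet> (A *\<^sub>v q N) = q i \<bullet> residual + \<alpha> N * (q i \<bullet> q N) + \<beta> (N - 1) * (q i \<bullet> q (N - 1))"
    using scalar_prod_A_q[of N "q i"] N qi by simp
  show ?thesis
  proof (cases "i = N")
    case True
    have "q i \<bullet> q (N - 1) = 0"
    proof (cases "N = 1")
      case False
      then show ?thesis using q_orthonormal[of i "N - 1"] True N by simp
    qed (use 0 in simp)
    then show ?thesis using eq alpha[of N] norm_q_1[of N] True N by simp
  next
    case False
    then have "i < N" "N = i + 1 \<longleftrightarrow> i = N - 1" "1 \<le> N - 1" "N - 1 \<noteq> N" using assms by auto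
    then show ?thesis
      using eq q_A_q[of i N] q_orthonormal[of i N] q_orthonormal[of i "N - 1"] assms
      by (cases "i = N - 1") auto
  qed
qed

definition lanczos_basis :: "real mat" where
  "lanczos_basis = mat_of_cols n (map (\<lambda>j. q (j + 1)) [0..<N])"

lemma lanczos_basis:
  "lanczos_basis \<in> carrier_mat n N" "orthonormal_cols lanczos_basis"
  "j < N \<Longrightarrow> col lanczos_basis j = q (j + 1)"
  unfolding lanczos_basis_def using q_carrier q_orthonormal
  by (auto intro!: orthonormal_cols_mat_of_cols)

lemma lanczos_tridiag_eq: "lanczos_basis\<^sup>T * A * lanczos_basis = lanczos_tridiag \<alpha> \<beta> N"
proof (rule eq_matI)
  fix i j assume "i < dim_row (lanczos_tridiag \<alpha> \<beta> N)" "j < dim_col (lanczos_tridiag \<alpha> \<beta> N)"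
  then have ij: "i < N" "j < N" by (auto simp: lanczos_tridiag_def)
  have "(lanczos_basis\<^sup>T * A * lanczos_basis) $$ (i, j) = q (i + 1) \<bullet> (A *\<^sub>v q (j + 1))"
    using congruence_index[OF A(1) lanczos_basis(1) ij] lanczos_basis(3) ij by simp
  then show "(lanczos_basis\<^sup>T * A * lanczos_basis) $$ (i, j) = lanczos_tridiag \<alpha> \<beta> N $$ (i, j)"
    using ij alpha[of "i + 1"] q_A_q[of "i + 1" "j + 1"] q_A_q[of "j + 1" "i + 1"]
      A_q_sym[of "i + 1" "j + 1"]
    by (cases i j rule: linorder_cases) (auto simp: lanczos_tridiag_def)
qed (use lanczos_basis in \<open>auto simp: lanczos_tridiag_def\<close>)

section \<open>The compressed process reproduces the Lanczos vectors\<close>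

text \<open>In the three-term expansion of \<open>A *\<^sub>v q a\<close>, projection removes
  exactly the terms in \<open>q a\<close> and \<open>q (a - 1)\<close> when these lie in the range
  of \<open>W\<close> and \<open>q (a + 1)\<close> is orthogonal to it. Membership in the range is
  expressed by the reverse of Bessel's inequality, which forces the projection residual to be
  zero.\<close>

lemma orthogonalize_eq:
  assumes W: "W \<in> carrier_mat n l" "orthonormal_cols W" and a: "1 \<le> a" "a < N"
    and fix1: "q a \<bullet> q a \<le> (W\<^sup>T *\<^sub>v q a) \<bullet> (W\<^sup>T *\<^sub>v q a)"
    and fix2: "q (a - 1) \<bullet> q (a - 1) \<le> (W\<^sup>T *\<^sub>v q (a - 1)) \<bullet> (W\<^sup>T *\<^sub>v q (a - 1))"
    and orth: "\<And>j. j < l \<Longrightarrow> col W j \<bullet> q (a + 1) = 0"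
  shows "orthogonalize W (A *\<^sub>v q a) = q (a + 1)"
proof -
  define proj where "proj v = W *\<^sub>v (W\<^sup>T *\<^sub>v v)" for v
  have pc: "proj v \<in> carrier_vec n" if "v \<in> carrier_vec n" for v using W that by (auto simp: proj_def)
  have c: "q a \<in> carrier_vec n" "q (a - 1) \<in> carrier_vec n" "q (a + 1) \<in> carrier_vec n"
    using a q_carrier by auto
  have "proj v = v" if v: "v \<in> carrier_vec n" and le: "v \<bullet> v \<le> (W\<^sup>T *\<^sub>v v) \<bullet> (W\<^sup>T *\<^sub>v v)" for v
  proof -
    have "(v - proj v) \<bullet> (v - proj v) \<le> 0"
      using norm_projection_residual[OF W v] le by (simp add: proj_def)
    then have "v - proj v = 0\<^sub>v n"
      using scalar_prod_self_nonneg[of "v - proj v"] v pc[OF v]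
      by (intro scalar_prod_self_eq_0) auto
    then have "v $ i - proj v $ i = 0" if "i < n" for i
      using that pc[OF v] v by (metis carrier_vecD index_minus_vec(1) index_zero_vec(1))
    then show ?thesis using v pc[OF v] by (intro eq_vecI) auto
  qed
  then have p1: "proj (q a) = q a" "proj (q (a - 1)) = q (a - 1)" using fix1 fix2 c by auto
  have "W\<^sup>T *\<^sub>v q (a + 1) = 0\<^sub>v l" using W c orth by (intro eq_vecI) auto
  then have p0: "proj (q (a + 1)) = 0\<^sub>v n"
    unfolding proj_def using mult_mat_zero_vec[OF W(1)] by simp
  have lin: "proj (b \<cdot>\<^sub>v u + d \<cdot>\<^sub>v v + f \<cdot>\<^sub>v w) = b \<cdot>\<^sub>v proj u + d \<cdot>\<^sub>v proj v + f \<cdot>\<^sub>v proj w"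
    if "u \<in> carrier_vec n" "v \<in> carrier_vec n" "w \<in> carrier_vec n" for b d f u v w
  proof -
    have Wc: "W\<^sup>T \<in> carrier_mat l n" using W by simp
    have k: "W\<^sup>T *\<^sub>v z \<in> carrier_vec l" if "z \<in> carrier_vec n" for z using that W by auto
    show ?thesis
      unfolding proj_def using that W k pc[unfolded proj_def]
      by (simp add: mult_add_distrib_mat_vec[OF Wc] mult_add_distrib_mat_vec[OF W(1)]
          mult_mat_vec[OF Wc] mult_mat_vec[OF W(1)] assoc_add_vec[of _ n])
  qed
  have Aq: "A *\<^sub>v q a = \<beta> a \<cdot>\<^sub>v q (a + 1) + \<alpha> a \<cdot>\<^sub>v q a + \<beta> (a - 1) \<cdot>\<^sub>v q (a - 1)"
    using three_term[of a] a by simp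
  have "A *\<^sub>v q a - proj (A *\<^sub>v q a) = \<beta> a \<cdot>\<^sub>v q (a + 1)"
    unfolding Aq lin[OF c(3,1,2)] p1 p0 using c by (intro eq_vecI) auto
  moreover have "vnorm (\<beta> a \<cdot>\<^sub>v q (a + 1)) = \<beta> a"
    using c beta_pos[OF a] norm_q_1[of "a + 1"] a by (simp add: vnorm_def)
  ultimately show ?thesis
    using beta_pos[OF a] c by (simp add: orthogonalize_def Let_def proj_def smult_smult_assoc)
qed

text \<open>Each step needs its two preceding Lanczos vectors in the current range. From the second
  step on both have been appended as columns; the first step relies on \<open>proj\<close> for
  \<open>q i\<close>. The next vector is described only before \<open>N\<close>, since afterwards a
  possibly zero residual would be normalized.\<close>

lemma lanczos_steps:
  assumes Q: "Q \<in> carrier_mat n l" "orthonormal_cols Q" and i: "1 \<le> i" "i + t \<le> N"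
    and orth: "\<And>j a. j < l \<Longrightarrow> i < a \<Longrightarrow> a \<le> N \<Longrightarrow> col Q j \<bullet> q a = 0"
    and proj: "Q *\<^sub>v (Q\<^sup>T *\<^sub>v q i) = q i"
    and x: "i < N \<Longrightarrow> x = q (i + 1)"
  shows "\<exists>x'. (lanczos_step A ^^ t) (Q, x, i)
      = (mat_of_cols n (cols Q @ map q [i + 1..<i + t + 1]), x', i + t) \<and>
    (i + t < N \<longrightarrow> x' = q (i + t + 1))"
  using i(2)
proof (induction t)
  case 0
  have "mat_of_cols n (cols Q) = Q" using Q mat_of_cols_cols[of Q] by simp
  then show ?case using x by simp
next
  case (Suc t)
  let ?a = "i + t + 1"
  let ?L = "cols Q @ map q [i + 1..<i + t + 1]"
  let ?L' = "cols Q @ map q [i + 1..<i + Suc t + 1]"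
  let ?W = "mat_of_cols n ?L'"
  obtain x' where x': "(lanczos_step A ^^ t) (Q, x, i) = (mat_of_cols n ?L, x', i + t)"
      "x' = q ?a"
    using Suc by auto
  have Qc: "col Q j \<in> carrier_vec n" for j using Q(1) by (intro carrier_vecI) simp
  have L: "set ?L \<subseteq> carrier_vec n" "set ?L' \<subseteq> carrier_vec n"
    using Q(1) q_carrier Suc.prems cols_dim[of Q] by auto
  have L': "?L @ [q ?a] = ?L'" by simp
  have step: "(lanczos_step A ^^ Suc t) (Q, x, i) = (?W, orthogonalize ?W (A *\<^sub>v q ?a), i + Suc t)"
  proof -
    have "(lanczos_step A ^^ Suc t) (Q, x, i) = lanczos_step A (mat_of_cols n ?L, q ?a, i + t)"
      using x' by simp
    then show ?thesis
      using L' by (simp only: lanczos_step_def Let_def case_prod_conv cols_mat_of_cols[OF L(1)]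
          carrier_matD(1)[OF A(1)]) simp
  qed
  have "orthogonalize ?W (A *\<^sub>v q ?a) = q (?a + 1)" if a: "?a < N"
  proof (rule orthogonalize_eq[OF _ _ _ a])
    let ?k = "l + Suc t"
    have len: "length ?L' = ?k" using Q by simp
    show W: "?W \<in> carrier_mat n ?k" using len mat_of_cols_carrier(1)[of n ?L'] by (simp del: upt_Suc)
    have colW: "col ?W j = (if j < l then col Q j else q (i + 1 + (j - l)))" if "j < ?k" for j
    proof -
      have j: "j < length ?L'" using len that by (simp del: upt_Suc)
      have "col ?W j = ?L' ! j" using nth_mem[OF j] L(2) by (intro col_mat_of_cols[OF j]) blast
      also have "\<dots> = (if j < l then col Q j else q (i + 1 + (j - l)))"
        using that Q(1) by (auto simp: nth_append simp del: upt_Suc)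
      finally show ?thesis .
    qed
    have orth': "q a \<bullet> col Q j = 0" if "j < l" "i < a" "a \<le> N" for j a
      using orth[OF that] comm_scalar_prod[OF q_carrier Qc, of a j] that by simp
    have "col ?W j \<bullet> col ?W j' = (if j = j' then 1 else 0)" if "j < ?k" "j' < ?k" for j j'
      unfolding colW[OF that(1)] colW[OF that(2)]
      using that a Q orth orth' q_orthonormal i(1) unfolding orthonormal_cols_iff by auto
    then show "orthonormal_cols ?W" unfolding orthonormal_cols_iff using W by auto
    show "col ?W j \<bullet> q (?a + 1) = 0" if "j < ?k" for j
      unfolding colW[OF that] using that a orth q_orthonormal i(1) by auto
    have qW: "q b \<bullet> q b \<le> (?W\<^sup>T *\<^sub>v q b) \<bullet> (?W\<^sup>T *\<^sub>v q b)" if b: "i < b" "b \<le> ?a" for b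
    proof -
      have qb: "q b \<in> carrier_vec n" using b a q_carrier by auto
      have "q b = col ?W (b - i - 1 + l)" using b by (subst colW) auto
      moreover have "(col ?W (b - i - 1 + l) \<bullet> q b)\<^sup>2 \<le> (\<Sum>j<?k. (col ?W j \<bullet> q b)\<^sup>2)"
        using b by (intro member_le_sum[of _ _ "\<lambda>j. (col ?W j \<bullet> q b)\<^sup>2"]) auto
      ultimately show ?thesis
        unfolding scalar_prod_transpose_mult[OF W qb qb]
        using q_orthonormal[of b b] b a by (simp add: power2_eq_square)
    qed
    show "q ?a \<bullet> q ?a \<le> (?W\<^sup>T *\<^sub>v q ?a) \<bullet> (?W\<^sup>T *\<^sub>v q ?a)" by (rule qW) auto
    show "q (?a - 1) \<bullet> q (?a - 1) \<le> (?W\<^sup>T *\<^sub>v q (?a - 1)) \<bullet> (?W\<^sup>T *\<^sub>v q (?a - 1))"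
    \<comment> \<open>For \<open>t = 0\<close> the vector is \<open>q i\<close>, which is no
      appended column but lies in the range of \<open>Q\<close>.\<close>
    proof (cases "t = 0")
      case False
      then show ?thesis by (intro qW) auto
    next
      case True
      have qi: "q i \<in> carrier_vec n" using a q_carrier by auto
      have Qq: "Q\<^sup>T *\<^sub>v q i \<in> carrier_vec l" using Q qi by auto
      have colQ: "col ?W j = col Q j" if "j < l" for j using colW[of j] that by (simp del: upt_Suc)
      have "q i \<bullet> q i = (Q\<^sup>T *\<^sub>v q i) \<bullet> (Q\<^sup>T *\<^sub>v q i)"
        using orthonormal_cols_isometry[OF Q Qq Qq] unfolding proj .
      also have "\<dots> = (\<Sum>j<l. (col ?W j \<bullet> q i) * (col ?W j \<bullet> q i))"
        unfolding scalar_prod_transpose_mult[OF Q(1) qi qi]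
        by (intro sum.cong refl) (simp only: lessThan_iff colQ)
      also have "\<dots> \<le> (\<Sum>j<?k. (col ?W j \<bullet> q i) * (col ?W j \<bullet> q i))"
        by (intro sum_mono2) auto
      also have "\<dots> = (?W\<^sup>T *\<^sub>v q i) \<bullet> (?W\<^sup>T *\<^sub>v q i)"
        using scalar_prod_transpose_mult[OF W qi qi] by simp
      finally show ?thesis using True by simp
    qed
  qed (use i in auto)
  then show ?case unfolding step by auto
qed

end

section \<open>The completed basis from round to round\<close>

lemma first_cols_mult_vec:
  fixes Z :: "real mat"
  assumes Z: "Z \<in> carrier_mat n (m + r)" and v: "v \<in> carrier_vec m"
  shows "mat_of_cols n (map (col Z) [0..<m]) *\<^sub>v v = Z *\<^sub>v (v @\<^sub>v 0\<^sub>v r)"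
proof (rule eq_vecI)
  fix i assume "i < dim_vec (Z *\<^sub>v (v @\<^sub>v 0\<^sub>v r))"
  then have i: "i < n" using Z by simp
  have "(Z *\<^sub>v (v @\<^sub>v 0\<^sub>v r)) $ i = (\<Sum>j<m + r. Z $$ (i, j) * (v @\<^sub>v 0\<^sub>v r) $ j)"
    using i Z v by (auto simp: scalar_prod_def atLeast0LessThan intro!: sum.cong)
  also have "\<dots> = (\<Sum>j<m. Z $$ (i, j) * (v @\<^sub>v 0\<^sub>v r) $ j)"
    using v by (intro sum.mono_neutral_right) auto
  also have "\<dots> = (mat_of_cols n (map (col Z) [0..<m]) *\<^sub>v v) $ i"
    using i Z v by (auto simp: scalar_prod_def atLeast0LessThan mat_of_cols_index intro!: sum.cong)
  finally show "(mat_of_cols n (map (col Z) [0..<m]) *\<^sub>v v) $ i = (Z *\<^sub>v (v @\<^sub>v 0\<^sub>v r)) $ i" by simp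
qed (use Z in simp)

lemma col_extend_id:
  assumes V: "V \<in> carrier_mat m l" and j: "j < l + r"
  shows "col (extend_id r V) j =
    (if j < l then col V j @\<^sub>v 0\<^sub>v r else unit_vec (m + r) (m + (j - l)))"
  using assms by (intro eq_vecI) auto

context lanczos
begin

text \<open>\<open>Z\<close> is the current basis completed by the Lanczos vectors still to come, so that
  \<open>Z\<^sup>T A Z\<close> is the matrix \<open>T\<^sup>(\<^sup>c\<^sup>)\<close> of the paper.\<close>

definition compressed_state :: "nat \<Rightarrow> real mat \<times> real vec \<times> nat \<Rightarrow> real mat \<Rightarrow> bool" where
  "compressed_state m s Z \<longleftrightarrow> (case s of (Q, x, i) \<Rightarrow>
     m \<le> i \<and> i \<le> N \<and> Z \<in> carrier_mat n (m + (N - i)) \<and> orthonormal_cols Z \<and>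
     (\<forall>j. m - 1 \<le> j \<longrightarrow> j < m + (N - i) \<longrightarrow> col Z j = q (i + 1 + j - m)) \<and>
     Z\<^sup>T *\<^sub>v residual = 0\<^sub>v (m + (N - i)) \<and>
     Q = mat_of_cols n (map (col Z) [0..<m]) \<and> (i < N \<longrightarrow> x = q (i + 1)))"

lemma compressed_state_0:
  assumes m: "1 \<le> m" "m \<le> N"
  shows "compressed_state m (lc_state A q m V 0) lanczos_basis"
proof -
  have "map q [1..<m + 1] = map (col lanczos_basis) [0..<m]"
    by (rule nth_equalityI) (use m lanczos_basis(3) in \<open>auto simp del: upt_Suc\<close>)
  moreover have "lanczos_basis\<^sup>T *\<^sub>v residual = 0\<^sub>v N"
    using lanczos_basis residual_orthogonal by (intro eq_vecI) auto
  ultimately show ?thesis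
    using m lanczos_basis A by (auto simp: compressed_state_def simp del: upt_Suc)
qed

text \<open>The columns of the new completed basis are those of \<open>Q * V\<close> followed by
  \<open>q (i + 1)\<close>, ..., \<open>q N\<close>. The \<open>m - l\<close> expansion steps only
  transfer the first of these future vectors to the current basis, so compression alone alters the
  completed one.\<close>

lemma compressed_state_Suc:
  assumes s: "compressed_state m (Q, x, i) Z" and V: "V \<in> carrier_mat m l" "orthonormal_cols V" "l < m"
    and last: "V *\<^sub>v (V\<^sup>T *\<^sub>v unit_vec m (m - 1)) = unit_vec m (m - 1)"
    and N': "i + (m - l) \<le> N"
  shows "compressed_state m ((lanczos_step A ^^ (m - l)) (Q * V, x, i)) (Z * extend_id (N - i) V)"
proof -
  let ?r = "N - i"
  let ?P = "extend_id ?r V"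
  let ?Z = "Z * ?P"
  have i: "m \<le> i" "i \<le> N" and Z: "Z \<in> carrier_mat n (m + ?r)" "orthonormal_cols Z"
    and Zq: "\<And>j. m - 1 \<le> j \<Longrightarrow> j < m + ?r \<Longrightarrow> col Z j = q (i + 1 + j - m)"
    and Zres: "Z\<^sup>T *\<^sub>v residual = 0\<^sub>v (m + ?r)"
    and Q: "Q = mat_of_cols n (map (col Z) [0..<m])" and x: "i < N \<Longrightarrow> x = q (i + 1)"
    using s by (auto simp: compressed_state_def)
  note P = extend_id(1,2)[OF V(1,2), of ?r]
  have ZP: "?Z \<in> carrier_mat n (l + ?r)" "orthonormal_cols ?Z"
    using Z P orthonormal_cols_mult[OF Z P] by auto
  have Zc: "col Z j \<in> carrier_vec n" for j using Z(1) by (intro carrier_vecI) simp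
  have Qm: "Q \<in> carrier_mat n m" unfolding Q using mat_of_cols_carrier(1)[of n "map (col Z) [0..<m]"] by simp
  have Qcol: "col Q j = col Z j" if "j < m" for j
    unfolding Q using that Zc by (subst col_mat_of_cols) auto
  have Qo: "orthonormal_cols Q" using Z Qm Qcol unfolding orthonormal_cols_iff by auto
  have colZP: "col ?Z j = Z *\<^sub>v col ?P j" if "j < l + ?r" for j
    using Z P that by (intro eq_vecI) auto
  have Vc: "col V j \<in> carrier_vec m" for j using V(1) by (intro carrier_vecI) simp
  have colZ1: "col ?Z j = col (Q * V) j" if "j < l" for j
  proof -
    have "col ?Z j = Z *\<^sub>v (col V j @\<^sub>v 0\<^sub>v ?r)"
      using colZP[of j] col_extend_id[OF V(1), of j ?r] that by simp
    also have "\<dots> = Q *\<^sub>v col V j" unfolding Q using first_cols_mult_vec[OF Z(1) Vc] by simp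
    also have "\<dots> = col (Q * V) j" using Qm V that by (intro eq_vecI) auto
    finally show ?thesis .
  qed
  have colZ2: "col ?Z j = q (i + 1 + (j - l))" if "l \<le> j" "j < l + ?r" for j
  proof -
    have "col ?Z j = Z *\<^sub>v unit_vec (m + ?r) (m + (j - l))"
      using colZP[of j] col_extend_id[OF V(1), of j ?r] that by simp
    also have "\<dots> = col Z (m + (j - l))"
      using that Z by (intro col_eq_mult_unit_vec[symmetric]) auto
    also have "\<dots> = q (i + 1 + (m + (j - l)) - m)" by (rule Zq) (use that V(3) in auto)
    also have "i + 1 + (m + (j - l)) - m = i + 1 + (j - l)" by arith
    finally show ?thesis .
  qed
  have QV: "Q * V \<in> carrier_mat n l" "orthonormal_cols (Q * V)"
    using Qm V orthonormal_cols_mult[OF Qm Qo V(1,2)] by auto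
  have orth: "col (Q * V) j \<bullet> q a = 0" if "j < l" "i < a" "a \<le> N" for j a
  proof -
    define b where "b = l + (a - i - 1)"
    have b: "b < l + ?r" "j \<noteq> b" "q a = col ?Z b"
      using colZ2[of b] that by (auto simp: b_def)
    then have "col ?Z j \<bullet> col ?Z b = 0"
      using ZP that(1) unfolding orthonormal_cols_iff by auto
    then show ?thesis using b(3) colZ1[OF that(1)] by simp
  qed
  let ?e = "unit_vec m (m - 1) :: real vec"
  have qi: "q i = Q *\<^sub>v ?e"
  proof -
    have "q i = col Z (m - 1)" using Zq[of "m - 1"] V(3) i by simp
    then show ?thesis using Qcol[of "m - 1"] col_eq_mult_unit_vec[OF Qm, of "m - 1"] V(3) by simp
  qed
  have proj: "(Q * V) *\<^sub>v ((Q * V)\<^sup>T *\<^sub>v q i) = q i"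
  proof -
    have "(Q * V)\<^sup>T *\<^sub>v q i = V\<^sup>T *\<^sub>v (Q\<^sup>T *\<^sub>v (Q *\<^sub>v ?e))"
      unfolding qi transpose_mult[OF Qm V(1)] using Qm V by (intro assoc_mult_mat_vec) auto
    also have "Q\<^sup>T *\<^sub>v (Q *\<^sub>v ?e) = ?e" using Qm Qo by (intro orthonormal_cols_cancel) auto
    finally have "(Q * V) *\<^sub>v ((Q * V)\<^sup>T *\<^sub>v q i) = (Q * V) *\<^sub>v (V\<^sup>T *\<^sub>v ?e)" by simp
    also have "\<dots> = Q *\<^sub>v (V *\<^sub>v (V\<^sup>T *\<^sub>v ?e))" using Qm V by (intro assoc_mult_mat_vec) auto
    finally show ?thesis unfolding last qi .
  qed
  obtain x' where x': "(lanczos_step A ^^ (m - l)) (Q * V, x, i)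
      = (mat_of_cols n (cols (Q * V) @ map q [i + 1..<i + (m - l) + 1]), x', i + (m - l))"
      "i + (m - l) < N \<longrightarrow> x' = q (i + (m - l) + 1)"
    using lanczos_steps[OF QV _ N' orth proj x] i V(3) by auto
  have r: "l + ?r = m + (N - (i + (m - l)))" using N' V(3) i by simp
  have "cols (Q * V) @ map q [i + 1..<i + (m - l) + 1] = map (col ?Z) [0..<m]"
  proof (rule nth_equalityI)
    fix j assume "j < length (cols (Q * V) @ map q [i + 1..<i + (m - l) + 1])"
    then have "j < m" using carrier_matD[OF QV(1)] V(3) by (simp del: upt_Suc index_mult_mat)
    then show "(cols (Q * V) @ map q [i + 1..<i + (m - l) + 1]) ! j = map (col ?Z) [0..<m] ! j"
      using QV V(1,3) colZ1[of j] colZ2[of j] N' by (auto simp: nth_append simp del: upt_Suc col_mult2)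
  qed (use QV V(3) in auto)
  moreover have "?Z\<^sup>T *\<^sub>v residual = 0\<^sub>v (l + ?r)"
  proof -
    have "?Z\<^sup>T *\<^sub>v residual = ?P\<^sup>T *\<^sub>v (Z\<^sup>T *\<^sub>v residual)"
      unfolding transpose_mult[OF Z(1) P(1)] using Z P residual_carrier
      by (intro assoc_mult_mat_vec) auto
    also have "\<dots> = 0\<^sub>v (l + ?r)"
      unfolding Zres using P(1) by (intro mult_mat_zero_vec) (simp only: transpose_carrier_mat)
    finally show ?thesis .
  qed
  \<comment> \<open>Because \<open>l < m\<close>, at least one vector is appended, and so column
    \<open>m - 1\<close> is a Lanczos vector again.\<close>
  moreover have "col ?Z j = q (i + (m - l) + 1 + j - m)" if "m - 1 \<le> j" "j < l + ?r" for j
  proof -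
    have index: "i + (m - l) + 1 + j - m = i + 1 + (j - l)" and "l \<le> j" using that V(3) i by auto
    then show ?thesis unfolding index using that(2) by (intro colZ2)
  qed
  ultimately show ?thesis
    using x' i N' ZP r by (simp add: compressed_state_def)
qed

text \<open>Column \<open>j\<close> is a Lanczos vector \<open>q b\<close> with
  \<open>b > i\<close>, and \<open>A *\<^sub>v q b\<close> involves only \<open>q (b - 1)\<close>,
  \<open>q b\<close> and \<open>q (b + 1)\<close>, or the residual when \<open>b = N\<close>. These
  vectors occur among the columns from \<open>m - 1\<close> on or are orthogonal to all columns,
  hence are orthogonal to column \<open>a\<close>.\<close>

lemma compressed_state_zero:
  assumes s: "compressed_state m (Q, x, i) Z" and m: "1 \<le> m"
    and aj: "a < m - 1" "m \<le> j" "j < m + (N - i)"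
  shows "(Z\<^sup>T * A * Z) $$ (a, j) = 0"
proof -
  let ?r = "N - i"
  have i: "m \<le> i" "i \<le> N" and Z: "Z \<in> carrier_mat n (m + ?r)" "orthonormal_cols Z"
    and Zq: "\<And>j. m - 1 \<le> j \<Longrightarrow> j < m + ?r \<Longrightarrow> col Z j = q (i + 1 + j - m)"
    and Zres: "Z\<^sup>T *\<^sub>v residual = 0\<^sub>v (m + ?r)"
    using s by (auto simp: compressed_state_def)
  define v where "v = col Z a"
  define b where "b = i + 1 + j - m"
  have v: "v \<in> carrier_vec n" unfolding v_def using Z(1) by (intro carrier_vecI) simp
  have ortho: "v \<bullet> q c = 0" if "i \<le> c" "c \<le> N" for c
  proof -
    have "q c = col Z (c + m - 1 - i)" "c + m - 1 - i < m + ?r" "c + m - 1 - i \<noteq> a"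
      using Zq[of "c + m - 1 - i"] that m i aj by auto
    then show ?thesis using Z aj unfolding v_def orthonormal_cols_iff by auto
  qed
  have "v \<bullet> residual = (Z\<^sup>T *\<^sub>v residual) $ a" using Z aj by (simp add: v_def)
  then have "v \<bullet> residual = 0" unfolding Zres using aj by simp
  moreover have b: "i < b" "b \<le> N" using aj by (auto simp: b_def)
  ultimately have "v \<bullet> (A *\<^sub>v q b) = 0"
    using scalar_prod_A_q[of b v] v ortho[of b] ortho[of "b - 1"] ortho[of "b + 1"] by auto
  then show ?thesis
    using congruence_index[OF A(1) Z(1), of a j] aj Zq[of j] by (simp add: v_def b_def)
qed

lemma compressed_state_leading_block:
  assumes s: "compressed_state m (Q, x, i) Z"
  shows "leading_block m (Z\<^sup>T * A * Z) = Q\<^sup>T * A * Q"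
proof (rule eq_matI)
  let ?r = "N - i"
  have Z: "Z \<in> carrier_mat n (m + ?r)" and Q: "Q = mat_of_cols n (map (col Z) [0..<m])"
    using s by (auto simp: compressed_state_def)
  have Zc: "col Z j \<in> carrier_vec n" for j using Z by (intro carrier_vecI) simp
  have Qm: "Q \<in> carrier_mat n m" unfolding Q using mat_of_cols_carrier(1)[of n "map (col Z) [0..<m]"] by simp
  have Qcol: "col Q j = col Z j" if "j < m" for j
    unfolding Q using that Zc by (subst col_mat_of_cols) auto
  show "dim_row (leading_block m (Z\<^sup>T * A * Z)) = dim_row (Q\<^sup>T * A * Q)"
    "dim_col (leading_block m (Z\<^sup>T * A * Z)) = dim_col (Q\<^sup>T * A * Q)"
    using Qm by (auto simp: leading_block_def)
  fix a j assume "a < dim_row (Q\<^sup>T * A * Q)" "j < dim_col (Q\<^sup>T * A * Q)"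
  then have "a < m" "j < m" using Qm by auto
  then show "leading_block m (Z\<^sup>T * A * Z) $$ (a, j) = (Q\<^sup>T * A * Q) $$ (a, j)"
    using congruence_index[OF A(1) Z, of a j] congruence_index[OF A(1) Qm, of a j] Qcol
    by (simp add: leading_block_def)
qed

end

text \<open>The last unit vector lies in the Krylov space: take the denominator itself as numerator.
  This is what lets the expansion continue with the original Lanczos vectors after a
  compression.\<close>

lemma compression_matrix_last:
  fixes T :: "real mat"
  assumes compr: "compression_matrix tol k T h p q V"
    and T: "T \<in> carrier_mat m m" "T\<^sup>T = T" and k: "1 \<le> k" "k < m"
    and poles: "\<And>x. poly q x = 0 \<Longrightarrow> \<not> eigenvalue T x"
  shows "V *\<^sub>v (V\<^sup>T *\<^sub>v unit_vec m (m - 1)) = unit_vec m (m - 1)"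
proof -
  note C = compression_matrixD[OF compr T(1) k]
  define l where "l = dim_col V"
  have V: "V \<in> carrier_mat m l" "orthonormal_cols V" using C(1,3) unfolding l_def .
  let ?b = "unit_vec m (m - 1) :: real vec"
  obtain S where S: "ordered_eigenvectors T m S"
      "vec_space.col_space m V =
         {u + w | u w. u \<in> vec_space.col_space m (mat_of_cols m (take h (cols S))) \<and>
                       w \<in> rational_krylov T ?b p q}"
    using C(7) by blast
  note DS = ordered_eigenvectorsD[OF S(1) T(1)]
  have qT: "poly q (eigval T (Suc j)) \<noteq> 0" if "j < m" for j
    using poles eigenvalue_eigval[OF T that] by blast
  define e where "e = ?b - V *\<^sub>v (V\<^sup>T *\<^sub>v ?b)"
  have b: "?b \<in> carrier_vec m" and Vb: "V\<^sup>T *\<^sub>v ?b \<in> carrier_vec l"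
    and VVb: "V *\<^sub>v (V\<^sup>T *\<^sub>v ?b) \<in> carrier_vec m" using V by auto
  have e: "e \<in> carrier_vec m" using VVb by (simp add: e_def)
  have Vte: "V\<^sup>T *\<^sub>v e = 0\<^sub>v l"
    unfolding e_def using V VVb Vb orthonormal_cols_cancel[OF V Vb]
    by (subst mult_minus_distrib_mat_vec[of _ l m]) auto
  obtain w where w: "w \<in> rational_krylov T ?b p q" "w \<in> carrier_vec m"
      "\<forall>j<m. col S j \<bullet> w = poly q (eigval T (Suc j)) / poly q (eigval T (Suc j)) * (col S j \<bullet> ?b)"
    using rational_krylov_spectral[OF T S(1), of q ?b q p] qT by auto
  have "?b \<bullet> e = (\<Sum>j<m. (col S j \<bullet> ?b) * (col S j \<bullet> e))"
    by (rule parseval[OF DS(1,2) b e])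
  also have "\<dots> = (\<Sum>j<m. (col S j \<bullet> w) * (col S j \<bullet> e))"
    using w(3) qT by (intro sum.cong refl) (simp del: scalar_prod_right_unit)
  also have "\<dots> = w \<bullet> e" by (rule parseval[OF DS(1,2) w(2) e, symmetric])
  also have "\<dots> = 0"
    by (rule compression_range_orthogonal(1)[OF T S(1) _ V(1) S(2) _ b e Vte w(1,2)])
      (use qT C(5) in auto)
  finally have be: "?b \<bullet> e = 0" .
  have "(V *\<^sub>v (V\<^sup>T *\<^sub>v ?b)) \<bullet> e = 0"
    unfolding scalar_prod_mult_mat_vec(2)[OF V(1) e Vb] Vte using Vb by simp
  then have "e \<bullet> e = 0"
    using minus_scalar_prod_distrib[OF b VVb e] unfolding be e_def[symmetric] by linarith
  then have "e = 0\<^sub>v m" using scalar_prod_self_eq_0[OF e] by simp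
  then have "e $ i = 0" if "i < m" for i using that by simp
  moreover have "e $ i = ?b $ i - (V *\<^sub>v (V\<^sup>T *\<^sub>v ?b)) $ i" if "i < m" for i
    unfolding e_def using that carrier_vecD[OF VVb] by (intro index_minus_vec(1)) simp
  ultimately have "?b $ i = (V *\<^sub>v (V\<^sup>T *\<^sub>v ?b)) $ i" if "i < m" for i
    using that by fastforce
  then show ?thesis by (intro eq_vecI) (use V in auto)
qed

section \<open>The returned trace and the accumulation over all compressions\<close>

lemma mat_trace_congruence_eigenvectors:
  fixes A :: "real mat"
  assumes A: "A \<in> carrier_mat n n" and Q: "Q \<in> carrier_mat n m"
    and S: "ordered_eigenvectors (Q\<^sup>T * A * Q) k S"
  shows "mat_trace ((Q * S)\<^sup>T * A * (Q * S)) = (\<Sum>i<k. eigval (Q\<^sup>T * A * Q) (Suc i))"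
proof -
  let ?T = "Q\<^sup>T * A * Q"
  have T: "?T \<in> carrier_mat m m" using A Q by simp
  note D = ordered_eigenvectorsD[OF S T]
  have QS: "Q * S \<in> carrier_mat n k" using Q D by auto
  have col: "col (Q * S) i = Q *\<^sub>v col S i" if "i < k" for i
    using Q D that by (intro eq_vecI) auto
  have "((Q * S)\<^sup>T * A * (Q * S)) $$ (i, i) = eigval ?T (Suc i)" if "i < k" for i
  proof -
    have "((Q * S)\<^sup>T * A * (Q * S)) $$ (i, i) = (Q *\<^sub>v col S i) \<bullet> (A *\<^sub>v (Q *\<^sub>v col S i))"
      using congruence_index[OF A QS that that] col[OF that] by simp
    also have "\<dots> = col S i \<bullet> (?T *\<^sub>v col S i)"
      using scalar_prod_congruence[OF A Q D(3)[OF that] D(3)[OF that]] by simp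
    also have "\<dots> = eigval ?T (Suc i)"
      unfolding D(4)[OF that] using D(1,2,3) that unfolding orthonormal_cols_iff by simp
    finally show ?thesis .
  qed
  moreover have "dim_row ((Q * S)\<^sup>T * A * (Q * S)) = k" using QS D(1) by simp
  ultimately show ?thesis unfolding mat_trace_def by (intro sum.cong) (simp_all only: lessThan_iff)
qed

theorem theorem3p2:
  fixes A :: "real mat" and q1 :: "real vec" and n k m Ncomp Lan :: nat and tol :: real
    and q :: "nat \<Rightarrow> real vec" and \<alpha> \<beta> :: "nat \<Rightarrow> real"
    and V :: "nat \<Rightarrow> real mat" and h :: "nat \<Rightarrow> nat" and num den :: "nat \<Rightarrow> real poly"
    and S U TLan :: "real mat" and T :: "nat \<Rightarrow> real mat"
  assumes A: "A \<in> carrier_mat n n" "A\<^sup>T = A"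
    and k: "1 \<le> k" "k < n" "k < m"
    and gaps: "\<And>i. i \<in> {1..k} \<Longrightarrow> eigval A i < eigval A (i + 1)"
    and q1: "q1 \<in> carrier_vec n" "vnorm q1 = 1"
    and lanczos: "lanczos_process A q1 Lan q \<alpha> \<beta>"
    and TLan: "TLan = lanczos_tridiag \<alpha> \<beta> Lan"
    and T: "\<And>c. T c = lc_projected A q m V c"
    and compression: "\<And>c. c < Ncomp \<Longrightarrow> compression_matrix tol k (T c) (h c) (num c) (den c) (V c)"
    and Lan: "Lan = lc_matvecs A q m V Ncomp"
    and ritz: "ordered_eigenvectors (T Ncomp) k S" "U = lc_basis A q m V Ncomp * S"
    and tol: "0 < tol" "tol < 1 / 2"
    and tolerance: "\<And>c x. c < Ncomp \<Longrightarrow>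
      x \<in> {eigval A 1..eigval (T c) m} - {eigval (T c) k<..<eigval (T c) (h c + 1)} \<Longrightarrow>
      \<bar>poly (num c) x / poly (den c) x - step_fun (split_tau (T c) k (h c)) x\<bar> < tol"
    and poles: "\<And>c x. c < Ncomp \<Longrightarrow> poly (den c) x = 0 \<Longrightarrow>
      \<not> eigenvalue (T c) x \<and> \<not> eigenvalue (compressed_tridiag TLan m V c) x"
    and generic: "\<And>c. c < Ncomp \<Longrightarrow> num_poles (num c) (den c) \<le> m \<and>
      subspace_dim m (rational_krylov (T c) (unit_vec m (m - 1)) (num c) (den c))
        = num_poles (num c) (den c)"
  shows "mat_trace (U\<^sup>T * A * U) - (\<Sum>i=1..k. eigval TLan i)
           \<le> 4 * real k * real Ncomp * (eigval A n - eigval A 1) * tol\<^sup>2"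
proof -
  let ?s = "lc_state A q m V"
  let ?mv = "lc_matvecs A q m V"
  have state_Suc: "?s (Suc c) = (lanczos_step A ^^ (m - dim_col (V c)))
      (lc_basis A q m V c * V c, fst (snd (?s c)), ?mv c)" for c
    by (simp add: split_beta lc_basis_def lc_matvecs_def)
  have state: "?s c = (lc_basis A q m V c, fst (snd (?s c)), ?mv c)" for c
    by (simp add: lc_basis_def lc_matvecs_def)
  have count: "snd (snd ((lanczos_step A ^^ t) s)) = snd (snd s) + t" for t s
    by (induction t) (auto simp: lanczos_step_def Let_def split: prod.splits)
  have mv_0: "?mv 0 = m" by (simp add: lc_matvecs_def)
  have mv_Suc: "?mv (Suc c) = ?mv c + (m - dim_col (V c))" for c
    using state_Suc[of c] count by (simp add: lc_matvecs_def)
  have mv_mono: "?mv c \<le> ?mv d" if "c \<le> d" for c d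
    using lift_Suc_mono_le[of ?mv c d] that by (simp add: mv_Suc)
  have mLan: "m \<le> Lan" using mv_mono[of 0 Ncomp] by (simp add: mv_0 Lan)
  interpret lanczos A n Lan q1 q \<alpha> \<beta>
    by unfold_locales (use A q1 lanczos mLan k in auto)
  let ?D = "4 * real k * (eigval A n - eigval A 1) * tol\<^sup>2"
  let ?F = "\<lambda>Z. \<Sum>i<k. eigval (Z\<^sup>T * A * Z) (Suc i)"
  \<comment> \<open>The induction starts from the Lanczos basis, whose projection is
    \<open>TLan\<close>, and each compression adds at most \<open>?D\<close> to the sum of the
    \<open>k\<close> smallest eigenvalues of the completed projection.\<close>
  have "\<exists>Z. compressed_state m (?s c) Z \<and> ?F Z \<le> ?F lanczos_basis + real c * ?D"
    if "c \<le> Ncomp" for c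
    using that
  proof (induction c)
    case 0
    show ?case using compressed_state_0[of m V] k mLan by (intro exI[of _ lanczos_basis]) auto
  next
    case (Suc c)
    then have c: "c < Ncomp" by simp
    obtain Z where Z: "compressed_state m (?s c) Z" "?F Z \<le> ?F lanczos_basis + real c * ?D"
      using Suc by auto
    let ?Q = "lc_basis A q m V c" and ?x = "fst (snd (?s c))" and ?i = "?mv c"
    let ?r = "Lan - ?i" and ?T = "Z\<^sup>T * A * Z"
    have s: "compressed_state m (?Q, ?x, ?i) Z" using Z(1) by (simp flip: state)
    have i: "m \<le> ?i" "?i \<le> Lan" and Zm: "Z \<in> carrier_mat n (m + ?r)" "orthonormal_cols Z"
      using s by (auto simp: compressed_state_def)
    have lead: "leading_block m ?T = T c"
      using compressed_state_leading_block[OF s] T by (simp add: lc_projected_def)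
    note T' = transpose_congruence[OF A Zm(1)]
    note Tc = leading_block_congruence(1,2)[OF T', of m, unfolded lead, simplified]
    note C = compression_matrixD[OF compression[OF c] Tc(1) k(1,3)]
    have Vlast: "V c *\<^sub>v ((V c)\<^sup>T *\<^sub>v unit_vec m (m - 1)) = unit_vec m (m - 1)"
      by (rule compression_matrix_last[OF compression[OF c] Tc k(1,3)]) (use poles[OF c] in blast)
    \<comment> \<open>\<open>Lan\<close> is the final count and counts never decrease, so no
      expansion of an earlier round runs past \<open>q Lan\<close>.\<close>
    have iN: "?i + (m - dim_col (V c)) \<le> Lan"
      using mv_mono[of "Suc c" Ncomp] c by (simp add: mv_Suc Lan)
    define Z' where "Z' = Z * extend_id ?r (V c)"
    have s': "compressed_state m (?s (Suc c)) Z'"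
      unfolding state_Suc Z'_def using compressed_state_Suc[OF s C(1,3,2) Vlast iN] .
    note P = extend_id(1,2)[OF C(1,3), of ?r]
    have "Z'\<^sup>T * A * Z' = (extend_id ?r (V c))\<^sup>T * ?T * extend_id ?r (V c)"
    proof -
      let ?P = "extend_id ?r (V c)" and ?l = "dim_col (V c) + ?r"
      have Pt: "?P\<^sup>T \<in> carrier_mat ?l (m + ?r)" and Zt: "Z\<^sup>T \<in> carrier_mat (m + ?r) n"
        using P Zm by (auto simp only: transpose_carrier_mat)
      have "Z'\<^sup>T * A * Z' = (?P\<^sup>T * Z\<^sup>T) * A * (Z * ?P)"
        unfolding Z'_def transpose_mult[OF Zm(1) P(1)] ..
      also have "\<dots> = ?P\<^sup>T * (Z\<^sup>T * A) * (Z * ?P)"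
        using assoc_mult_mat[OF Pt Zt A(1)] by simp
      also have "\<dots> = ?P\<^sup>T * (Z\<^sup>T * A) * Z * ?P"
        by (rule assoc_mult_mat[symmetric]) (use Pt Zt Zm P A in \<open>auto simp del: index_mat_four_block\<close>)
      also have "?P\<^sup>T * (Z\<^sup>T * A) * Z = ?P\<^sup>T * ?T"
        by (rule assoc_mult_mat) (use Pt Zt Zm P A in \<open>auto simp del: index_mat_four_block\<close>)
      finally show ?thesis .
    qed
    moreover have "(\<Sum>i<k. eigval ((extend_id ?r (V c))\<^sup>T * ?T * extend_id ?r (V c)) (Suc i))
        \<le> ?F Z + ?D"
    proof -
      \<comment> \<open>The full order is \<open>m + ?r\<close>; leaving \<open>m + ?r - m\<close>
        unsimplified matches the form \<open>n - m\<close> of the one-step bound.\<close>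
      have "(\<Sum>i<k. eigval ((extend_id (m + ?r - m) (V c))\<^sup>T * ?T * extend_id (m + ?r - m) (V c)) (Suc i))
          \<le> ?F Z + ?D"
      proof (rule compression_step[OF T' k(1,3), unfolded lead])
        show "compression_matrix tol k (T c) (h c) (num c) (den c) (V c)" by (rule compression[OF c])
        show "?T $$ (a, j) = 0" if "a < m - 1" "m \<le> j" "j < m + ?r" for a j
          using compressed_state_zero[OF s _ that] k by simp
        show "eigval A 1 \<le> eigval A n" by (rule eigval_mono[OF A]) (use k in auto)
        show "eigval A 1 \<le> eigval ?T j" "eigval ?T j \<le> eigval A n" if "1 \<le> j" "j \<le> m + ?r" for j
          using eigval_congruence_bounds[OF A Zm that] by auto
        \<comment> \<open>At least \<open>m - dim_col (V c)\<close> Lanczos vectors are still to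
          come, so the compressed matrix has order at least \<open>m\<close>, which exceeds
          \<open>k\<close>.\<close>
        show "k \<le> dim_col (V c) + (m + ?r - m)" using iN k C(2) by simp
      qed (use tol tolerance[OF c] poles[OF c] in auto)
      then show ?thesis by simp
    qed
    ultimately have "?F Z' \<le> ?F lanczos_basis + real (Suc c) * ?D"
      using Z(2) by (simp add: algebra_simps)
    then show ?case using s' by blast
  qed
  then obtain Z where Z: "compressed_state m (?s Ncomp) Z"
      "?F Z \<le> ?F lanczos_basis + real Ncomp * ?D"
    by blast
  let ?Q = "lc_basis A q m V Ncomp"
  have s: "compressed_state m (?Q, fst (snd (?s Ncomp)), ?mv Ncomp) Z" using Z(1) by (simp flip: state)
  \<comment> \<open>At the end the count equals \<open>Lan\<close>, no Lanczos vector is left to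
    append, and the completed basis is the basis itself.\<close>
  have Zm: "Z \<in> carrier_mat n m" and Q: "?Q = mat_of_cols n (map (col Z) [0..<m])"
    using s by (auto simp: compressed_state_def Lan[symmetric])
  have "map (col Z) [0..<m] = cols Z" using Zm by (simp add: cols_def)
  then have QZ: "?Q = Z" unfolding Q using Zm mat_of_cols_cols[of Z] by simp
  have TN: "T Ncomp = Z\<^sup>T * A * Z" unfolding T lc_projected_def QZ ..
  have "mat_trace (U\<^sup>T * A * U) = ?F Z"
    unfolding ritz(2) QZ by (rule mat_trace_congruence_eigenvectors[OF A(1) Zm ritz(1)[unfolded TN]])
  moreover have "(\<Sum>i=1..k. eigval TLan i) = ?F lanczos_basis"
    unfolding TLan lanczos_tridiag_eq by (simp add: sum.atLeast1_atMost_eq)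
  ultimately show ?thesis using Z(2) by (simp add: algebra_simps)
qed

end
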